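(* Let $m\geq 1$ and $a$ be integers. Then for every $c\in(1,4/3)$ there exists $\varepsilon>0$ such that, uniformly for $x\geq 1$, \[ \left|\{n\leq x:\ s_Z(\lfloor n^c\rfloor)\equiv a\bmod m\}\right|=\frac xm+O\left(x^{1-\varepsilon}\right), \] where $n$ ranges over positive integers.
   Context: Let $F_0=0$, $F_1=1$, $F_k=F_{k-1}+F_{k-2}$ be the Fibonacci numbers. By Zeckendorf's theorem every positive integer $n$ has a unique representation $n=\sum_{i\geq 2}\varepsilon_i(n)F_i$ with $\varepsilon_i(n)\in\{0,1\}$ and $\varepsilon_i(n)=1\Rightarrow\varepsilon_{i+1}(n)=0$. The Zeckendorf sum-of-digits is $s_Z(n)=\sum_{i\geq 2}\varepsilon_i(n)$, with $s_Z(0)=0$. $\lfloor\cdot\rfloor$ is the floor function. *)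

theory Defs
  imports "HOL-Analysis.Analysis"
begin

fun fibZ :: "nat \<Rightarrow> nat" where
  "fibZ 0 = 0"
| "fibZ (Suc 0) = 1"
| "fibZ (Suc (Suc k)) = fibZ (Suc k) + fibZ k"

definition zeck_rep :: "nat \<Rightarrow> nat set \<Rightarrow> bool" where
  "zeck_rep n S \<longleftrightarrow> finite S \<and> S \<subseteq> {2..} \<and> (\<forall>i\<in>S. Suc i \<notin> S) \<and> (\<Sum>i\<in>S. fibZ i) = n"

text \<open>Zeckendorf sum of digits (number of nonzero digits of the unique representation).
 For n = 0 the unique representation is the empty set, giving 0.\<close>
definition sZ :: "nat \<Rightarrow> nat" where
  "sZ n = card (THE S. zeck_rep n S)"

end

theory Submission
  imports Defs
begin

text \<open>
Put \<open>\<gamma> = 1 / c\<close> and let \<open>w k = \<lceil>(k + 1)\<^sup>\<gamma>\<rceil> - \<lceil>k\<^sup>\<gamma>\<rceil>\<close> be the number of \<open>n\<close> with \<open>\<lfloor>n\<^sup>c\<rfloor> = k\<close>.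
By orthogonality it suffices to save a power in \<open>\<Sum>k<B. \<omega> ^ sZ k * w k\<close> for every \<open>\<omega> \<noteq> 1\<close> of modulus 1.
Cut the range at \<open>k \<approx> K\<close> into Zeckendorf blocks \<open>{u..<u + F}\<close> with \<open>F\<close> slightly below \<open>K\<^sup>1\<^sup>/\<^sup>2\<close>, so that
\<open>sZ (u + r) = sZ u + sZ r\<close>. On a block \<open>k\<^sup>\<gamma>\<close> is so close to linear that \<open>w (u + r)\<close> is, up to a negligible set
of \<open>r\<close>, the indicator of a short interval modulo 1 at a linear function of \<open>r\<close> with slope
\<open>\<approx> \<gamma> * u powr (\<gamma> - 1)\<close>. Slopes are rounded to multiples of \<open>1 / Q\<close>, which makes its Fourier expansion a finite
one. The zero frequency contributes the sums \<open>\<Sum>r<F. \<omega> ^ sZ r\<close>, which satisfy a linear recurrence whose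
growth rate is below the golden ratio. The other frequencies involve the \<^emph>\<open>same\<close> exponential polynomial
\<open>\<Sum>r<F. \<omega> ^ sZ r * ee (r * \<theta>)\<close> for all blocks, taken at the well-spaced points \<open>\<theta>\<close> given by the slopes; the
large sieve then gives square-root cancellation on average, in total \<open>K\<^sup>3\<^sup>/\<^sup>4\<close> up to small powers, and this
beats the trivial bound \<open>K\<^sup>\<gamma>\<close> exactly when \<open>c < 4/3\<close>.
\<close>

section \<open>Zeckendorf blocks\<close>

text \<open>The block length n is squeezed from both sides. On a block,
  \<open>k powr \<gamma>\<close> departs from a line by about
  \<open>n\<^sup>2 * K powr (\<gamma> - 2)\<close>, which has to stay below the interval length
  \<open>K powr (\<gamma> - 1)\<close>; so n stays below the square root of K. For such n the large
  sieve yields about K / sqrt n, so shorter blocks lose. Both constraints meet at K to the power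
  3/4. The natural scale of the frequencies h is A = \<open>K powr (1 - \<gamma>)\<close>. For h
  below A the multiplied slopes crowd together, for h above A they spread over many unit intervals;
  both effects cost sqrt (h / A) + sqrt (A / h), which is bounded near h = A. The sharp indicator of
  an interval has coefficients decaying like 1 / h, too slowly against sqrt h, hence the smoothing.
  No pointwise bound for the twisted digit sums at a nonzero frequency is used. The large sieve
  accepts any coefficients of modulus at most 1, so the digits enter only through additivity on
  blocks and through the zero frequency. With all coefficients equal to 1 the same estimate also
  controls the places where linearisation may change a ceiling.\<close>

lemma fibZ_pos: "n \<ge> 1 \<Longrightarrow> fibZ n \<ge> 1"
proof (induction n rule: fibZ.induct)
  case (3 k)
  then show ?case by (cases k) auto
qed auto

lemma fibZ_Suc: "n \<ge> 1 \<Longrightarrow> fibZ (Suc n) = fibZ n + fibZ (n - 1)"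
  by (cases n) auto

lemma fibZ_mono: "i \<le> j \<Longrightarrow> fibZ i \<le> fibZ j"
proof (induction j)
  case (Suc j)
  have "fibZ j \<le> fibZ (Suc j)" by (cases j) auto
  with Suc show ?case by (cases "i = Suc j") auto
qed auto

text \<open>Adjacent indices are excluded, so once \<open>i - 1\<close> is removed the other indices
  lie below \<open>i - 2\<close> and by induction sum to less than \<open>fibZ (i - 2)\<close>. This
  strict bound is what forces the greedy choice of digits.\<close>

lemma zeck_rep_less_fibZ:
  assumes "zeck_rep n S" "S \<subseteq> {..<i}" "i \<ge> 1"
  shows "n < fibZ i"
  using assms
proof (induction i arbitrary: n S rule: less_induct)
  case (less i)
  show ?case
  proof (cases "i - 1 \<in> S")
    case False
    have sub: "S \<subseteq> {..<i - 1}"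
    proof
      fix k assume "k \<in> S"
      then have "k < i" "k \<noteq> i - 1" using less.prems False by auto
      then show "k \<in> {..<i - 1}" by auto
    qed
    have i: "i - 1 \<ge> 1 \<or> S = {}"
      using sub by (cases "i - 1 = 0") auto
    show ?thesis
    proof (cases "S = {}")
      case True
      then show ?thesis using less.prems fibZ_pos[of i] by (auto simp: zeck_rep_def)
    next
      case ne: False
      have "n < fibZ (i - 1)"
        using less.IH[of "i - 1" n S] less.prems i ne sub by auto
      then show ?thesis using fibZ_mono[of "i - 1" i] by linarith
    qed
  next
    case True
    then have i3: "i \<ge> 3" using less.prems unfolding zeck_rep_def by force
    define T where "T = S - {i - 1}"
    have fin: "finite S" using less.prems by (simp add: zeck_rep_def)
    have "n = fibZ (i - 1) + (\<Sum>k\<in>T. fibZ k)"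
      using less.prems True fin unfolding zeck_rep_def T_def by (metis sum.remove)
    moreover have "zeck_rep (\<Sum>k\<in>T. fibZ k) T"
      using less.prems unfolding zeck_rep_def T_def by auto
    moreover have "T \<subseteq> {..<i - 2}"
    proof
      fix k assume k: "k \<in> T"
      then have "k < i" "k \<noteq> i - 1" using less.prems unfolding T_def by auto
      moreover have "k \<noteq> i - 2"
      proof
        assume "k = i - 2"
        then have "Suc k = i - 1" using i3 by auto
        then show False using k True less.prems unfolding T_def zeck_rep_def by auto
      qed
      ultimately show "k \<in> {..<i - 2}" by auto
    qed
    ultimately have "(\<Sum>k\<in>T. fibZ k) < fibZ (i - 2)" using less.IH[of "i - 2"] i3 by auto
    moreover have "fibZ i = fibZ (i - 1) + fibZ (i - 2)"
      using fibZ_Suc[of "i - 1"] i3 by (simp add: numeral_2_eq_2)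
    ultimately show ?thesis using \<open>n = _\<close> by linarith
  qed
qed

lemma zeck_rep_subset:
  assumes "zeck_rep n S" "n < fibZ i"
  shows "S \<subseteq> {..<i}"
proof
  fix k assume k: "k \<in> S"
  have "fibZ k \<le> n" using assms k unfolding zeck_rep_def by (metis member_le_sum zero_le)
  then show "k \<in> {..<i}" using assms fibZ_mono[of i k] by (cases "k < i") auto
qed

lemma zeck_rep_insert:
  assumes "zeck_rep r S" "r < fibZ (i - 1)" "i \<ge> 2"
  shows "zeck_rep (fibZ i + r) (insert i S)"
proof -
  have "S \<subseteq> {..<i - 1}" by (rule zeck_rep_subset) (use assms in auto)
  moreover have "i \<notin> S" using calculation by auto
  ultimately show ?thesis using assms unfolding zeck_rep_def by (auto simp: subset_iff)
qed

lemma le_fibZ_Suc: "k \<le> fibZ (Suc k)"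
proof (induction k rule: less_induct)
  case (less k)
  show ?case
  proof (cases "k \<le> 1")
    case True then show ?thesis by (cases k) auto
  next
    case False
    then have l: "k = Suc (Suc (k - 2))" by auto
    then obtain l where l: "k = Suc (Suc l)" by blast
    have "Suc l \<le> fibZ (Suc (Suc l))" "1 \<le> fibZ (Suc l)"
      using less[of "Suc l"] l fibZ_pos[of "Suc l"] by auto
    then show ?thesis using l by auto
  qed
qed

lemma fibZ_cover:
  assumes "n \<ge> 1"
  obtains i where "i \<ge> 2" "fibZ i \<le> n" "n < fibZ (Suc i)"
proof -
  define i where "i = (LEAST i. n < fibZ (Suc i))"
  have ex: "n < fibZ (Suc (Suc n))" using le_fibZ_Suc[of "Suc n"] by linarith
  have i: "n < fibZ (Suc i)" unfolding i_def by (rule LeastI[of "\<lambda>i. n < fibZ (Suc i)", OF ex])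
  have "i \<ge> 2"
  proof (rule ccontr)
    assume "\<not> i \<ge> 2" then have "i = 0 \<or> i = 1" by auto
    then show False using i assms by auto
  qed
  then have "i - 1 < i" by auto
  then have "\<not> n < fibZ (Suc (i - 1))" unfolding i_def using not_less_Least by blast
  then have "fibZ i \<le> n" using \<open>i \<ge> 2\<close> by (simp add: Suc_diff_1)
  then show ?thesis using that i \<open>i \<ge> 2\<close> by blast
qed

lemma zeck_rep_exists: "\<exists>S. zeck_rep n S"
proof (induction n rule: less_induct)
  case (less n)
  show ?case
  proof (cases "n = 0")
    case True
    then show ?thesis by (intro exI[of _ "{}"]) (auto simp: zeck_rep_def)
  next
    case False
    then obtain i where i: "i \<ge> 2" "fibZ i \<le> n" "n < fibZ (Suc i)" using fibZ_cover[of n] by auto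
    have "n - fibZ i < n" using i False fibZ_pos[of i] by auto
    then obtain S where "zeck_rep (n - fibZ i) S" using less by blast
    moreover have "n - fibZ i < fibZ (i - 1)" using i fibZ_Suc[of i] by auto
    ultimately have "zeck_rep (fibZ i + (n - fibZ i)) (insert i S)" using i by (intro zeck_rep_insert) auto
    then show ?thesis using i by auto
  qed
qed

text \<open>The greedy index \<open>i\<close> lies in every representation: without it all indices
  would be below \<open>i\<close> and the value would be smaller than \<open>fibZ i\<close>.
  Removing \<open>i\<close> on both sides leaves a smaller number.\<close>

lemma zeck_rep_unique:
  assumes "zeck_rep n S" "zeck_rep n T"
  shows "S = T"
  using assms
proof (induction n arbitrary: S T rule: less_induct)
  case (less n)
  show ?case
  proof (cases "n = 0")
    case True
    have "S = {}" if "zeck_rep n S" for S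
    proof (rule ccontr)
      assume "S \<noteq> {}"
      then obtain k where k: "k \<in> S" by auto
      then have "fibZ k \<le> n" using that unfolding zeck_rep_def by (metis member_le_sum zero_le)
      moreover have "fibZ k \<ge> 1" using k that fibZ_pos[of k] unfolding zeck_rep_def by force
      ultimately show False using True by auto
    qed
    then show ?thesis using less.prems by blast
  next
    case False
    then obtain i where i: "i \<ge> 2" "fibZ i \<le> n" "n < fibZ (Suc i)" using fibZ_cover[of n] by auto
    have *: "i \<in> S \<and> zeck_rep (n - fibZ i) (S - {i})" if S: "zeck_rep n S" for S
    proof -
      have sub: "S \<subseteq> {..<Suc i}" by (rule zeck_rep_subset[OF S i(3)])
      have iS: "i \<in> S"
      proof (rule ccontr)
        assume "i \<notin> S"
        then have "S \<subseteq> {..<i}" using sub by (auto simp: subset_iff less_Suc_eq)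
        then have "n < fibZ i" using zeck_rep_less_fibZ[OF S] i by auto
        then show False using i by auto
      qed
      have "n = fibZ i + (\<Sum>k\<in>S - {i}. fibZ k)"
        using S iS unfolding zeck_rep_def by (metis sum.remove)
      then show ?thesis using S iS unfolding zeck_rep_def by auto
    qed
    have "n - fibZ i < n" using i False fibZ_pos[of i] by auto
    then have "S - {i} = T - {i}" using less.IH *[OF less.prems(1)] *[OF less.prems(2)] by blast
    then show ?thesis using *[OF less.prems(1)] *[OF less.prems(2)] by blast
  qed
qed

lemma sZ_eq_card: "zeck_rep n S \<Longrightarrow> sZ n = card S"
  unfolding sZ_def using zeck_rep_unique by (metis the_equality)

lemma sZ_0 [simp]: "sZ 0 = 0"
  using sZ_eq_card[of 0 "{}"] by (auto simp: zeck_rep_def)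

lemma sZ_fibZ_add:
  assumes "i \<ge> 2" "r < fibZ (i - 1)"
  shows "sZ (fibZ i + r) = Suc (sZ r)"
proof -
  obtain S where S: "zeck_rep r S" using zeck_rep_exists by blast
  have "S \<subseteq> {..<i - 1}" by (rule zeck_rep_subset) (use assms S in auto)
  then have "i \<notin> S" by auto
  moreover have "finite S" using S by (auto simp: zeck_rep_def)
  ultimately show ?thesis
    using sZ_eq_card[OF S] sZ_eq_card[OF zeck_rep_insert[OF S assms(2,1)]] by simp
qed

section \<open>Decomposition into additive blocks\<close>

lemma sum_lessThan_add:
  "(\<Sum>r<m + n. f r) = (\<Sum>r<m. f r) + (\<Sum>r<n. f (m + r :: nat) :: 'a::comm_monoid_add)"
  by (induction n) (auto simp: add.assoc)

text \<open>Additivity is recorded instead of a condition on the digits of \<open>u\<close>: it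
  turns the sums over all blocks into instances of one exponential polynomial. The distance
  \<open>q\<close> between starts later becomes the spacing of the slopes in the large
  sieve.\<close>

definition zeck_block_starts :: "nat \<Rightarrow> nat \<Rightarrow> nat set \<Rightarrow> bool" where
  "zeck_block_starts q N U \<longleftrightarrow> finite U \<and> (\<forall>u\<in>U. u + q \<le> N)
     \<and> (\<forall>u\<in>U. \<forall>v\<in>U. u < v \<longrightarrow> u + q \<le> v)
     \<and> (\<forall>u\<in>U. \<forall>r<q. sZ (u + r) = sZ u + sZ r)"

text \<open>The numbers from \<open>fibZ (Suc n)\<close> up to \<open>fibZ (Suc (Suc n))\<close> are
  exactly those with top index \<open>Suc n\<close>. Translating by \<open>fibZ (Suc n)\<close>
  raises \<open>sZ\<close> by 1 on both sides of the additivity relation, which therefore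
  survives.\<close>

lemma zeck_block_starts_step:
  assumes U: "zeck_block_starts q (fibZ (Suc n)) U" and W: "zeck_block_starts q (fibZ n) W"
    and "q \<ge> 1" "n \<ge> 1"
  shows "zeck_block_starts q (fibZ (Suc (Suc n))) (U \<union> (+) (fibZ (Suc n)) ` W)"
    and "U \<inter> (+) (fibZ (Suc n)) ` W = {}"
proof -
  let ?s = "(+) (fibZ (Suc n))"
  have U1: "finite U" and U2: "\<And>u. u \<in> U \<Longrightarrow> u + q \<le> fibZ (Suc n)"
    and U3: "\<And>u v. u \<in> U \<Longrightarrow> v \<in> U \<Longrightarrow> u < v \<Longrightarrow> u + q \<le> v"
    and U4: "\<And>u r. u \<in> U \<Longrightarrow> r < q \<Longrightarrow> sZ (u + r) = sZ u + sZ r"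
    using U unfolding zeck_block_starts_def by blast+
  have W1: "finite W" and W2: "\<And>u. u \<in> W \<Longrightarrow> u + q \<le> fibZ n"
    and W3: "\<And>u v. u \<in> W \<Longrightarrow> v \<in> W \<Longrightarrow> u < v \<Longrightarrow> u + q \<le> v"
    and W4: "\<And>u r. u \<in> W \<Longrightarrow> r < q \<Longrightarrow> sZ (u + r) = sZ u + sZ r"
    using W unfolding zeck_block_starts_def by blast+
  have add: "sZ (fibZ (Suc n) + k) = Suc (sZ k)" if "k < fibZ n" for k
    using sZ_fibZ_add[of "Suc n" k] that assms by auto
  show "U \<inter> ?s ` W = {}"
  proof (rule ccontr)
    assume "U \<inter> ?s ` W \<noteq> {}"
    then obtain w where "fibZ (Suc n) + w \<in> U" by auto
    from U2[OF this] show False using assms by linarith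
  qed
  show "zeck_block_starts q (fibZ (Suc (Suc n))) (U \<union> ?s ` W)"
    unfolding zeck_block_starts_def
  proof (intro conjI ballI allI impI)
    show "finite (U \<union> ?s ` W)" using U1 W1 by auto
  next
    fix u assume "u \<in> U \<union> ?s ` W"
    then show "u + q \<le> fibZ (Suc (Suc n))"
    proof
      assume "u \<in> U" from U2[OF this] show ?thesis by simp
    next
      assume "u \<in> ?s ` W"
      then obtain w where w: "w \<in> W" "u = fibZ (Suc n) + w" by auto
      from W2[OF w(1)] w(2) show ?thesis by simp
    qed
  next
    fix u v assume uv: "u \<in> U \<union> ?s ` W" "v \<in> U \<union> ?s ` W" "u < v"
    consider "u \<in> U" "v \<in> U" | w where "u \<in> U" "v = fibZ (Suc n) + w"
      | w where "v \<in> U" "u = fibZ (Suc n) + w"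
      | w w' where "w \<in> W" "w' \<in> W" "u = fibZ (Suc n) + w" "v = fibZ (Suc n) + w'"
      using uv(1,2) by auto
    then show "u + q \<le> v"
    proof cases
      case 1 then show ?thesis using U3 uv(3) by blast
    next
      case 2 then show ?thesis using U2[of u] by linarith
    next
      case 3 then show ?thesis using U2[of v] uv(3) by linarith
    next
      case 4 then show ?thesis using W3[of w w'] uv(3) by linarith
    qed
  next
    fix u r assume u: "u \<in> U \<union> ?s ` W" and r: "r < q"
    then consider "u \<in> U" | w where "w \<in> W" "u = fibZ (Suc n) + w" by auto
    then show "sZ (u + r) = sZ u + sZ r"
    proof cases
      case 1 then show ?thesis using U4 r by blast
    next
      case 2
      have "w + r < fibZ n" "w < fibZ n" using W2[OF 2(1)] r by linarith+
      then show ?thesis using add[of w] add[of "w + r"] W4[OF 2(1) r] 2(2) by (simp add: add.assoc)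
    qed
  qed
qed

text \<open>Two block lengths are unavoidable: the Fibonacci recursion descends by one or two
  indices at a time, so it can stop at \<open>j\<close> or jump over it to \<open>j - 1\<close>. The
  partition is expressed by sums of an arbitrary \<open>h\<close>, because the induction needs it
  for a translate of \<open>h\<close>.\<close>

lemma zeck_blocks:
  assumes j: "j \<ge> 2" and i: "i \<ge> j - 1"
  shows "\<exists>U V. zeck_block_starts (fibZ j) (fibZ i) U \<and> zeck_block_starts (fibZ (j - 1)) (fibZ i) V
    \<and> (\<forall>h::nat\<Rightarrow>complex. (\<Sum>k<fibZ i. h k) =
         (\<Sum>u\<in>U. \<Sum>r<fibZ j. h (u + r)) + (\<Sum>u\<in>V. \<Sum>r<fibZ (j - 1). h (u + r)))"
  using i
proof (induction i rule: less_induct)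
  case (less i)
  consider "i = j - 1" | "i = j" | "i \<ge> j + 1" using less.prems by linarith
  then show ?case
  proof cases
    case 1
    then show ?thesis
      by (intro exI[of _ "{}"] exI[of _ "{0}"]) (auto simp: zeck_block_starts_def)
  next
    case 2
    then show ?thesis
      by (intro exI[of _ "{0}"] exI[of _ "{}"]) (auto simp: zeck_block_starts_def)
  next
    case 3
    define n where "n = i - 2"
    have n: "i = Suc (Suc n)" "n \<ge> 1" "n \<ge> j - 1" "Suc n \<ge> j - 1" "n < i" "Suc n < i" using 3 j unfolding n_def by auto
    obtain U V where U: "zeck_block_starts (fibZ j) (fibZ (Suc n)) U"
      and V: "zeck_block_starts (fibZ (j - 1)) (fibZ (Suc n)) V"
      and UV: "\<And>h::nat\<Rightarrow>complex. (\<Sum>k<fibZ (Suc n). h k) =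
         (\<Sum>u\<in>U. \<Sum>r<fibZ j. h (u + r)) + (\<Sum>u\<in>V. \<Sum>r<fibZ (j - 1). h (u + r))"
      using less.IH[of "Suc n"] n by blast
    obtain U' V' where U': "zeck_block_starts (fibZ j) (fibZ n) U'"
      and V': "zeck_block_starts (fibZ (j - 1)) (fibZ n) V'"
      and UV': "\<And>h::nat\<Rightarrow>complex. (\<Sum>k<fibZ n. h k) =
         (\<Sum>u\<in>U'. \<Sum>r<fibZ j. h (u + r)) + (\<Sum>u\<in>V'. \<Sum>r<fibZ (j - 1). h (u + r))"
      using less.IH[of n] n by blast
    have j1: "fibZ j \<ge> 1" "fibZ (j - 1) \<ge> 1" using j fibZ_pos[of j] fibZ_pos[of "j - 1"] by auto
    let ?s = "(+) (fibZ (Suc n))"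
    note su = zeck_block_starts_step[OF U U' j1(1) n(2)]
    note sv = zeck_block_starts_step[OF V V' j1(2) n(2)]
    have fin: "finite U" "finite V" "finite U'" "finite V'"
      using U V U' V' by (auto simp: zeck_block_starts_def)
    have "(\<Sum>k<fibZ i. h k) = (\<Sum>u\<in>U \<union> ?s ` U'. \<Sum>r<fibZ j. h (u + r))
        + (\<Sum>u\<in>V \<union> ?s ` V'. \<Sum>r<fibZ (j - 1). h (u + r))" for h :: "nat \<Rightarrow> complex"
    proof -
      have "(\<Sum>k<fibZ i. h k) = (\<Sum>k<fibZ (Suc n). h k) + (\<Sum>k<fibZ n. h (fibZ (Suc n) + k))"
        using n by (simp add: sum_lessThan_add)
      also have "\<dots> = ((\<Sum>u\<in>U. \<Sum>r<fibZ j. h (u + r)) + (\<Sum>u\<in>V. \<Sum>r<fibZ (j - 1). h (u + r)))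
         + ((\<Sum>u\<in>U'. \<Sum>r<fibZ j. h (fibZ (Suc n) + (u + r)))
           + (\<Sum>u\<in>V'. \<Sum>r<fibZ (j - 1). h (fibZ (Suc n) + (u + r))))"
        by (simp only: UV UV'[of "\<lambda>k. h (fibZ (Suc n) + k)"])
      also have "\<dots> = (\<Sum>u\<in>U \<union> ?s ` U'. \<Sum>r<fibZ j. h (u + r))
        + (\<Sum>u\<in>V \<union> ?s ` V'. \<Sum>r<fibZ (j - 1). h (u + r))"
        using fin su(2) sv(2) by (simp add: sum.union_disjoint sum.reindex add.assoc add.left_commute)
      finally show ?thesis .
    qed
    then show ?thesis using su(1) sv(1) n(1) by blast
  qed
qed

section \<open>Power saving at frequency zero\<close>

lemma sum_fibZ_recurrence:
  assumes "n \<ge> 1"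
  shows "(\<Sum>r<fibZ (Suc (Suc n)). \<omega> ^ sZ r) =
    (\<Sum>r<fibZ (Suc n). \<omega> ^ sZ r) + (\<omega>::complex) * (\<Sum>r<fibZ n. \<omega> ^ sZ r)"
proof -
  have "(\<Sum>r<fibZ (Suc n) + fibZ n. \<omega> ^ sZ r)
      = (\<Sum>r<fibZ (Suc n). \<omega> ^ sZ r) + (\<Sum>r<fibZ n. \<omega> ^ sZ (fibZ (Suc n) + r))"
    by (rule sum_lessThan_add)
  also have "(\<Sum>r<fibZ n. \<omega> ^ sZ (fibZ (Suc n) + r)) = (\<Sum>r<fibZ n. \<omega> * \<omega> ^ sZ r)"
    using assms by (intro sum.cong) (auto simp: sZ_fibZ_add)
  finally show ?thesis by (simp add: sum_distrib_left)
qed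

text \<open>Two steps of the recurrence give \<open>s (j + 3) = (1 + \<omega>) * s (j + 1) + \<omega> * s j\<close> with \<open>norm (1 + \<omega>) < 2\<close>, whereas
the Fibonacci numbers satisfy the same relation with coefficients \<open>2\<close> and \<open>1\<close>.\<close>

lemma sum_fibZ_power_saving:
  fixes \<omega> :: complex
  assumes \<omega>: "norm \<omega> = 1" "\<omega> \<noteq> 1"
  obtains \<delta> where "0 < \<delta>" "\<delta> \<le> 1"
    "\<And>j. j \<ge> 1 \<Longrightarrow> norm (\<Sum>r<fibZ j. \<omega> ^ sZ r) \<le> 6 * real (fibZ j) powr (1 - \<delta>)"
proof -
  define \<kappa> where "\<kappa> = norm (1 + \<omega>)"
  have k0: "\<kappa> \<ge> 0" by (simp add: \<kappa>_def)
  have k2: "\<kappa> < 2"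
  proof (rule ccontr)
    assume "\<not> \<kappa> < 2"
    then have "norm (1 + \<omega>) = norm (1::complex) + norm \<omega>"
      using norm_triangle_ineq[of 1 \<omega>] \<omega> unfolding \<kappa>_def by auto
    then have "norm (1::complex) *\<^sub>R \<omega> = norm \<omega> *\<^sub>R 1" by (simp only: norm_triangle_eq)
    then show False using \<omega> by simp
  qed
  define g :: real where "g = (1 + sqrt 5) / 2"
  have g2: "g ^ 2 = g + 1" by (simp add: g_def power2_eq_square field_simps)
  have "sqrt 5 \<ge> (2::real)" "sqrt 5 \<le> (5/2::real)"
    by (rule real_le_rsqrt real_le_lsqrt; simp add: power2_eq_square)+
  then have g: "g \<ge> 3/2" "g \<le> 7/4" by (auto simp: g_def)
  \<comment> \<open>One Newton step for \<open>x ^ 3 - \<kappa> * x - 1\<close> at \<open>g\<close>,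
    with the derivative simplified to \<open>3 * g\<^sup>2\<close>. The value at \<open>g\<close> is
    \<open>(2 - \<kappa>) * g\<close> and is cancelled exactly by the linear term
    \<open>3 * g\<^sup>2 * t\<close>; what remains is nonnegative, so \<open>\<mu> < g\<close> still
    dominates the recurrence.\<close>
  define t where "t = (2 - \<kappa>) / (3 * g)"
  define \<mu> where "\<mu> = g - t"
  have t0: "t > 0" using k2 g by (simp add: t_def)
  have "t \<le> 2 / (3 * (3/2))" unfolding t_def using k0 g k2 by (intro frac_le) auto
  then have mu1: "\<mu> \<ge> 1" using g by (simp add: \<mu>_def)
  have mug: "\<mu> < g" using t0 by (simp add: \<mu>_def)
  have g3: "g ^ 3 = 2 * g + 1" using g2 by (simp add: power3_eq_cube power2_eq_square algebra_simps)
  have mu3: "\<mu> ^ 3 \<ge> \<kappa> * \<mu> + 1"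
  proof -
    have "\<mu> ^ 3 - (\<kappa> * \<mu> + 1) = (g^3 - 1 - \<kappa> * g) - 3 * g^2 * t + \<kappa> * t + t^2 * (3 * g - t)"
      unfolding \<mu>_def by (simp add: power3_eq_cube power2_eq_square algebra_simps)
    also have "g^3 - 1 - \<kappa> * g = (2 - \<kappa>) * g" using g3 by (simp add: algebra_simps)
    also have "3 * g^2 * t = (2 - \<kappa>) * g" using g by (simp add: t_def power2_eq_square)
    also have "(2 - \<kappa>) * g - (2 - \<kappa>) * g + \<kappa> * t + t^2 * (3 * g - t) \<ge> 0"
      using k0 t0 g mu1 by (auto simp: \<mu>_def intro!: add_nonneg_nonneg mult_nonneg_nonneg)
    finally show ?thesis by simp
  qed
  define s where "s = (\<lambda>j. \<Sum>r<fibZ j. \<omega> ^ sZ r)"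
  have rec: "s (Suc (Suc n)) = s (Suc n) + \<omega> * s n" if "n \<ge> 1" for n
    using sum_fibZ_recurrence[OF that] unfolding s_def by blast
  have s1: "s 1 = 1" and s2: "s 2 = 1" by (auto simp: s_def numeral_2_eq_2)
  have s3: "s 3 = 1 + \<omega>" using rec[of 1] s1 s2 by (simp add: numeral_2_eq_2 numeral_3_eq_3)
  have bound: "norm (s j) \<le> 2 * \<mu> ^ j" if "j \<ge> 1" for j
    using that
  proof (induction j rule: less_induct)
    case (less j)
    consider "j = 1" | "j = 2" | "j = 3" | "j \<ge> 4" using less.prems by linarith
    then show ?case
    proof cases
      case 1 then show ?thesis using s1 mu1 by simp
    next
      case 2 then show ?thesis using s2 one_le_power[OF mu1, of 2] by auto
    next
      case 3 then show ?thesis using s3 one_le_power[OF mu1, of 3] k2 by (simp add: \<kappa>_def)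
    next
      case 4
      define n where "n = j - 3"
      have n: "j = Suc (Suc (Suc n))" "n \<ge> 1" using 4 by (auto simp: n_def)
      have "s j = (1 + \<omega>) * s (Suc n) + \<omega> * s n"
        using rec[of n] rec[of "Suc n"] n by (simp add: algebra_simps)
      then have "norm (s j) \<le> norm ((1 + \<omega>) * s (Suc n)) + norm (\<omega> * s n)"
        using norm_triangle_ineq by metis
      also have "\<dots> = \<kappa> * norm (s (Suc n)) + norm (s n)" using \<omega> by (simp add: norm_mult \<kappa>_def)
      also have "\<dots> \<le> \<kappa> * (2 * \<mu> ^ Suc n) + 2 * \<mu> ^ n"
        using less.IH[of n] less.IH[of "Suc n"] n k0 by (intro add_mono mult_left_mono) auto
      also have "\<dots> = 2 * \<mu> ^ n * (\<kappa> * \<mu> + 1)" by (simp add: algebra_simps)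
      also have "\<dots> \<le> 2 * \<mu> ^ n * \<mu> ^ 3" using mu3 mu1 by (intro mult_left_mono) auto
      also have "\<dots> = 2 * \<mu> ^ j" using n by (simp add: power3_eq_cube)
      finally show ?thesis .
    qed
  qed
  \<comment> \<open>Chosen so that \<open>\<mu> = g powr (1 - \<delta>)\<close>. Comparing
    \<open>g ^ j\<close> with \<open>fibZ j\<close> costs at most \<open>g\<^sup>2 \<le> 3\<close>,
    which with the factor 2 in \<open>bound\<close> gives the constant 6.\<close>
  define \<delta> where "\<delta> = 1 - ln \<mu> / ln g"
  have lng: "ln g > 0" using g by simp
  have lnmu: "ln \<mu> \<ge> 0" "ln \<mu> < ln g" using mu1 mug by auto
  have d: "0 < \<delta>" "\<delta> \<le> 1" using lng lnmu by (auto simp: \<delta>_def)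
  have mupow: "\<mu> = g powr (1 - \<delta>)" using g lng mu1 by (simp add: \<delta>_def powr_def)
  have fibg: "g ^ j \<le> real (fibZ j) * g^2" if "j \<ge> 1" for j
    using that
  proof (induction j rule: less_induct)
    case (less j)
    consider "j = 1" | "j = 2" | "j \<ge> 3" using less.prems by linarith
    then show ?case
    proof cases
      case 1 then show ?thesis using g by (simp add: power2_eq_square)
    next
      case 2 then show ?thesis by (simp add: numeral_2_eq_2)
    next
      case 3
      define n where "n = j - 2"
      have n: "j = Suc (Suc n)" "n \<ge> 1" using 3 by (auto simp: n_def)
      have "g ^ j = g ^ n * g^2" using n by (simp add: power2_eq_square)
      also have "\<dots> = g ^ Suc n + g ^ n" using g2 by (simp add: algebra_simps)
      also have "\<dots> \<le> real (fibZ (Suc n)) * g^2 + real (fibZ n) * g^2"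
        using less.IH[of n] less.IH[of "Suc n"] n by auto
      also have "\<dots> = real (fibZ j) * g^2" using n by (simp add: algebra_simps)
      finally show ?thesis .
    qed
  qed
  have "norm (\<Sum>r<fibZ j. \<omega> ^ sZ r) \<le> 6 * real (fibZ j) powr (1 - \<delta>)" if j: "j \<ge> 1" for j
  proof -
    have "\<mu> ^ j = (g ^ j) powr (1 - \<delta>)"
      using g by (simp add: mupow powr_realpow[symmetric] powr_powr mult.commute)
    also have "\<dots> \<le> (real (fibZ j) * g^2) powr (1 - \<delta>)"
      using fibg[OF j] d g by (intro powr_mono2) auto
    also have "\<dots> = real (fibZ j) powr (1 - \<delta>) * (g^2) powr (1 - \<delta>)" by (simp add: powr_mult)
    also have "(g^2) powr (1 - \<delta>) \<le> (g^2) powr 1" using d g by (intro powr_mono) auto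
    also have "(g^2) powr 1 \<le> 3" using g g2 by simp
    finally have "\<mu> ^ j \<le> real (fibZ j) powr (1 - \<delta>) * 3" by (simp add: mult_left_mono)
    then show ?thesis using bound[OF j] unfolding s_def by linarith
  qed
  then show ?thesis using that d by blast
qed

section \<open>Exponential sums\<close>

definition ee :: "real \<Rightarrow> complex" where "ee x = cis (2 * pi * x)"

lemma ee_add: "ee (x + y) = ee x * ee y"
  by (simp add: ee_def cis_mult algebra_simps)

lemma ee_of_int [simp]: "ee (of_int n) = 1"
  by (simp add: ee_def cis.code complex_eq_iff cos_integer_2pi sin_integer_2pi)

lemma norm_ee [simp]: "norm (ee x) = 1"
  by (simp add: ee_def)

lemma ee_0 [simp]: "ee 0 = 1" by (simp add: ee_def)

lemma cnj_ee: "cnj (ee x) = ee (- x)"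
  by (simp add: ee_def cis_cnj)

lemma ee_of_nat_mult: "ee (of_nat n * x) = ee x ^ n"
  unfolding ee_def Complex.DeMoivre by (simp add: mult_ac)

lemma ee_eq_1_iff: "ee x = 1 \<longleftrightarrow> x \<in> \<int>"
proof
  assume "ee x = 1"
  then have "cos (2 * pi * x) = 1" by (simp add: ee_def complex_eq_iff)
  then obtain n :: int where "2 * pi * x = of_int n * 2 * pi" using cos_one_2pi_int by blast
  then have "x = of_int n" by simp
  then show "x \<in> \<int>" by simp
qed (auto elim: Ints_cases)

text \<open>The distance from \<open>x\<close> to the nearest integer.\<close>

definition dnint :: "real \<Rightarrow> real" where "dnint x = min (frac x) (1 - frac x)"

text \<open>Jordan's inequality: by concavity the sine lies above its chord from 0 to
  \<open>pi/2\<close>.\<close>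

lemma sin_pi_mult_ge:
  fixes y :: real assumes "0 \<le> y" "y \<le> 1/2"
  shows "2 * y \<le> sin (pi * y)"
proof -
  have "convex_on {0..pi} (\<lambda>x. - sin x :: real)"
    by (rule f''_ge0_imp_convex[where f' = "\<lambda>x. - cos x" and f'' = sin])
       (auto intro!: derivative_eq_intros sin_ge_zero)
  from convex_onD[OF this, of "2 * y" 0 "pi/2"] assms
  show ?thesis by (simp add: algebra_simps)
qed

lemma norm_one_minus_ee: "4 * dnint x \<le> norm (1 - ee x)"
proof -
  have "ee x = ee (frac x)"
    using ee_add[of "frac x" "of_int \<lfloor>x\<rfloor>"] by (simp add: frac_def)
  moreover have "norm (1 - ee y) = 2 * \<bar>sin (pi * y)\<bar>" for y
  proof -
    have "(norm (1 - ee y))^2 = (1 - cos (2 * (pi * y)))^2 + (sin (2 * (pi * y)))^2"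
      by (simp add: ee_def cmod_power2 mult.assoc)
    also have "\<dots> = (2 * \<bar>sin (pi * y)\<bar>)^2"
    proof -
      define S C where "S = sin (pi * y)" and "C = cos (pi * y)"
      have "S * S + C * C = 1" unfolding S_def C_def using sin_cos_squared_add[of "pi * y"] by (simp add: power2_eq_square)
      then have "(1 - (1 - 2 * S^2))^2 + (2 * S * C)^2 = 4 * S^2"
        unfolding power2_eq_square by algebra
      then show ?thesis unfolding sin_double cos_double_sin S_def C_def by (simp add: power_mult_distrib)
    qed
    finally show ?thesis by (subst (asm) power2_eq_iff_nonneg) auto
  qed
  moreover have "2 * dnint x \<le> sin (pi * frac x)"
  proof (cases "frac x \<le> 1/2")
    case True
    then show ?thesis using sin_pi_mult_ge[of "frac x"] by (simp add: dnint_def)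
  next
    case False
    have "sin (pi * (1 - frac x)) = sin (pi * frac x)" by (simp add: algebra_simps sin_diff)
    then show ?thesis using sin_pi_mult_ge[of "1 - frac x"] False frac_lt_1[of x]
      by (simp add: dnint_def)
  qed
  ultimately show ?thesis by (smt (verit))
qed

lemma norm_sum_ee_le:
  assumes "dnint x > 0"
  shows "norm (\<Sum>r<n. ee (of_nat r * x)) \<le> 1 / (2 * dnint x)"
proof -
  have pos: "norm (1 - ee x) > 0" using norm_one_minus_ee[of x] assms by linarith
  then have ne: "ee x \<noteq> 1" by auto
  have "(\<Sum>r<n. ee (of_nat r * x)) = (\<Sum>r<n. ee x ^ r)" by (simp add: ee_of_nat_mult)
  also have "\<dots> = (1 - ee x ^ n) / (1 - ee x)" using ne by (simp add: sum_gp_strict)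
  also have "norm \<dots> = norm (1 - ee x ^ n) / norm (1 - ee x)" by (simp add: norm_divide)
  also have "\<dots> \<le> 2 / (4 * dnint x)"
  proof (rule frac_le)
    show "norm (1 - ee x ^ n) \<le> 2"
      using norm_triangle_ineq4[of 1 "ee x ^ n"] by (simp add: norm_power)
  qed (use norm_one_minus_ee[of x] assms in auto)
  finally show ?thesis by simp
qed

lemma norm_sum_ee_le_length: "norm (\<Sum>r<n. ee (of_nat r * x)) \<le> of_nat n"
  by (rule order_trans[OF norm_sum]) simp

lemma sum_ee_indicator:
  assumes "Q > 0"
  shows "(\<Sum>h<Q. ee (of_nat h * of_int z / of_nat Q)) = (if int Q dvd z then of_nat Q else 0)"
proof -
  have eq: "(\<Sum>h<Q. ee (of_nat h * of_int z / of_nat Q)) = (\<Sum>h<Q. ee (of_int z / of_nat Q) ^ h)"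
    by (simp flip: ee_of_nat_mult)
  have iff: "ee (of_int z / of_nat Q) = 1 \<longleftrightarrow> int Q dvd z"
  proof -
    have "ee (of_int z / of_nat Q) = 1 \<longleftrightarrow> (of_int z / of_int (int Q) :: real) \<in> \<int>"
      by (simp add: ee_eq_1_iff)
    also have "\<dots> \<longleftrightarrow> int Q dvd z" using assms by (intro of_int_div_of_int_in_Ints_iff[THEN trans]) auto
    finally show ?thesis .
  qed
  show ?thesis
  proof (cases "int Q dvd z")
    case True
    then show ?thesis unfolding eq using iff by simp
  next
    case False
    then have ne: "ee (of_int z / of_nat Q) \<noteq> 1" using iff by simp
    have "ee (of_int z / of_nat Q) ^ Q = ee (of_int z)"
      using assms by (simp flip: ee_of_nat_mult)
    then show ?thesis unfolding eq using False ne by (simp add: sum_gp_strict)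
  qed
qed

text \<open>\<open>l\<close> is the index of the cell of length \<open>1 / n\<close> that contains \<open>frac y\<close>.\<close>

lemma norm_sum_ee_cell:
  assumes n: "n > 0" and l: "l = nat \<lfloor>real n * frac y\<rfloor>"
  shows "l < n" "norm (\<Sum>r<n. ee (of_nat r * y)) \<le> real n / real (1 + l) + real n / real (n - l)"
proof -
  have fr: "0 \<le> frac y" "frac y < 1" by (auto simp: frac_lt_1)
  then have nn: "0 \<le> real n * frac y" "real n * frac y < n" using n by auto
  then have li: "int l = \<lfloor>real n * frac y\<rfloor>" using l by simp
  show ln: "l < n" using nn li by linarith
  have lo: "real l \<le> real n * frac y" "real n * frac y < real l + 1" using li by linarith+
  define D where "D = norm (\<Sum>r<n. ee (of_nat r * y))"
  have Dn: "D \<le> real n" unfolding D_def by (rule norm_sum_ee_le_length)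
  have D2: "D * (2 * dnint y) \<le> 1"
  proof (cases "dnint y > 0")
    case True then show ?thesis using norm_sum_ee_le[of y n] by (simp add: D_def field_simps)
  next
    case False
    then have "dnint y \<le> 0" by simp
    then have "D * (2 * dnint y) \<le> 0" unfolding D_def by (intro mult_nonneg_nonpos) auto
    then show ?thesis by simp
  qed
  have D0: "D \<ge> 0" by (simp add: D_def)
  have nonneg: "real n / real (1 + l) \<ge> 0" "real n / real (n - l) \<ge> 0" by auto
  show "norm (\<Sum>r<n. ee (of_nat r * y)) \<le> real n / real (1 + l) + real n / real (n - l)"
  proof (cases "frac y \<le> 1 - frac y")
    case True
    then have dn: "dnint y = frac y" by (simp add: dnint_def)
    \<comment> \<open>The index 0, where the point may be an integer, is covered by the trivial
      bound. For larger \<open>l\<close> the factor 2 in \<open>norm_sum_ee_le\<close> pays for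
      replacing \<open>l\<close> by \<open>1 + l\<close>.\<close>
    have "D * (1 + real l) \<le> real n"
    proof (cases "l = 0")
      case True then show ?thesis using Dn by simp
    next
      case False
      have "D * (1 + real l) \<le> D * (2 * real l)" using D0 False by (intro mult_left_mono) auto
      also have "\<dots> \<le> D * (2 * (real n * frac y))" using D0 lo by (intro mult_left_mono) auto
      also have "\<dots> = real n * (D * (2 * dnint y))" using dn by simp
      also have "\<dots> \<le> real n * 1" using D2 by (intro mult_left_mono) auto
      finally show ?thesis by simp
    qed
    then have "D \<le> real n / real (1 + l)" by (simp add: field_simps)
    then show ?thesis using nonneg(2) unfolding D_def[symmetric] by (rule add_increasing2[rotated])
  next
    case False
    then have dn: "dnint y = 1 - frac y" by (simp add: dnint_def)
    have "D * real (n - l) \<le> real n"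
    proof (cases "n - l = 1")
      case True then show ?thesis using Dn by simp
    next
      case False
      then have "real (n - l) \<le> 2 * (real n - (real l + 1))" using ln by (auto simp: of_nat_diff)
      then have "D * real (n - l) \<le> D * (2 * (real n - (real l + 1)))" using D0 by (intro mult_left_mono) auto
      also have "\<dots> \<le> D * (2 * (real n - real n * frac y))" using D0 lo by (intro mult_left_mono) auto
      also have "\<dots> = real n * (D * (2 * dnint y))" unfolding dn by (simp add: algebra_simps)
      also have "\<dots> \<le> real n * 1" using D2 by (intro mult_left_mono) auto
      finally show ?thesis by simp
    qed
    then have "D \<le> real n / real (n - l)" using ln by (simp add: field_simps)
    then show ?thesis using nonneg(1) unfolding D_def[symmetric] by (rule add_increasing[rotated])
  qed
qed

lemma harm_le_ln: "n \<ge> 1 \<Longrightarrow> (harm n :: real) \<le> 1 + ln (real n)"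
proof (induction n rule: nat_induct_at_least)
  case base
  show ?case by (simp add: harm_expand)
next
  case (Suc n)
  have "ln (real n / real (Suc n)) \<le> real n / real (Suc n) - 1" using Suc by (intro ln_le_minus_one) auto
  also have "\<dots> = - (1 / real (Suc n))" by (simp add: field_simps)
  finally have "1 / real (Suc n) \<le> ln (real (Suc n)) - ln (real n)" using Suc by (simp add: ln_div)
  then show ?case using Suc by (simp add: harm_Suc inverse_eq_divide)
qed

lemma card_separated_le:
  fixes Y :: "real set"
  assumes "\<sigma> > 0" "d \<ge> 0" "Y \<subseteq> {a..a + d}"
    and sep: "\<And>y z. y \<in> Y \<Longrightarrow> z \<in> Y \<Longrightarrow> y < z \<Longrightarrow> y + \<sigma> \<le> z"
  shows "finite Y" "real (card Y) \<le> d / \<sigma> + 1"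
proof -
  define q where "q = (\<lambda>y. \<lfloor>(y - a) / \<sigma>\<rfloor>)"
  have lt: "q y < q z" if "y \<in> Y" "z \<in> Y" "y < z" for y z
  proof -
    have "(y - a) / \<sigma> + 1 \<le> (z - a) / \<sigma>" 
    proof -
      have "(y - a) / \<sigma> + 1 = (y + \<sigma> - a) / \<sigma>" using assms(1) by (simp add: field_simps)
      also have "\<dots> \<le> (z - a) / \<sigma>" using sep[OF that] assms(1) by (intro divide_right_mono) auto
      finally show ?thesis .
    qed
    then show ?thesis unfolding q_def by linarith
  qed
  have inj: "inj_on q Y"
  proof (rule inj_onI)
    fix y z assume "y \<in> Y" "z \<in> Y" "q y = q z"
    then show "y = z" using lt[of y z] lt[of z y] by linarith
  qed
  have img: "q ` Y \<subseteq> {0..\<lfloor>d / \<sigma>\<rfloor>}"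
  proof
    fix i assume "i \<in> q ` Y"
    then obtain y where y: "y \<in> Y" "i = q y" by auto
    then have "0 \<le> (y - a) / \<sigma>" "(y - a) / \<sigma> \<le> d / \<sigma>" using assms by (auto intro!: divide_right_mono)
    then show "i \<in> {0..\<lfloor>d / \<sigma>\<rfloor>}" unfolding y q_def by (auto intro: floor_mono)
  qed
  show "finite Y" using finite_imageD[OF finite_subset[OF img] inj] by simp
  have "card Y = card (q ` Y)" using card_image[OF inj] by simp
  also have "\<dots> \<le> card {0..\<lfloor>d / \<sigma>\<rfloor>}" by (intro card_mono img) auto
  finally have "real (card Y) \<le> real (nat (\<lfloor>d / \<sigma>\<rfloor> + 1))" by simp
  also have "\<dots> \<le> d / \<sigma> + 1" using assms by (simp add: floor_le_iff)
  finally show "real (card Y) \<le> d / \<sigma> + 1" .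
qed

section \<open>Large sieve and finite Fourier expansion\<close>

text \<open>The points are separated on the real line, not modulo 1, so they may pile up modulo 1;
  this costs the number \<open>2 * R\<close> of unit intervals. Within a unit interval each cell of
  length \<open>1 / n\<close> contains at most \<open>1 / (n * \<sigma>) + 1\<close> points, and the
  kernel bounds over the \<open>n\<close> cells form two harmonic sums.\<close>

lemma sum_kernel_separated:
  fixes y :: "'a \<Rightarrow> real"
  assumes fin: "finite I" and n: "n > 0" and \<sigma>: "\<sigma> > 0"
    and R: "\<And>i. i \<in> I \<Longrightarrow> - real R \<le> y i \<and> y i < real R"
    and sep: "\<And>i j. i \<in> I \<Longrightarrow> j \<in> I \<Longrightarrow> i \<noteq> j \<Longrightarrow> \<sigma> \<le> \<bar>y i - y j\<bar>"
  shows "(\<Sum>i\<in>I. norm (\<Sum>r<n. ee (of_nat r * y i)))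
    \<le> 4 * real R * (1 / (real n * \<sigma>) + 1) * (real n * (1 + ln (real n)))"
proof -
  define cell where "cell = (\<lambda>i. (\<lfloor>y i\<rfloor>, nat \<lfloor>real n * frac (y i)\<rfloor>))"
  define B where "B = (\<lambda>l. real n / real (1 + l) + real n / real (n - l))"
  define C where "C = {- int R..<int R} \<times> {..<n}"
  define \<kappa> where "\<kappa> = 1 / (real n * \<sigma>) + 1"
  have B0: "B l \<ge> 0" for l unfolding B_def by simp
  have img: "cell ` I \<subseteq> C"
  proof
    fix c assume "c \<in> cell ` I"
    then obtain i where i: "i \<in> I" "c = cell i" by auto
    have "- int R \<le> \<lfloor>y i\<rfloor>" "\<lfloor>y i\<rfloor> < int R" using R[OF i(1)] by (auto simp: le_floor_iff floor_less_iff)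
    moreover have "nat \<lfloor>real n * frac (y i)\<rfloor> < n" using norm_sum_ee_cell(1)[OF n refl] .
    ultimately show "c \<in> C" unfolding i(2) cell_def C_def by auto
  qed
  have cellcard: "real (card {i \<in> I. cell i = c}) \<le> \<kappa>" for c
  proof -
    define A where "A = {i \<in> I. cell i = c}"
    have finA: "finite A" using fin by (auto simp: A_def)
    have "inj_on y A"
    proof (rule inj_onI)
      fix i j assume "i \<in> A" "j \<in> A" "y i = y j"
      then show "i = j" using sep[of i j] \<sigma> by (cases "i = j") (auto simp: A_def)
    qed
    then have "card A = card (y ` A)" by (simp add: card_image)
    moreover have "real (card (y ` A)) \<le> (1 / real n) / \<sigma> + 1"
    proof (rule card_separated_le(2)[where a = "of_int (fst c) + real (snd c) / real n"])
      show "y ` A \<subseteq> {of_int (fst c) + real (snd c) / real n..of_int (fst c) + real (snd c) / real n + 1 / real n}"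
      proof
        fix z assume "z \<in> y ` A"
        then obtain i where i: "i \<in> I" "cell i = c" "z = y i" by (auto simp: A_def)
        have f: "fst c = \<lfloor>y i\<rfloor>" "snd c = nat \<lfloor>real n * frac (y i)\<rfloor>" using i(2) by (auto simp: cell_def)
        have "0 \<le> real n * frac (y i)" by simp
        then have "real (snd c) \<le> real n * frac (y i)" "real n * frac (y i) \<le> real (snd c) + 1"
          unfolding f by linarith+
        then have "real (snd c) / real n \<le> frac (y i)" "frac (y i) \<le> real (snd c) / real n + 1 / real n"
          using n by (auto simp: field_simps)
        then show "z \<in> {of_int (fst c) + real (snd c) / real n..of_int (fst c) + real (snd c) / real n + 1 / real n}"
          unfolding i(3) f(1) by (auto simp: frac_def)
      qed
      fix w z assume wz: "w \<in> y ` A" "z \<in> y ` A" "w < z"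
      then obtain i j where "i \<in> A" "j \<in> A" "w = y i" "z = y j" by auto
      moreover from this have "i \<noteq> j" using wz(3) by auto
      ultimately show "w + \<sigma> \<le> z" using sep[of i j] wz(3) by (auto simp: A_def)
    qed (use \<sigma> in auto)
    ultimately show ?thesis unfolding A_def \<kappa>_def by (simp add: field_simps)
  qed
  have "(\<Sum>i\<in>I. norm (\<Sum>r<n. ee (of_nat r * y i))) \<le> (\<Sum>i\<in>I. B (snd (cell i)))"
    unfolding B_def cell_def by (intro sum_mono) (use norm_sum_ee_cell(2)[OF n refl] in auto)
  also have "\<dots> = (\<Sum>c\<in>C. \<Sum>i\<in>{i \<in> I. cell i = c}. B (snd (cell i)))"
    by (rule sum.group[symmetric]) (use fin img in \<open>auto simp: C_def\<close>)
  also have "\<dots> = (\<Sum>c\<in>C. real (card {i \<in> I. cell i = c}) * B (snd c))"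
    by (intro sum.cong refl) (simp add: sum.cong)
  also have "\<dots> \<le> (\<Sum>c\<in>C. \<kappa> * B (snd c))"
    by (intro sum_mono mult_right_mono cellcard B0)
  also have "\<dots> = \<kappa> * (\<Sum>x\<in>{- int R..<int R}. \<Sum>l<n. B l)"
    unfolding C_def sum_distrib_left[symmetric] sum.cartesian_product by (simp add: case_prod_unfold)
  also have "\<dots> = \<kappa> * (2 * real R * (\<Sum>l<n. B l))" by simp
  also have "(\<Sum>l<n. B l) = 2 * (real n * harm n)"
  proof -
    have h: "(\<Sum>l<n. real n / real (1 + l)) = real n * harm n"
      by (simp add: harm_def sum_distrib_left divide_inverse lessThan_atLeast0 atLeast1_atMost_eq_remove0
        flip: sum.atLeast_Suc_atMost_Suc_shift) (auto simp: sum.shift_bounds_Suc_ivl intro!: sum.reindex_bij_witness[of _ "\<lambda>k. k - 1" Suc])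
    have "(\<Sum>l<n. real n / real (n - l)) = (\<Sum>l<n. real n / real (n - (n - Suc l)))"
      by (rule sum.nat_diff_reindex[symmetric])
    also have "\<dots> = (\<Sum>l<n. real n / real (1 + l))" by (intro sum.cong) auto
    finally show ?thesis unfolding B_def sum.distrib h by simp
  qed
  also have "\<kappa> * (2 * real R * (2 * (real n * harm n))) \<le> \<kappa> * (2 * real R * (2 * (real n * (1 + ln (real n)))))"
    using harm_le_ln[of n] n \<sigma> by (intro mult_left_mono) (auto simp: \<kappa>_def)
  also have "\<dots> = 4 * real R * \<kappa> * (real n * (1 + ln (real n)))" by simp
  finally show ?thesis unfolding \<kappa>_def .
qed

text \<open>The large sieve in its dual form: the coefficients \<open>a\<close> are removed by Cauchy--Schwarz.\<close>

lemma large_sieve_dual: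
  fixes a :: "nat \<Rightarrow> complex" and \<theta> :: "'a \<Rightarrow> real"
  assumes fin: "finite U" and a: "\<And>r. norm (a r) \<le> 1"
  shows "(\<Sum>u\<in>U. norm (\<Sum>r<n. a r * ee (of_nat r * \<theta> u)))
    \<le> sqrt (real n * (\<Sum>u\<in>U. \<Sum>v\<in>U. norm (\<Sum>r<n. ee (of_nat r * (\<theta> u - \<theta> v)))))"
proof -
  define S where "S = (\<lambda>u. \<Sum>r<n. a r * ee (of_nat r * \<theta> u))"
  \<comment> \<open>Phases that rotate each \<open>S u\<close> to its modulus; where
    \<open>S u = 0\<close> the phase is 0, so only \<open>norm (e u) \<le> 1\<close> holds in
    general.\<close>
  define e where "e = (\<lambda>u. cnj (sgn (S u)))"
  define G where "G = (\<lambda>r. \<Sum>u\<in>U. e u * ee (of_nat r * \<theta> u))"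
  have e1: "norm (e u) \<le> 1" for u unfolding e_def by (simp add: norm_sgn)
  have eS: "e u * S u = of_real (norm (S u))" for u
    unfolding e_def sgn_eq by (simp add: complex_norm_square[symmetric] power2_eq_square field_simps)
  define T where "T = (\<Sum>u\<in>U. norm (S u))"
  have T0: "T \<ge> 0" unfolding T_def by (intro sum_nonneg) auto
  have "of_real T = (\<Sum>u\<in>U. e u * S u)" unfolding T_def by (simp add: eS)
  also have "\<dots> = (\<Sum>u\<in>U. \<Sum>r<n. a r * (e u * ee (of_nat r * \<theta> u)))"
    unfolding S_def sum_distrib_left by (simp add: mult_ac)
  also have "\<dots> = (\<Sum>r<n. a r * G r)"
    unfolding G_def sum_distrib_left by (rule sum.swap)
  finally have "T = norm (\<Sum>r<n. a r * G r)" using T0 by (metis abs_of_nonneg norm_of_real)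
  also have "\<dots> \<le> (\<Sum>r<n. norm (a r * G r))" by (rule norm_sum)
  also have "\<dots> \<le> (\<Sum>r<n. 1 * norm (G r))"
    unfolding norm_mult by (intro sum_mono mult_right_mono a) auto
  finally have "T\<^sup>2 \<le> (\<Sum>r<n. 1 * norm (G r))\<^sup>2" using T0 by (intro power_mono)
  also have "\<dots> \<le> (\<Sum>r<n. 1\<^sup>2) * (\<Sum>r<n. (norm (G r))\<^sup>2)" by (rule Cauchy_Schwarz_ineq_sum)
  also have "(\<Sum>r<n. (norm (G r))\<^sup>2) \<le> (\<Sum>u\<in>U. \<Sum>v\<in>U. norm (\<Sum>r<n. ee (of_nat r * (\<theta> u - \<theta> v))))"
  proof -
    have G2: "of_real ((norm (G r))\<^sup>2) = (\<Sum>u\<in>U. \<Sum>v\<in>U. e u * cnj (e v) * ee (of_nat r * (\<theta> u - \<theta> v)))" for r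
    proof -
      have "of_real ((norm (G r))\<^sup>2) = G r * cnj (G r)" by (rule complex_norm_square)
      also have "\<dots> = (\<Sum>u\<in>U. \<Sum>v\<in>U. e u * ee (of_nat r * \<theta> u) * cnj (e v * ee (of_nat r * \<theta> v)))"
        unfolding G_def cnj_sum sum_product ..
      also have "\<dots> = (\<Sum>u\<in>U. \<Sum>v\<in>U. e u * cnj (e v) * ee (of_nat r * (\<theta> u - \<theta> v)))"
      proof (intro sum.cong refl)
        fix u v
        have "ee (of_nat r * (\<theta> u - \<theta> v)) = ee (of_nat r * \<theta> u) * ee (- (of_nat r * \<theta> v))"
          unfolding ee_add[symmetric] by (simp add: algebra_simps)
        then show "e u * ee (of_nat r * \<theta> u) * cnj (e v * ee (of_nat r * \<theta> v))
          = e u * cnj (e v) * ee (of_nat r * (\<theta> u - \<theta> v))" by (simp add: cnj_ee mult_ac)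
      qed
      finally show ?thesis .
    qed
    have "of_real (\<Sum>r<n. (norm (G r))\<^sup>2) = (\<Sum>r<n. \<Sum>u\<in>U. \<Sum>v\<in>U. e u * cnj (e v) * ee (of_nat r * (\<theta> u - \<theta> v)))"
      unfolding of_real_sum G2 ..
    also have "\<dots> = (\<Sum>u\<in>U. \<Sum>r<n. \<Sum>v\<in>U. e u * cnj (e v) * ee (of_nat r * (\<theta> u - \<theta> v)))" by (rule sum.swap)
    also have "\<dots> = (\<Sum>u\<in>U. \<Sum>v\<in>U. \<Sum>r<n. e u * cnj (e v) * ee (of_nat r * (\<theta> u - \<theta> v)))"
      by (intro sum.cong refl sum.swap)
    also have "\<dots> = (\<Sum>u\<in>U. \<Sum>v\<in>U. e u * cnj (e v) * (\<Sum>r<n. ee (of_nat r * (\<theta> u - \<theta> v))))"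
      by (simp add: sum_distrib_left)
    finally have "norm (complex_of_real (\<Sum>r<n. (norm (G r))\<^sup>2))
      = norm (\<Sum>u\<in>U. \<Sum>v\<in>U. e u * cnj (e v) * (\<Sum>r<n. ee (of_nat r * (\<theta> u - \<theta> v))))" by simp
    also have "\<dots> \<le> (\<Sum>u\<in>U. \<Sum>v\<in>U. norm (e u * cnj (e v) * (\<Sum>r<n. ee (of_nat r * (\<theta> u - \<theta> v)))))"
      by (intro order_trans[OF norm_sum] sum_mono norm_sum)
    also have "\<dots> \<le> (\<Sum>u\<in>U. \<Sum>v\<in>U. norm (\<Sum>r<n. ee (of_nat r * (\<theta> u - \<theta> v))))"
    proof (intro sum_mono)
      fix u v
      have "norm (e u) * norm (e v) \<le> 1 * 1" by (intro mult_mono e1) auto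
      then show "norm (e u * cnj (e v) * (\<Sum>r<n. ee (of_nat r * (\<theta> u - \<theta> v))))
          \<le> norm (\<Sum>r<n. ee (of_nat r * (\<theta> u - \<theta> v)))"
        by (simp add: norm_mult mult_left_le_one_le)
    qed
    moreover have "0 \<le> (\<Sum>r<n. (norm (G r))\<^sup>2)" by (intro sum_nonneg) auto
    ultimately show ?thesis unfolding norm_of_real by linarith
  qed
  finally have "T\<^sup>2 \<le> real n * (\<Sum>u\<in>U. \<Sum>v\<in>U. norm (\<Sum>r<n. ee (of_nat r * (\<theta> u - \<theta> v))))"
    by (simp add: mult_left_mono)
  then show ?thesis unfolding T_def S_def by (rule real_le_rsqrt)
qed

text \<open>The number of multiples of \<open>Q\<close> in \<open>{q + t..<q + t + P}\<close>, averaged over \<open>t < J\<close>: a trapezoidal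
approximation to the indicator of an interval in the integers modulo \<open>Q\<close>.\<close>

definition smooth_ind :: "nat \<Rightarrow> nat \<Rightarrow> nat \<Rightarrow> int \<Rightarrow> real" where
  "smooth_ind Q J P q = (\<Sum>t<J. \<Sum>s<P. if int Q dvd q + int t + int s then 1 else 0) / real J"

text \<open>The discrete Fourier coefficient of \<open>smooth_ind\<close> at frequency
  \<open>h\<close>. The trapezoid is a convolution of two intervals, so the coefficient is a product
  of two geometric sums and decays quadratically, which the sum over frequencies needs.\<close>

definition smooth_coeff :: "nat \<Rightarrow> nat \<Rightarrow> nat \<Rightarrow> nat \<Rightarrow> complex" where
  "smooth_coeff Q J P h = (\<Sum>t<J. ee (of_nat t * (real h / real Q)))
     * (\<Sum>s<P. ee (of_nat s * (real h / real Q))) / (of_nat Q * of_nat J)"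

lemma smooth_ind_fourier:
  assumes "Q > 0"
  shows "complex_of_real (smooth_ind Q J P q)
    = (\<Sum>h<Q. smooth_coeff Q J P h * ee (real h * of_int q / real Q))"
proof -
  have ind: "complex_of_real (if int Q dvd z then 1 else 0) = (\<Sum>h<Q. ee (real h * of_int z / real Q)) / of_nat Q" for z
    using sum_ee_indicator[OF assms, of z] assms by auto
  have split: "ee (real h * of_int (q + int t + int s) / real Q)
     = ee (of_nat t * (real h / real Q)) * ee (of_nat s * (real h / real Q)) * ee (real h * of_int q / real Q)" for h t s
    unfolding ee_add[symmetric] by (simp add: algebra_simps add_divide_distrib)
  have "complex_of_real (smooth_ind Q J P q)
    = (\<Sum>t<J. \<Sum>s<P. (\<Sum>h<Q. ee (real h * of_int (q + int t + int s) / real Q)) / of_nat Q) / of_nat J"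
    unfolding smooth_ind_def of_real_divide of_real_sum ind by simp
  also have "\<dots> = (\<Sum>t<J. \<Sum>s<P. \<Sum>h<Q. ee (of_nat t * (real h / real Q)) * ee (of_nat s * (real h / real Q)) * ee (real h * of_int q / real Q)) / (of_nat Q * of_nat J)"
    unfolding split by (simp add: sum_divide_distrib)
  also have "(\<Sum>t<J. \<Sum>s<P. \<Sum>h<Q. ee (of_nat t * (real h / real Q)) * ee (of_nat s * (real h / real Q)) * ee (real h * of_int q / real Q))
    = (\<Sum>t<J. \<Sum>h<Q. \<Sum>s<P. ee (of_nat t * (real h / real Q)) * ee (of_nat s * (real h / real Q)) * ee (real h * of_int q / real Q))"
    by (intro sum.cong refl sum.swap)
  also have "\<dots> = (\<Sum>h<Q. \<Sum>t<J. \<Sum>s<P. ee (of_nat t * (real h / real Q)) * ee (of_nat s * (real h / real Q)) * ee (real h * of_int q / real Q))"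
    by (rule sum.swap)
  also have "\<dots> = (\<Sum>h<Q. (\<Sum>t<J. ee (of_nat t * (real h / real Q))) * (\<Sum>s<P. ee (of_nat s * (real h / real Q))) * ee (real h * of_int q / real Q))"
  proof (rule sum.cong[OF refl])
    fix h
    show "(\<Sum>t<J. \<Sum>s<P. ee (of_nat t * (real h / real Q)) * ee (of_nat s * (real h / real Q)) * ee (real h * of_int q / real Q))
      = (\<Sum>t<J. ee (of_nat t * (real h / real Q))) * (\<Sum>s<P. ee (of_nat s * (real h / real Q))) * ee (real h * of_int q / real Q)"
      unfolding sum_product unfolding sum_distrib_right ..
  qed
  also have "\<dots> / (of_nat Q * of_nat J) = (\<Sum>h<Q. smooth_coeff Q J P h * ee (real h * of_int q / real Q))"
    unfolding smooth_coeff_def by (simp add: sum_divide_distrib)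
  finally show ?thesis .
qed

lemma smooth_coeff_0: "J > 0 \<Longrightarrow> smooth_coeff Q J P 0 = of_real (real P / real Q)"
  unfolding smooth_coeff_def by simp

lemma dnint_fraction:
  assumes "1 \<le> h" "h < Q"
  shows "dnint (real h / real Q) = real (min h (Q - h)) / real Q"
proof -
  have "frac (real h / real Q) = real h / real Q" using assms by (intro frac_eq[THEN iffD2]) auto
  then show ?thesis using assms
    by (auto simp: dnint_def min_def field_simps of_nat_diff)
qed

lemma norm_smooth_coeff_le:
  assumes Q: "Q > 0" and J: "J > 0"
  shows "norm (smooth_coeff Q J P h) \<le> real P / real Q"
    and "1 \<le> h \<Longrightarrow> h < Q \<Longrightarrow> norm (smooth_coeff Q J P h) \<le> real Q / (4 * real J * (real (min h (Q - h)))\<^sup>2)"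
proof -
  let ?x = "real h / real Q"
  have n: "norm (smooth_coeff Q J P h) = norm (\<Sum>t<J. ee (of_nat t * ?x)) * norm (\<Sum>s<P. ee (of_nat s * ?x)) / (real Q * real J)"
    unfolding smooth_coeff_def by (simp add: norm_mult norm_divide)
  have "\<dots> \<le> real J * real P / (real Q * real J)"
    by (intro divide_right_mono mult_mono norm_sum_ee_le_length) auto
  then show "norm (smooth_coeff Q J P h) \<le> real P / real Q" using n J by simp
  assume h: "1 \<le> h" "h < Q"
  define m where "m = real (min h (Q - h))"
  have m: "m > 0" "dnint ?x = m / real Q" using dnint_fraction[OF h] h by (auto simp: m_def)
  have d: "dnint ?x > 0" using m Q by simp
  have "norm (smooth_coeff Q J P h) \<le> (1 / (2 * (m / real Q))) * (1 / (2 * (m / real Q))) / (real Q * real J)"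
    unfolding n using norm_sum_ee_le[OF d] unfolding m(2)
    by (intro divide_right_mono mult_mono) (use m Q in auto)
  also have "\<dots> = real Q / (4 * real J * m\<^sup>2)" using Q J m by (simp add: power2_eq_square field_simps)
  finally show "norm (smooth_coeff Q J P h) \<le> real Q / (4 * real J * (real (min h (Q - h)))\<^sup>2)" unfolding m_def .
qed

text \<open>Since the argument is linear in \<open>r\<close>, the offset \<open>b u\<close>
  contributes only a phase of modulus 1 at each frequency, and \<open>P u\<close> only a coefficient
  with a uniform bound. What is left depends on \<open>u\<close> through the slope alone.
  Frequencies \<open>h\<close> and \<open>Q - h\<close> are estimated alike, whence the factor
  2.\<close>

lemma smooth_ind_linear_sum:
  fixes a :: "nat \<Rightarrow> complex" and p b :: "'a \<Rightarrow> int" and P :: "'a \<Rightarrow> nat" and L :: "nat \<Rightarrow> real"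
  assumes Q: "Q > 0" and J: "J > 0" and fin: "finite U"
    and P: "\<And>u. u \<in> U \<Longrightarrow> P u \<le> P0"
    and L: "\<And>h::int. h \<noteq> 0 \<Longrightarrow> (\<Sum>u\<in>U. norm (\<Sum>r<n. a r * ee (of_nat r * (of_int h * of_int (p u) / real Q)))) \<le> L (nat \<bar>h\<bar>)"
  shows "(\<Sum>u\<in>U. norm ((\<Sum>r<n. a r * of_real (smooth_ind Q J (P u) (b u + int r * p u)))
             - of_real (real (P u) / real Q) * (\<Sum>r<n. a r)))
    \<le> 2 * (\<Sum>h=1..<Q. min (real P0 / real Q) (real Q / (4 * real J * (real h)\<^sup>2)) * L h)"
proof -
  define S where "S = (\<lambda>h u. \<Sum>r<n. a r * ee (of_nat r * (of_int h * of_int (p u) / real Q)))"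
  define M where "M = (\<lambda>h::nat. min (real P0 / real Q) (real Q / (4 * real J * (real h)\<^sup>2)))"
  have L0: "L h \<ge> 0" if "h \<ge> 1" for h
    by (rule order_trans[OF sum_nonneg]) (use L[of "int h"] that in auto)
  have M0: "M h \<ge> 0" for h unfolding M_def by auto
  have each: "norm ((\<Sum>r<n. a r * of_real (smooth_ind Q J (P u) (b u + int r * p u)))
             - of_real (real (P u) / real Q) * (\<Sum>r<n. a r))
     \<le> (\<Sum>h=1..<Q. M (min h (Q - h)) * norm (S (int h) u))" if u: "u \<in> U" for u
  proof -
    have "(\<Sum>r<n. a r * of_real (smooth_ind Q J (P u) (b u + int r * p u)))
      = (\<Sum>r<n. \<Sum>h<Q. smooth_coeff Q J (P u) h * ee (real h * of_int (b u) / real Q) * (a r * ee (of_nat r * (of_int (int h) * of_int (p u) / real Q))))"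
    proof (intro sum.cong refl)
      fix r
      have "ee (real h * of_int (b u + int r * p u) / real Q)
        = ee (real h * of_int (b u) / real Q) * ee (of_nat r * (of_int (int h) * of_int (p u) / real Q))" for h
        unfolding ee_add[symmetric] by (simp add: algebra_simps add_divide_distrib)
      then show "a r * of_real (smooth_ind Q J (P u) (b u + int r * p u)) =
        (\<Sum>h<Q. smooth_coeff Q J (P u) h * ee (real h * of_int (b u) / real Q) * (a r * ee (of_nat r * (of_int (int h) * of_int (p u) / real Q))))"
        unfolding smooth_ind_fourier[OF Q] sum_distrib_left by (intro sum.cong refl) (simp add: mult_ac)
    qed
    also have "\<dots> = (\<Sum>h<Q. smooth_coeff Q J (P u) h * ee (real h * of_int (b u) / real Q) * S (int h) u)"
      unfolding S_def sum_distrib_left by (rule sum.swap)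
    also have "{..<Q} = insert 0 {1..<Q}" using Q by auto
    also have "(\<Sum>h\<in>insert 0 {1..<Q}. smooth_coeff Q J (P u) h * ee (real h * of_int (b u) / real Q) * S (int h) u)
      = of_real (real (P u) / real Q) * (\<Sum>r<n. a r)
       + (\<Sum>h=1..<Q. smooth_coeff Q J (P u) h * ee (real h * of_int (b u) / real Q) * S (int h) u)"
      using smooth_coeff_0[OF J] by (simp add: S_def)
    finally have "norm ((\<Sum>r<n. a r * of_real (smooth_ind Q J (P u) (b u + int r * p u)))
             - of_real (real (P u) / real Q) * (\<Sum>r<n. a r))
      = norm (\<Sum>h=1..<Q. smooth_coeff Q J (P u) h * ee (real h * of_int (b u) / real Q) * S (int h) u)" by simp
    also have "\<dots> \<le> (\<Sum>h=1..<Q. norm (smooth_coeff Q J (P u) h * ee (real h * of_int (b u) / real Q) * S (int h) u))"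
      by (rule norm_sum)
    also have "\<dots> \<le> (\<Sum>h=1..<Q. M (min h (Q - h)) * norm (S (int h) u))"
    proof (intro sum_mono)
      fix h assume h: "h \<in> {1..<Q}"
      have "norm (smooth_coeff Q J (P u) h) \<le> real P0 / real Q"
        using norm_smooth_coeff_le(1)[OF Q J, of "P u" h] P[OF u]
        by (meson divide_right_mono of_nat_0_le_iff of_nat_le_iff order_trans)
      then have "norm (smooth_coeff Q J (P u) h) \<le> M (min h (Q - h))"
        using norm_smooth_coeff_le(2)[OF Q J, of h "P u"] h by (simp add: M_def)
      then show "norm (smooth_coeff Q J (P u) h * ee (real h * of_int (b u) / real Q) * S (int h) u) \<le> M (min h (Q - h)) * norm (S (int h) u)"
        by (simp add: norm_mult mult_right_mono)
    qed
    finally show ?thesis .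
  qed
  \<comment> \<open>Changing the frequency by \<open>Q\<close> changes the phase by the integer
    \<open>r * p u\<close>; this uses that the rounded slopes have denominator \<open>Q\<close>.
    Frequencies above \<open>Q / 2\<close> thus count as small negative ones.\<close>
  have refl_S: "S (int h) u = S (- int (Q - h)) u" if "h \<le> Q" for h u
  proof -
    have "ee (of_nat r * (of_int (int h) * of_int (p u) / real Q)) = ee (of_nat r * (of_int (- int (Q - h)) * of_int (p u) / real Q))" for r
    proof -
      have "real h = real Q - real (Q - h)" using that by (simp add: of_nat_diff)
      then have "of_nat r * (of_int (int h) * of_int (p u) / real Q)
         = of_nat r * (of_int (- int (Q - h)) * of_int (p u) / real Q) + of_int (int r * p u)"
        using Q by (simp add: field_simps)
      then show ?thesis by (metis ee_add ee_of_int mult.right_neutral)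
    qed
    then show ?thesis unfolding S_def by simp
  qed
  have sumS: "(\<Sum>u\<in>U. norm (S (int h) u)) \<le> L (min h (Q - h))" if "h \<in> {1..<Q}" for h
  proof (cases "h \<le> Q - h")
    case True
    then show ?thesis using L[of "int h"] that unfolding S_def by (simp add: min_def)
  next
    case False
    have "(\<Sum>u\<in>U. norm (S (int h) u)) = (\<Sum>u\<in>U. norm (S (- int (Q - h)) u))"
      using refl_S[of h] that by simp
    also have "\<dots> \<le> L (nat \<bar>- int (Q - h)\<bar>)" unfolding S_def by (rule L) (use that in auto)
    also have "nat \<bar>- int (Q - h)\<bar> = min h (Q - h)" using False that by auto
    finally show ?thesis .
  qed
  have "(\<Sum>u\<in>U. norm ((\<Sum>r<n. a r * of_real (smooth_ind Q J (P u) (b u + int r * p u)))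
             - of_real (real (P u) / real Q) * (\<Sum>r<n. a r)))
     \<le> (\<Sum>u\<in>U. \<Sum>h=1..<Q. M (min h (Q - h)) * norm (S (int h) u))" by (intro sum_mono each)
  also have "\<dots> = (\<Sum>h=1..<Q. M (min h (Q - h)) * (\<Sum>u\<in>U. norm (S (int h) u)))"
    unfolding sum_distrib_left by (rule sum.swap)
  also have "\<dots> \<le> (\<Sum>h=1..<Q. M (min h (Q - h)) * L (min h (Q - h)))"
    by (intro sum_mono mult_left_mono sumS M0) auto
  also have "\<dots> \<le> (\<Sum>h=1..<Q. M h * L h + M (Q - h) * L (Q - h))"
  proof (intro sum_mono)
    fix h assume h: "h \<in> {1..<Q}"
    have "0 \<le> M h * L h" "0 \<le> M (Q - h) * L (Q - h)" using h by (auto intro!: mult_nonneg_nonneg M0 L0)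
    then show "M (min h (Q - h)) * L (min h (Q - h)) \<le> M h * L h + M (Q - h) * L (Q - h)"
      by (auto simp: min_def)
  qed
  also have "\<dots> = (\<Sum>h=1..<Q. M h * L h) + (\<Sum>h=1..<Q. M (Q - h) * L (Q - h))" by (rule sum.distrib)
  also have "(\<Sum>h=1..<Q. M (Q - h) * L (Q - h)) = (\<Sum>h=1..<Q. M h * L h)"
    by (rule sum.reindex_bij_witness[of _ "\<lambda>h. Q - h" "\<lambda>h. Q - h"]) auto
  finally show ?thesis unfolding M_def by simp
qed

section \<open>Linear approximation of power functions\<close>

lemma ceiling_divide_Suc:
  fixes z :: int
  assumes "Q > 0"
  shows "\<lceil>real_of_int (z + 1) / real Q\<rceil> - \<lceil>real_of_int z / real Q\<rceil> = (if int Q dvd z then 1 else 0)"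
proof -
  have c: "\<lceil>real_of_int x / real Q\<rceil> = - (- x div int Q)" for x
    using ceiling_divide_eq_div[of x "int Q", where 'a = real] by simp
  show ?thesis
  proof (cases "int Q dvd z")
    case True
    then obtain k where k: "z = int Q * k" by blast
    have "(- (z + 1)) div int Q = (- 1 + (- k) * int Q) div int Q" using k by (simp add: algebra_simps)
    also have "\<dots> = - k + (- 1) div int Q" using assms by (subst div_mult_self1) auto
    also have "(- 1) div int Q = - 1" using assms by (simp add: div_eq_minus1)
    finally have "(- (z + 1)) div int Q = - k - 1" by simp
    moreover have "(- z) div int Q = - k" using k assms by (simp add: minus_mult_right del: mult_minus_right)
    ultimately show ?thesis unfolding c using True by simp
  next
    case False
    have "(- z) mod int Q \<noteq> 0" using False by (simp add: mod_eq_0_iff_dvd)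
    moreover have "(- z) mod int Q \<ge> 0" "(- z) mod int Q < int Q" using assms by auto
    ultimately have "((- z) mod int Q - 1) div int Q = 0" by (intro div_pos_pos_trivial) auto
    moreover have "- (z + 1) = ((- z) mod int Q - 1) + ((- z) div int Q) * int Q"
      using mult_div_mod_eq[of "int Q" "- z"] by (simp add: algebra_simps)
    ultimately have "(- (z + 1)) div int Q = (- z) div int Q" using assms by (simp only: div_mult_self1)
    then show ?thesis unfolding c using False by simp
  qed
qed

lemma ceiling_divide_add:
  fixes z :: int
  assumes "Q > 0"
  shows "real_of_int \<lceil>real_of_int (z + int P) / real Q\<rceil> - real_of_int \<lceil>real_of_int z / real Q\<rceil>
    = (\<Sum>s<P. if int Q dvd z + int s then 1 else 0)"
proof (induction P)
  case (Suc P)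
  then show ?case using ceiling_divide_Suc[OF assms, of "z + int P"]
    by (auto simp: algebra_simps split: if_splits)
qed auto

text \<open>The ceiling of \<open>z / Q\<close> jumps exactly when \<open>z\<close> leaves a
  multiple of \<open>Q\<close>, so counting multiples telescopes. In this form
  \<open>smooth_ind\<close> can be matched with \<open>ps_gap\<close>, also a difference of two
  ceilings, one ceiling at a time.\<close>

lemma smooth_ind_eq_ceiling:
  assumes "Q > 0"
  shows "smooth_ind Q J P q = (\<Sum>t<J. real_of_int \<lceil>real_of_int (q + int P + int t) / real Q\<rceil>) / real J
    - (\<Sum>t<J. real_of_int \<lceil>real_of_int (q + int t) / real Q\<rceil>) / real J"
  unfolding smooth_ind_def ceiling_divide_add[OF assms, symmetric]
  by (simp add: sum_subtractf diff_divide_distrib algebra_simps)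

lemma smooth_ind_nonneg: "smooth_ind Q J P q \<ge> 0"
  unfolding smooth_ind_def by (intro divide_nonneg_nonneg sum_nonneg) auto

text \<open>Each of the \<open>J\<close> windows starts below \<open>q - 2 * J\<close> and ends
  beyond \<open>q + 2 * J\<close>, so all of them contain the multiple \<open>Q * \<nu>\<close>.
  This is the reason for the width \<open>6 * J\<close> and the shift \<open>3 * J\<close>.\<close>

lemma smooth_ind_near:
  assumes J: "J > 0" and near: "\<bar>int Q * \<nu> - q\<bar> \<le> 2 * int J"
  shows "smooth_ind Q J (6 * J) (q - 3 * int J) \<ge> 1"
proof -
  have "(\<Sum>s<6 * J. if int Q dvd q - 3 * int J + int t + int s then 1 else (0::real)) \<ge> 1" if t: "t < J" for t
  proof -
    define s where "s = nat (int Q * \<nu> - q + 3 * int J - int t)"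
    have s: "int s = int Q * \<nu> - q + 3 * int J - int t" "s < 6 * J" using near t J unfolding s_def by auto
    have "q - 3 * int J + int t + int s = int Q * \<nu>" using s by simp
    then have d: "int Q dvd q - 3 * int J + int t + int s" by simp
    have "(\<Sum>s\<in>{s}. if int Q dvd q - 3 * int J + int t + int s then 1 else (0::real))
       \<le> (\<Sum>s<6 * J. if int Q dvd q - 3 * int J + int t + int s then 1 else (0::real))"
      using s by (intro sum_mono2) auto
    then show ?thesis using d by simp
  qed
  then have "(\<Sum>t<J. 1) \<le> (\<Sum>t<J. \<Sum>s<6 * J. if int Q dvd q - 3 * int J + int t + int s then 1 else (0::real))"
    by (intro sum_mono) auto
  then show ?thesis unfolding smooth_ind_def using J by (simp add: field_simps)
qed

text \<open>If the two ceilings differ, some multiple of \<open>Q\<close> separates the arguments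
  and hence lies close to \<open>q\<close>, where the wide indicator is at least 1. The condition
  \<open>2 * J < Q\<close> keeps the arguments less than 1 apart, so the ceilings never differ by
  more than 1.\<close>

lemma ceiling_approx:
  assumes Q: "Q > 0" and J: "J > 0" "2 * J < Q" and y: "\<bar>real Q * y - real_of_int q\<bar> \<le> real J"
  shows "\<bar>real_of_int \<lceil>y\<rceil> - (\<Sum>t<J. real_of_int \<lceil>real_of_int (q + int t) / real Q\<rceil>) / real J\<bar>
    \<le> smooth_ind Q J (6 * J) (q - 3 * int J)" (is "_ \<le> ?S")
proof -
  have each: "\<bar>real_of_int \<lceil>y\<rceil> - real_of_int \<lceil>real_of_int (q + int t) / real Q\<rceil>\<bar> \<le> ?S" if t: "t < J" for t
  proof (cases "\<lceil>y\<rceil> = \<lceil>real_of_int (q + int t) / real Q\<rceil>")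
    case True then show ?thesis using smooth_ind_nonneg by simp
  next
    case False
    define z where "z = real_of_int (q + int t) / real Q"
    have Qz: "real Q * z = real_of_int q + real t" unfolding z_def using Q by simp
    have *: "?S \<ge> 1" if ab: "\<lceil>a\<rceil> < \<lceil>b\<rceil>" "\<bar>real Q * a - real_of_int q\<bar> \<le> real J" "\<bar>real Q * b - real_of_int q\<bar> \<le> real J" for a b
    proof -
      have "a \<le> of_int \<lceil>a\<rceil>" "of_int \<lceil>a\<rceil> < b" using ab(1) by (auto simp: less_ceiling_iff)
      then have "real Q * a \<le> real Q * of_int \<lceil>a\<rceil>" "real Q * of_int \<lceil>a\<rceil> \<le> real Q * b" using Q by (auto intro: mult_left_mono)
      then have "\<bar>real_of_int (int Q * \<lceil>a\<rceil> - q)\<bar> \<le> real J" using ab by simp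
      then have "\<bar>int Q * \<lceil>a\<rceil> - q\<bar> \<le> 2 * int J" by linarith
      then show ?thesis by (rule smooth_ind_near[OF J(1)])
    qed
    have zq: "\<bar>real Q * z - real_of_int q\<bar> \<le> real J" using Qz t by simp
    have S1: "?S \<ge> 1" using False *[of y z] *[of z y] y zq unfolding z_def[symmetric] by linarith
    have "\<bar>real Q * (y - z)\<bar> \<le> 2 * real J" using y zq Qz t by (simp add: algebra_simps)
    moreover have "2 * real J < real Q" using J(2) by linarith
    moreover have "\<bar>real Q * (y - z)\<bar> = real Q * \<bar>y - z\<bar>" by (simp add: abs_mult)
    ultimately have "real Q * \<bar>y - z\<bar> < real Q * 1" by linarith
    then have "\<bar>y - z\<bar> < 1" using Q by (subst (asm) mult_less_cancel_left_pos) auto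
    then have "\<bar>\<lceil>y\<rceil> - \<lceil>z\<rceil>\<bar> \<le> 1" by linarith
    then show ?thesis using S1 unfolding z_def[symmetric] by linarith
  qed
  have "real_of_int \<lceil>y\<rceil> - (\<Sum>t<J. real_of_int \<lceil>real_of_int (q + int t) / real Q\<rceil>) / real J
     = (\<Sum>t<J. real_of_int \<lceil>y\<rceil> - real_of_int \<lceil>real_of_int (q + int t) / real Q\<rceil>) / real J"
    using J by (simp add: sum_subtractf field_simps)
  also have "\<bar>\<dots>\<bar> \<le> (\<Sum>t<J. \<bar>real_of_int \<lceil>y\<rceil> - real_of_int \<lceil>real_of_int (q + int t) / real Q\<rceil>\<bar>) / real J"
    by (simp add: abs_divide divide_right_mono sum_abs)
  also have "\<dots> \<le> (\<Sum>t<J. ?S) / real J" using each by (intro divide_right_mono sum_mono) auto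
  also have "\<dots> = ?S" using J by simp
  finally show ?thesis .
qed

section \<open>Derivatives and elementary inequalities for powers\<close>

lemma DERIV_powr_first:
  fixes t :: real assumes "t > 0"
  shows "((\<lambda>t. t powr \<gamma>) has_real_derivative \<gamma> * t powr (\<gamma> - 1)) (at t)"
    "((\<lambda>t. \<gamma> * t powr (\<gamma> - 1)) has_real_derivative \<gamma> * (\<gamma> - 1) * t powr (\<gamma> - 2)) (at t)"
proof -
  show 1: "((\<lambda>t. t powr \<gamma>) has_real_derivative \<gamma> * t powr (\<gamma> - 1)) (at t)" for \<gamma>
    using assms by (auto intro!: derivative_eq_intros simp: powr_diff field_simps)
  have "((\<lambda>t. \<gamma> * t powr (\<gamma> - 1)) has_real_derivative \<gamma> * ((\<gamma> - 1) * t powr (\<gamma> - 1 - 1))) (at t)"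
    by (rule DERIV_cmult[OF 1])
  then show "((\<lambda>t. \<gamma> * t powr (\<gamma> - 1)) has_real_derivative \<gamma> * (\<gamma> - 1) * t powr (\<gamma> - 2)) (at t)" by (simp add: mult.assoc)
qed

lemma powr_deriv_diff:
  fixes u v :: real assumes "0 < u" "u < v"
  obtains z where "u < z" "z < v" "\<gamma> * u powr (\<gamma> - 1) - \<gamma> * v powr (\<gamma> - 1) = (v - u) * (\<gamma> * (1 - \<gamma>) * z powr (\<gamma> - 2))"
proof -
  have "\<exists>z. u < z \<and> z < v \<and>
     \<gamma> * v powr (\<gamma> - 1) - \<gamma> * u powr (\<gamma> - 1) = (v - u) * (\<gamma> * (\<gamma> - 1) * z powr (\<gamma> - 2))"
    by (rule MVT2[OF assms(2)], rule DERIV_powr_first(2)) (use assms in auto)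
  then obtain z where z: "u < z" "z < v"
     "\<gamma> * v powr (\<gamma> - 1) - \<gamma> * u powr (\<gamma> - 1) = (v - u) * (\<gamma> * (\<gamma> - 1) * z powr (\<gamma> - 2))"
    by blast
  have "(v - u) * (\<gamma> * (1 - \<gamma>) * z powr (\<gamma> - 2)) = - ((v - u) * (\<gamma> * (\<gamma> - 1) * z powr (\<gamma> - 2)))"
    by (simp add: algebra_simps)
  then show ?thesis using z that[of z] by linarith
qed

text \<open>The mean value theorem is applied to the function and then to its derivative; the factor
  \<open>\<gamma> * (1 - \<gamma>)\<close> is estimated by 1.\<close>

lemma powr_linear_approx:
  fixes u d \<gamma> :: real assumes "u > 0" "d \<ge> 0" "0 < \<gamma>" "\<gamma> < 1"
  shows "\<bar>(u + d) powr \<gamma> - (u powr \<gamma> + d * (\<gamma> * u powr (\<gamma> - 1)))\<bar> \<le> d\<^sup>2 * u powr (\<gamma> - 2)"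
proof (cases "d = 0")
  case False
  then have d: "u < u + d" using assms by simp
  have "\<exists>x. u < x \<and> x < u + d \<and> (u + d) powr \<gamma> - u powr \<gamma> = (u + d - u) * (\<gamma> * x powr (\<gamma> - 1))"
    by (rule MVT2[OF d], rule DERIV_powr_first(1)) (use assms in auto)
  then obtain x where x: "u < x" "x < u + d" "(u + d) powr \<gamma> - u powr \<gamma> = (u + d - u) * (\<gamma> * x powr (\<gamma> - 1))"
    by blast
  obtain z where z: "u < z" "z < x" "\<gamma> * u powr (\<gamma> - 1) - \<gamma> * x powr (\<gamma> - 1) = (x - u) * (\<gamma> * (1 - \<gamma>) * z powr (\<gamma> - 2))"
    using powr_deriv_diff[OF assms(1) x(1)] by blast
  have eq: "(u + d) powr \<gamma> - (u powr \<gamma> + d * (\<gamma> * u powr (\<gamma> - 1))) = - (d * ((x - u) * (\<gamma> * (1 - \<gamma>) * z powr (\<gamma> - 2))))"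
    unfolding z(3)[symmetric] using x(3) by (simp add: algebra_simps)
  have zu: "z powr (\<gamma> - 2) \<le> u powr (\<gamma> - 2)" using z assms by (intro powr_mono2') auto
  have "\<gamma> * (1 - \<gamma>) \<le> 1 * 1" using assms by (intro mult_mono) auto
  then have "\<gamma> * (1 - \<gamma>) * z powr (\<gamma> - 2) \<le> 1 * u powr (\<gamma> - 2)" using zu assms by (intro mult_mono) auto
  then have "(x - u) * (\<gamma> * (1 - \<gamma>) * z powr (\<gamma> - 2)) \<le> d * (1 * u powr (\<gamma> - 2))"
    by (rule mult_mono[rotated]) (use x assms in auto)
  then have "d * ((x - u) * (\<gamma> * (1 - \<gamma>) * z powr (\<gamma> - 2))) \<le> d * (d * (1 * u powr (\<gamma> - 2)))"
    using assms by (intro mult_left_mono) auto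
  moreover have "0 \<le> d * ((x - u) * (\<gamma> * (1 - \<gamma>) * z powr (\<gamma> - 2)))" using x assms by (intro mult_nonneg_nonneg) auto
  ultimately show ?thesis unfolding eq by (simp add: power2_eq_square mult.assoc)
qed simp

text \<open>The first factor is the bound for the Fourier coefficients, the second the loss of the
  large sieve. Quadratic decay beats the growth of \<open>sqrt (h / A)\<close> and leaves
  \<open>1 / h\<close>, so summing over the frequencies costs only a logarithm and the ratio
  \<open>H / A\<close>.\<close>

lemma min_interpolation:
  fixes A H h :: real
  assumes "A > 0" "H \<ge> A" "h > 0"
  shows "min (1 / A) (H / h\<^sup>2) * (sqrt (h / A) + sqrt (A / h)) \<le> 2 * (H / A) / h"
proof -
  define x \<mu> where "x = h / A" and "\<mu> = H / A"
  have x: "x > 0" and l: "\<mu> \<ge> 1" using assms by (auto simp: x_def \<mu>_def)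
  have hx: "h = x * A" "H = \<mu> * A" using assms by (auto simp: x_def \<mu>_def)
  define s where "s = sqrt x"
  have s: "s > 0" "s\<^sup>2 = x" using x by (auto simp: s_def)
  have sA: "sqrt (A / h) = 1 / s" "sqrt (h / A) = s" using assms s by (auto simp: hx s_def real_sqrt_divide)
  have m: "min 1 (\<mu> / x\<^sup>2) * (s + 1 / s) \<le> 2 * \<mu> / x"
  proof (cases "x \<le> 1")
    case True
    have "s \<le> 1" using True by (simp add: s_def)
    have "x * (s + 1/s) = s * (s\<^sup>2 + 1)" using s by (simp add: field_simps power2_eq_square)
    also have "\<dots> \<le> 1 * (1 + 1)" using s \<open>s \<le> 1\<close> True by (intro mult_mono) auto
    finally have "s + 1/s \<le> 2 / x" using x by (simp add: field_simps)
    also have "\<dots> \<le> 2 * \<mu> / x" using l x by (simp add: divide_right_mono)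
    finally have "s + 1/s \<le> 2 * \<mu> / x" .
    moreover have "min 1 (\<mu> / x\<^sup>2) * (s + 1 / s) \<le> 1 * (s + 1/s)" using s by (intro mult_right_mono) auto
    ultimately show ?thesis unfolding mult_1_left by (rule order_trans[rotated])
  next
    case False
    have s1: "s \<ge> 1" using False by (simp add: s_def)
    have "1 / s \<le> 1" using s1 by simp
    then have "s + 1 / s \<le> 2 * s" using s1 by linarith
    also have "2 * s \<le> 2 * x"
    proof -
      have "s * 1 \<le> s * s" using s1 by (intro mult_left_mono) auto
      then show ?thesis using s(2) unfolding power2_eq_square by linarith
    qed
    finally have "\<mu> / x\<^sup>2 * (s + 1 / s) \<le> \<mu> / x\<^sup>2 * (2 * x)" using l by (intro mult_left_mono) auto
    also have "\<dots> = 2 * \<mu> / x" using x by (simp add: power2_eq_square)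
    finally have "\<mu> / x\<^sup>2 * (s + 1 / s) \<le> 2 * \<mu> / x" .
    moreover have "min 1 (\<mu> / x\<^sup>2) * (s + 1 / s) \<le> \<mu> / x\<^sup>2 * (s + 1/s)" using s by (intro mult_right_mono) auto
    ultimately show ?thesis by linarith
  qed
  have "min (1 / A) (H / h\<^sup>2) = min 1 (\<mu> / x\<^sup>2) / A"
    using assms by (simp add: hx min_def power2_eq_square field_simps)
  then have "min (1 / A) (H / h\<^sup>2) * (sqrt (h / A) + sqrt (A / h)) = min 1 (\<mu> / x\<^sup>2) * (s + 1 / s) / A"
    unfolding sA by (simp add: add.commute)
  also have "\<dots> \<le> (2 * \<mu> / x) / A" using m assms by (intro divide_right_mono) auto
  also have "\<dots> = 2 * (H / A) / h" using assms by (simp add: hx)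
  finally show ?thesis .
qed

lemma powr_mult_eq: "a + b = c \<Longrightarrow> x powr a * x powr b = x powr c" for x :: real
  by (simp flip: powr_add)

lemma ln_le_powr: "K \<ge> 1 \<Longrightarrow> \<eta> > 0 \<Longrightarrow> 1 + ln K \<le> (1 + 1 / \<eta>) * K powr \<eta>" for K \<eta> :: real
proof -
  assume a: "K \<ge> 1" "\<eta> > 0"
  have "\<eta> * ln K = ln (K powr \<eta>)" using a by (simp add: ln_powr)
  also have "\<dots> \<le> K powr \<eta> - 1" using a by (intro ln_le_minus_one) auto
  finally have "ln K \<le> K powr \<eta> / \<eta>" using a by (simp add: field_simps)
  moreover have "1 \<le> K powr \<eta>" using a by (simp add: ge_one_powr_ge_zero)
  ultimately show ?thesis by (simp add: algebra_simps)
qed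

lemma powr_eventually_ge:
  fixes c e :: real assumes "e > 0"
  obtains K0 where "K0 \<ge> 1" "\<And>K. K \<ge> K0 \<Longrightarrow> K powr e \<ge> c"
proof -
  define K0 where "K0 = max 1 (max 1 c powr (1 / e))"
  have "K powr e \<ge> c" if "K \<ge> K0" for K
  proof -
    have "c \<le> (max 1 c powr (1 / e)) powr e" using assms by (simp add: powr_powr)
    also have "\<dots> \<le> K powr e" using that assms unfolding K0_def by (intro powr_mono2) auto
    finally show ?thesis .
  qed
  then show ?thesis using that[of K0] unfolding K0_def by auto
qed

section \<open>Sums over blocks\<close>

lemma powr_le_scaled:
  fixes K :: real
  assumes "K > 0" "K / 8 \<le> x" "e \<le> 0"
  shows "x powr e \<le> 8 powr (- e) * K powr e"
proof -
  have "x powr e \<le> (K / 8) powr e" using assms by (intro powr_mono2') auto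
  also have "\<dots> = 8 powr (- e) * K powr e" using assms by (simp add: powr_divide powr_minus field_simps)
  finally show ?thesis .
qed

lemma slope_bounds:
  fixes K \<gamma> :: real
  assumes \<gamma>: "0 < \<gamma>" "\<gamma> < 1" and K: "K \<ge> 1" and x: "K / 8 \<le> x"
  shows "0 \<le> real_of_int \<lfloor>real Q * (\<gamma> * x powr (\<gamma> - 1))\<rfloor>"
    "real_of_int \<lfloor>real Q * (\<gamma> * x powr (\<gamma> - 1))\<rfloor> \<le> real Q * (8 * K powr (\<gamma> - 1))"
proof -
  have "0 \<le> real Q * (\<gamma> * x powr (\<gamma> - 1))" using \<gamma> by simp
  then show "0 \<le> real_of_int \<lfloor>real Q * (\<gamma> * x powr (\<gamma> - 1))\<rfloor>" by simp
  have "x powr (\<gamma> - 1) \<le> 8 powr (- (\<gamma> - 1)) * K powr (\<gamma> - 1)"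
    using x K \<gamma> by (intro powr_le_scaled) auto
  also have "\<dots> \<le> 8 powr 1 * K powr (\<gamma> - 1)" using \<gamma> by (intro mult_right_mono powr_mono) auto
  finally have "\<gamma> * x powr (\<gamma> - 1) \<le> 1 * (8 * K powr (\<gamma> - 1))" using \<gamma> by (intro mult_mono) auto
  then have "real Q * (\<gamma> * x powr (\<gamma> - 1)) \<le> real Q * (8 * K powr (\<gamma> - 1))" by (intro mult_left_mono) auto
  then show "real_of_int \<lfloor>real Q * (\<gamma> * x powr (\<gamma> - 1))\<rfloor> \<le> real Q * (8 * K powr (\<gamma> - 1))" by linarith
qed

text \<open>The derivative of \<open>t powr \<gamma>\<close> is monotone, so starts that are
  \<open>n\<close> apart have slopes at least
  \<open>n * \<gamma> * (1 - \<gamma>) * K powr (\<gamma> - 2)\<close> apart. Rounding can reduce a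
  difference of two values of \<open>p\<close> by at most 1, and \<open>big\<close> ensures that
  half of the gap survives. Multiplication by \<open>h\<close> scales the spacing and also the
  range, which is why \<open>\<bar>h\<bar>\<close> occurs in both factors of the bound.\<close>

lemma large_sieve_slopes:
  fixes K \<gamma> :: real and a :: "nat \<Rightarrow> complex" and h :: int
  assumes \<gamma>: "0 < \<gamma>" "\<gamma> < 1" and K: "K \<ge> 1" and n: "n > 0" and Q: "Q > 0"
    and fin: "finite U" and U: "\<And>u. u \<in> U \<Longrightarrow> K / 8 \<le> real u \<and> real u \<le> K"
    and sep: "\<And>u v. u \<in> U \<Longrightarrow> v \<in> U \<Longrightarrow> u < v \<Longrightarrow> u + n \<le> v"
    and a: "\<And>r. norm (a r) \<le> 1" and h: "h \<noteq> 0"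
    and p: "\<And>u. p u = \<lfloor>real Q * (\<gamma> * real u powr (\<gamma> - 1))\<rfloor>"
    and big: "real Q * (real n * (\<gamma> * (1 - \<gamma>) * K powr (\<gamma> - 2))) \<ge> 2"
  shows "(\<Sum>u\<in>U. norm (\<Sum>r<n. a r * ee (of_nat r * (of_int h * of_int (p u) / real Q))))
    \<le> sqrt (real n * (real (card U) * (4 * (8 * \<bar>of_int h\<bar> * K powr (\<gamma> - 1) + 2)
        * (2 * K powr (2 - \<gamma>) / ((real n)\<^sup>2 * (\<gamma> * (1 - \<gamma>)) * \<bar>of_int h\<bar>) + 1) * (real n * (1 + ln (real n))))))"
proof -
  define \<theta> where "\<theta> = (\<lambda>u. real_of_int h * real_of_int (p u) / real Q)"
  define H where "H = \<bar>real_of_int h\<bar>"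
  have H1: "H \<ge> 1" using h unfolding H_def by linarith
  define c where "c = \<gamma> * (1 - \<gamma>)"
  have c: "c > 0" using \<gamma> by (simp add: c_def)
  define \<sigma> where "\<sigma> = H * (real n * (c * K powr (\<gamma> - 2))) / 2"
  define R where "R = nat \<lceil>8 * H * K powr (\<gamma> - 1)\<rceil> + 1"
  have \<sigma>0: "\<sigma> > 0" unfolding \<sigma>_def using H1 n c K by simp
  have Kp: "K powr (\<gamma> - 1) > 0" using K by simp
  have Rle: "real R \<le> 8 * H * K powr (\<gamma> - 1) + 2"
  proof -
    have "0 \<le> 8 * H * K powr (\<gamma> - 1)" using H1 Kp by simp
    then show ?thesis unfolding R_def by linarith
  qed
  have Rgt: "8 * H * K powr (\<gamma> - 1) < real R" unfolding R_def by linarith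
  have pb: "0 \<le> real_of_int (p u)" "real_of_int (p u) \<le> real Q * (8 * K powr (\<gamma> - 1))" if "u \<in> U" for u
    unfolding p using slope_bounds[OF \<gamma> K] U[OF that] by auto
  have gap: "real Q * (real n * (c * K powr (\<gamma> - 2))) / 2 \<le> real_of_int (p u) - real_of_int (p v)"
    if uv: "u \<in> U" "v \<in> U" "u < v" for u v
  proof -
    have u0: "real u > 0" using U[OF uv(1)] K by linarith
    obtain z where z: "real u < z" "z < real v"
      "\<gamma> * real u powr (\<gamma> - 1) - \<gamma> * real v powr (\<gamma> - 1) = (real v - real u) * (\<gamma> * (1 - \<gamma>) * z powr (\<gamma> - 2))"
      using powr_deriv_diff[of "real u" "real v" \<gamma>] u0 uv by auto
    have "K powr (\<gamma> - 2) \<le> z powr (\<gamma> - 2)" using z u0 U[OF uv(2)] \<gamma> by (intro powr_mono2') auto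
    then have "c * K powr (\<gamma> - 2) \<le> \<gamma> * (1 - \<gamma>) * z powr (\<gamma> - 2)" unfolding c_def using \<gamma> by (intro mult_left_mono) auto
    moreover have "real n \<le> real v - real u" using sep[OF uv] by linarith
    ultimately have "real n * (c * K powr (\<gamma> - 2)) \<le> (real v - real u) * (\<gamma> * (1 - \<gamma>) * z powr (\<gamma> - 2))"
      by (intro mult_mono[where c = "c * K powr (\<gamma> - 2)"]) (use c uv in auto)
    then have "real Q * (real n * (c * K powr (\<gamma> - 2))) \<le> real Q * (\<gamma> * real u powr (\<gamma> - 1) - \<gamma> * real v powr (\<gamma> - 1))"
      unfolding z(3) by (intro mult_left_mono) auto
    then have "real Q * (real n * (c * K powr (\<gamma> - 2))) \<le> real Q * (\<gamma> * real u powr (\<gamma> - 1)) - real Q * (\<gamma> * real v powr (\<gamma> - 1))"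
      by (simp add: right_diff_distrib)
    moreover have "real Q * (\<gamma> * real u powr (\<gamma> - 1)) - 1 \<le> real_of_int (p u)" "real_of_int (p v) \<le> real Q * (\<gamma> * real v powr (\<gamma> - 1))"
      unfolding p by linarith+
    moreover have "real Q * (real n * (c * K powr (\<gamma> - 2))) \<ge> 2" using big unfolding c_def .
    ultimately show ?thesis by linarith
  qed
  have sepQ: "\<sigma> \<le> \<bar>\<theta> u - \<theta> v\<bar>" if uv: "u \<in> U" "v \<in> U" "u \<noteq> v" for u v
  proof -
    have "real Q * (real n * (c * K powr (\<gamma> - 2))) / 2 \<le> \<bar>real_of_int (p u) - real_of_int (p v)\<bar>"
    proof (cases "u < v")
      case True
      then show ?thesis using gap[OF uv(1,2)] by linarith
    next
      case False
      then show ?thesis using gap[OF uv(2,1)] uv(3) by linarith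
    qed
    then have le: "H * (real Q * (real n * (c * K powr (\<gamma> - 2))) / 2) \<le> H * \<bar>real_of_int (p u) - real_of_int (p v)\<bar>"
      using H1 by (intro mult_left_mono) auto
    have "\<theta> u - \<theta> v = real_of_int h * (real_of_int (p u) - real_of_int (p v)) / real Q"
      unfolding \<theta>_def by (simp add: right_diff_distrib diff_divide_distrib)
    then have eq: "\<bar>\<theta> u - \<theta> v\<bar> = H * \<bar>real_of_int (p u) - real_of_int (p v)\<bar> / real Q"
      unfolding H_def by (simp add: abs_mult)
    have "H * (real Q * (real n * (c * K powr (\<gamma> - 2))) / 2) / real Q \<le> \<bar>\<theta> u - \<theta> v\<bar>"
      unfolding eq by (rule divide_right_mono[OF le]) simp
    moreover have "H * (real Q * (real n * (c * K powr (\<gamma> - 2))) / 2) / real Q = \<sigma>"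
      unfolding \<sigma>_def using Q by simp
    ultimately show ?thesis by simp
  qed
  have each: "(\<Sum>v\<in>U. norm (\<Sum>r<n. ee (of_nat r * (\<theta> u - \<theta> v))))
      \<le> 4 * real R * (1 / (real n * \<sigma>) + 1) * (real n * (1 + ln (real n)))" if u: "u \<in> U" for u
  proof (rule sum_kernel_separated[OF fin n \<sigma>0])
    fix v assume v: "v \<in> U"
    have "\<bar>real_of_int (p u) - real_of_int (p v)\<bar> \<le> real Q * (8 * K powr (\<gamma> - 1))" using pb[OF u] pb[OF v] by linarith
    then have le: "H * \<bar>real_of_int (p u) - real_of_int (p v)\<bar> \<le> H * (real Q * (8 * K powr (\<gamma> - 1)))" using H1 by (intro mult_left_mono) auto
    have "\<theta> u - \<theta> v = real_of_int h * (real_of_int (p u) - real_of_int (p v)) / real Q"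
      unfolding \<theta>_def by (simp add: right_diff_distrib diff_divide_distrib)
    then have eq: "\<bar>\<theta> u - \<theta> v\<bar> = H * \<bar>real_of_int (p u) - real_of_int (p v)\<bar> / real Q"
      unfolding H_def by (simp add: abs_mult)
    have "\<bar>\<theta> u - \<theta> v\<bar> \<le> H * (real Q * (8 * K powr (\<gamma> - 1))) / real Q"
      unfolding eq by (rule divide_right_mono[OF le]) simp
    also have "\<dots> = 8 * H * K powr (\<gamma> - 1)" using Q by simp
    finally have "\<bar>\<theta> u - \<theta> v\<bar> < real R" using Rgt by linarith
    then show "- real R \<le> \<theta> u - \<theta> v \<and> \<theta> u - \<theta> v < real R" by linarith
  next
    fix v w assume "v \<in> U" "w \<in> U" "v \<noteq> w"
    then show "\<sigma> \<le> \<bar>\<theta> u - \<theta> v - (\<theta> u - \<theta> w)\<bar>" using sepQ[of w v] by simp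
  qed
  have inv: "1 / (real n * \<sigma>) = 2 * K powr (2 - \<gamma>) / ((real n)\<^sup>2 * c * H)"
  proof -
    have "K powr (2 - \<gamma>) * K powr (\<gamma> - 2) = 1" using K by (simp flip: powr_add)
    then have "K powr (\<gamma> - 2) = 1 / K powr (2 - \<gamma>)" using K by (simp add: field_simps)
    then show ?thesis unfolding \<sigma>_def using n c H1 K by (simp add: field_simps power2_eq_square)
  qed
  have nln: "real n * (1 + ln (real n)) \<ge> 0" using n by (intro mult_nonneg_nonneg add_nonneg_nonneg) auto
  have fac: "1 / (real n * \<sigma>) + 1 \<ge> 0" using \<sigma>0 by (intro add_nonneg_nonneg) auto
  have "(\<Sum>u\<in>U. \<Sum>v\<in>U. norm (\<Sum>r<n. ee (of_nat r * (\<theta> u - \<theta> v))))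
     \<le> (\<Sum>u\<in>U. 4 * (8 * H * K powr (\<gamma> - 1) + 2) * (1 / (real n * \<sigma>) + 1) * (real n * (1 + ln (real n))))"
    by (intro sum_mono order_trans[OF each] mult_right_mono mult_left_mono Rle nln fac) auto
  also have "\<dots> = real (card U) * (4 * (8 * H * K powr (\<gamma> - 1) + 2) * (1 / (real n * \<sigma>) + 1) * (real n * (1 + ln (real n))))" by simp
  finally have "real n * (\<Sum>u\<in>U. \<Sum>v\<in>U. norm (\<Sum>r<n. ee (of_nat r * (\<theta> u - \<theta> v))))
     \<le> real n * (real (card U) * (4 * (8 * H * K powr (\<gamma> - 1) + 2) * (1 / (real n * \<sigma>) + 1) * (real n * (1 + ln (real n)))))"
    by (intro mult_left_mono) auto
  then have "sqrt (real n * (\<Sum>u\<in>U. \<Sum>v\<in>U. norm (\<Sum>r<n. ee (of_nat r * (\<theta> u - \<theta> v)))))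
     \<le> sqrt (real n * (real (card U) * (4 * (8 * H * K powr (\<gamma> - 1) + 2) * (1 / (real n * \<sigma>) + 1) * (real n * (1 + ln (real n))))))"
    by (rule real_sqrt_le_mono)
  with large_sieve_dual[OF fin a, where n = n and \<theta> = \<theta>]
  show ?thesis unfolding inv \<theta>_def H_def c_def by (rule order_trans)
qed

text \<open>With \<open>A = K powr (1 - \<gamma>)\<close> the number of unit intervals is about
  \<open>H / A + 1\<close> and the number of points per cell, up to
  \<open>K powr (2 * \<eta>)\<close>, about \<open>A / H + 1\<close>. Their product is the square of
  \<open>sqrt (H / A) + sqrt (A / H)\<close>. The remaining factor is \<open>K\<close> times the
  block length, so its root is \<open>K powr (3/4)\<close> up to \<open>\<eta>\<close>.\<close>

lemma large_sieve_slopes_powr: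
  fixes K \<gamma> \<eta> :: real and a :: "nat \<Rightarrow> complex" and h :: int
  assumes \<gamma>: "0 < \<gamma>" "\<gamma> < 1" and \<eta>: "0 < \<eta>" "\<eta> < 1/4" and K: "K \<ge> 1" and n: "n > 0" and Q: "Q > 0"
    and nK: "K powr (1/2 - \<eta>) / 4 \<le> real n" "real n \<le> K powr (1/2 - \<eta>)"
    and fin: "finite U" and U: "\<And>u. u \<in> U \<Longrightarrow> K / 8 \<le> real u \<and> real u \<le> K"
    and cardU: "real n * real (card U) \<le> 2 * K"
    and sep: "\<And>u v. u \<in> U \<Longrightarrow> v \<in> U \<Longrightarrow> u < v \<Longrightarrow> u + n \<le> v"
    and a: "\<And>r. norm (a r) \<le> 1" and h: "h \<noteq> 0"
    and p: "\<And>u. p u = \<lfloor>real Q * (\<gamma> * real u powr (\<gamma> - 1))\<rfloor>"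
    and big: "real Q * (real n * (\<gamma> * (1 - \<gamma>) * K powr (\<gamma> - 2))) \<ge> 2"
  shows "(\<Sum>u\<in>U. norm (\<Sum>r<n. a r * ee (of_nat r * (of_int h * of_int (p u) / real Q))))
    \<le> sqrt (2048 / (\<gamma> * (1 - \<gamma>)) * (1 + 1 / \<eta>)) * K powr (3/4 + \<eta>)
        * (sqrt (\<bar>of_int h\<bar> / K powr (1 - \<gamma>)) + sqrt (K powr (1 - \<gamma>) / \<bar>of_int h\<bar>))"
proof -
  define H where "H = \<bar>real_of_int h\<bar>"
  have H1: "H \<ge> 1" using h unfolding H_def by linarith
  define c where "c = \<gamma> * (1 - \<gamma>)"
  have "\<gamma> * (1 - \<gamma>) \<le> 1 * 1" using \<gamma> by (intro mult_mono) auto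
  then have c: "c > 0" "c \<le> 1" using \<gamma> by (auto simp: c_def)
  define A where "A = K powr (1 - \<gamma>)"
  have A: "A > 0" using K by (simp add: A_def)
  have KA: "K powr (\<gamma> - 1) = 1 / A" unfolding A_def using K by (simp add: powr_minus_divide[symmetric])
  have K2: "K powr (2 - \<gamma>) = K * A" unfolding A_def using K by (simp add: powr_add[symmetric] powr_mult_base)
  have n2: "K powr (1 - 2 * \<eta>) / 16 \<le> (real n)\<^sup>2"
  proof -
    have "(K powr (1/2 - \<eta>) / 4)\<^sup>2 \<le> (real n)\<^sup>2" using nK by (intro power_mono) auto
    moreover have "(K powr (1/2 - \<eta>))\<^sup>2 = K powr (1 - 2 * \<eta>)" using K by (simp add: power2_eq_square flip: powr_add)
    ultimately show ?thesis by (simp add: power_divide)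
  qed
  have f1: "8 * H * K powr (\<gamma> - 1) + 2 \<le> 8 * (H / A + 1)" unfolding KA by simp
  have f2: "2 * K powr (2 - \<gamma>) / ((real n)\<^sup>2 * c * H) + 1 \<le> 32 / c * K powr (2 * \<eta>) * (A / H + 1)"
  proof -
    have "2 * K powr (2 - \<gamma>) / ((real n)\<^sup>2 * c * H) \<le> 2 * K powr (2 - \<gamma>) / (K powr (1 - 2 * \<eta>) / 16 * c * H)"
      using n2 c H1 K n by (intro divide_left_mono mult_right_mono mult_pos_pos) auto
    also have "\<dots> = 32 / c * (K / K powr (1 - 2 * \<eta>)) * (A / H)" unfolding K2 using c H1 by (simp add: field_simps)
    also have "K / K powr (1 - 2 * \<eta>) = K powr (2 * \<eta>)" using K powr_diff[of K 1 "1 - 2 * \<eta>"] by simp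
    finally have 1: "2 * K powr (2 - \<gamma>) / ((real n)\<^sup>2 * c * H) \<le> 32 / c * K powr (2 * \<eta>) * (A / H)" .
    have "1 * 1 \<le> 32 / c * K powr (2 * \<eta>)" using c K \<eta> by (intro mult_mono) (auto simp: field_simps ge_one_powr_ge_zero)
    then show ?thesis using 1 unfolding distrib_left by linarith
  qed
  have lnn: "1 + ln (real n) \<le> (1 + 1 / \<eta>) * K powr \<eta>"
  proof -
    have "K powr (1/2 - \<eta>) \<le> K powr 1" using K \<eta> by (intro powr_mono) auto
    then have "ln (real n) \<le> ln K" using nK(2) n K by (subst ln_le_cancel_iff) auto
    then show ?thesis using ln_le_powr[OF K \<eta>(1)] by linarith
  qed
  have ln0: "0 \<le> 1 + ln (real n)" using n by (intro add_nonneg_nonneg) auto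
  have reassoc: "(2 * K) * (4 * ((8 * x) * (32 / c * y * z)) * (s * (e * t))) = 2048 / c * e * (K * y * s * t) * (x * z)"
    for x y z s e t :: real by simp
  have prod: "(H / A + 1) * (A / H + 1) = (sqrt (H / A) + sqrt (A / H))\<^sup>2"
  proof -
    have "sqrt (H / A) * sqrt (A / H) = 1" using A H1 by (simp flip: real_sqrt_mult)
    then show ?thesis using A H1 by (simp add: power2_sum) (simp add: field_simps)
  qed
  have "real n * (real (card U) * (4 * (8 * H * K powr (\<gamma> - 1) + 2)
        * (2 * K powr (2 - \<gamma>) / ((real n)\<^sup>2 * c * H) + 1) * (real n * (1 + ln (real n)))))
     = (real n * real (card U)) * (4 * ((8 * H * K powr (\<gamma> - 1) + 2)
        * (2 * K powr (2 - \<gamma>) / ((real n)\<^sup>2 * c * H) + 1)) * (real n * (1 + ln (real n))))" by (simp add: mult_ac)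
  also have "\<dots> \<le> (2 * K) * (4 * ((8 * (H / A + 1)) * (32 / c * K powr (2 * \<eta>) * (A / H + 1))) * (K powr (1/2 - \<eta>) * ((1 + 1 / \<eta>) * K powr \<eta>)))"
    by (rule mult_mono[OF cardU mult_mono[OF mult_left_mono[OF mult_mono[OF f1 f2]] mult_mono[OF nK(2) lnn]]])
       (use K A H1 c n ln0 \<eta> in \<open>auto intro!: mult_nonneg_nonneg add_nonneg_nonneg divide_nonneg_nonneg\<close>)
  also have "\<dots> = 2048 / c * (1 + 1 / \<eta>) * (K * K powr (2 * \<eta>) * K powr (1/2 - \<eta>) * K powr \<eta>) * ((H / A + 1) * (A / H + 1))"
    by (rule reassoc)
  also have "K * K powr (2 * \<eta>) * K powr (1/2 - \<eta>) * K powr \<eta> = (K powr (3/4 + \<eta>))\<^sup>2"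
  proof -
    have "K * K powr (2 * \<eta>) * K powr (1/2 - \<eta>) * K powr \<eta> = K powr 1 * K powr (2 * \<eta>) * K powr (1/2 - \<eta>) * K powr \<eta>" using K by simp
    also have "\<dots> = K powr (3/4 + \<eta>) * K powr (3/4 + \<eta>)"
      unfolding powr_add[symmetric] by (rule arg_cong[where f = "(powr) K"]) simp
    finally show ?thesis by (simp add: power2_eq_square)
  qed
  finally have le: "real n * (real (card U) * (4 * (8 * H * K powr (\<gamma> - 1) + 2)
        * (2 * K powr (2 - \<gamma>) / ((real n)\<^sup>2 * c * H) + 1) * (real n * (1 + ln (real n)))))
     \<le> 2048 / c * (1 + 1 / \<eta>) * (K powr (3/4 + \<eta>) * (sqrt (H / A) + sqrt (A / H)))\<^sup>2"
    unfolding prod by (simp add: power_mult_distrib mult.assoc)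
  have "(\<Sum>u\<in>U. norm (\<Sum>r<n. a r * ee (of_nat r * (of_int h * of_int (p u) / real Q))))
    \<le> sqrt (real n * (real (card U) * (4 * (8 * H * K powr (\<gamma> - 1) + 2)
        * (2 * K powr (2 - \<gamma>) / ((real n)\<^sup>2 * c * H) + 1) * (real n * (1 + ln (real n))))))"
    unfolding H_def c_def by (rule large_sieve_slopes) (use assms in auto)
  also have "\<dots> \<le> sqrt (2048 / c * (1 + 1 / \<eta>) * (K powr (3/4 + \<eta>) * (sqrt (H / A) + sqrt (A / H)))\<^sup>2)"
    using le by (rule real_sqrt_le_mono)
  also have "\<dots> = sqrt (2048 / c * (1 + 1 / \<eta>)) * (K powr (3/4 + \<eta>) * (sqrt (H / A) + sqrt (A / H)))"
    using A H1 by (subst real_sqrt_mult) (simp add: abs_mult abs_of_nonneg)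
  finally show ?thesis unfolding H_def c_def A_def by (simp add: mult.assoc)
qed

text \<open>The exponent collects three losses of size \<open>\<eta>\<close>: one from the large
  sieve, one from smoothing (\<open>H / A = K powr \<eta>\<close>), and one from the harmonic sum
  over frequencies. The modulus \<open>Q\<close> enters this last loss only through its logarithm,
  so any fixed power of \<open>K\<close> is affordable.\<close>

lemma smooth_ind_slopes:
  fixes K \<gamma> \<eta> :: real and a :: "nat \<Rightarrow> complex" and b :: "nat \<Rightarrow> int" and P :: "nat \<Rightarrow> nat"
  assumes \<gamma>: "0 < \<gamma>" "\<gamma> < 1" and \<eta>: "0 < \<eta>" "\<eta> < 1/4" and K: "K \<ge> 1" and n: "n > 0" and Q: "Q > 0"
    and nK: "K powr (1/2 - \<eta>) / 4 \<le> real n" "real n \<le> K powr (1/2 - \<eta>)"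
    and fin: "finite U" and U: "\<And>u. u \<in> U \<Longrightarrow> K / 8 \<le> real u \<and> real u \<le> K"
    and cardU: "real n * real (card U) \<le> 2 * K"
    and sep: "\<And>u v. u \<in> U \<Longrightarrow> v \<in> U \<Longrightarrow> u < v \<Longrightarrow> u + n \<le> v"
    and a: "\<And>r. norm (a r) \<le> 1"
    and p: "\<And>u. p u = \<lfloor>real Q * (\<gamma> * real u powr (\<gamma> - 1))\<rfloor>"
    and big: "real Q * (real n * (\<gamma> * (1 - \<gamma>) * K powr (\<gamma> - 2))) \<ge> 2"
    and Q2: "real Q \<le> 2 * K\<^sup>2" and J: "J > 0" "real Q * K powr (\<gamma> - 1 - \<eta>) \<le> real J"
    and P: "\<And>u. u \<in> U \<Longrightarrow> P u \<le> P0" "real P0 \<le> 12 * (real Q * K powr (\<gamma> - 1))"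
  shows "(\<Sum>u\<in>U. norm ((\<Sum>r<n. a r * of_real (smooth_ind Q J (P u) (b u + int r * p u)))
             - of_real (real (P u) / real Q) * (\<Sum>r<n. a r)))
    \<le> 96 * (1 + 1 / \<eta>) * sqrt (2048 / (\<gamma> * (1 - \<gamma>)) * (1 + 1 / \<eta>)) * K powr (3/4 + 3 * \<eta>)"
proof -
  define A where "A = K powr (1 - \<gamma>)"
  have A: "A > 0" using K by (simp add: A_def)
  define H where "H = A * K powr \<eta>"
  have K\<eta>: "K powr \<eta> \<ge> 1" using K \<eta> by (simp add: ge_one_powr_ge_zero)
  have HA: "H \<ge> A" "H / A = K powr \<eta>" unfolding H_def using A K\<eta> by auto
  define C1 where "C1 = sqrt (2048 / (\<gamma> * (1 - \<gamma>)) * (1 + 1 / \<eta>))"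
  have C1: "C1 \<ge> 0" unfolding C1_def using \<gamma> \<eta> by simp
  have reassoc: "2 * (48 * x * e * k) = 96 * e * x * k" for x e k :: real by simp
  define L where "L = (\<lambda>h. C1 * K powr (3/4 + \<eta>) * (sqrt (real h / A) + sqrt (A / real h)))"
  have first: "(\<Sum>u\<in>U. norm ((\<Sum>r<n. a r * of_real (smooth_ind Q J (P u) (b u + int r * p u)))
             - of_real (real (P u) / real Q) * (\<Sum>r<n. a r)))
    \<le> 2 * (\<Sum>h=1..<Q. min (real P0 / real Q) (real Q / (4 * real J * (real h)\<^sup>2)) * L h)"
  proof (rule smooth_ind_linear_sum[OF Q J(1) fin P(1)])
    fix h :: int assume h: "h \<noteq> 0"
    have "(\<Sum>u\<in>U. norm (\<Sum>r<n. a r * ee (of_nat r * (of_int h * of_int (p u) / real Q))))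
    \<le> sqrt (2048 / (\<gamma> * (1 - \<gamma>)) * (1 + 1 / \<eta>)) * K powr (3/4 + \<eta>)
        * (sqrt (\<bar>of_int h\<bar> / K powr (1 - \<gamma>)) + sqrt (K powr (1 - \<gamma>) / \<bar>of_int h\<bar>))"
      by (rule large_sieve_slopes_powr[OF \<gamma> \<eta> K n Q nK fin U cardU sep a h p big])
    then show "(\<Sum>u\<in>U. norm (\<Sum>r<n. a r * ee (of_nat r * (of_int h * of_int (p u) / real Q)))) \<le> L (nat \<bar>h\<bar>)"
      unfolding L_def C1_def A_def by simp
  qed
  have "(\<Sum>h=1..<Q. min (real P0 / real Q) (real Q / (4 * real J * (real h)\<^sup>2)) * L h)
    \<le> (\<Sum>h=1..<Q. 24 * C1 * K powr (3/4 + 2 * \<eta>) * (1 / real h))"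
  proof (rule sum_mono)
    fix h assume "h \<in> {1..<Q}"
    then have h: "real h > 0" by simp
    have L0: "sqrt (real h / A) + sqrt (A / real h) \<ge> 0" using A h by (intro add_nonneg_nonneg) auto
    have KA: "K powr (\<gamma> - 1) = 1 / A" unfolding A_def using K by (simp add: powr_minus_divide[symmetric])
    have "real P0 / real Q \<le> 12 * (1 / A)" using P(2) Q unfolding KA by (simp add: field_simps)
    moreover have "real Q / (4 * real J * (real h)\<^sup>2) \<le> 12 * (H / (real h)\<^sup>2)"
    proof -
      have "K powr (\<gamma> - 1 - \<eta>) = 1 / H" unfolding H_def A_def using K
        by (simp add: powr_add[symmetric] powr_minus_divide[symmetric])
      then have "real Q / H \<le> real J" using J(2) by simp
      then have QJ: "real Q \<le> real J * H" using HA A by (simp add: field_simps)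
      have "real Q / (4 * real J * (real h)\<^sup>2) \<le> (real J * H) / (4 * real J * (real h)\<^sup>2)"
        using QJ by (intro divide_right_mono) auto
      also have "\<dots> = (1/4) * (H / (real h)\<^sup>2)" using J(1) by simp
      also have "\<dots> \<le> 12 * (H / (real h)\<^sup>2)" using HA A by (intro mult_right_mono) auto
      finally show ?thesis .
    qed
    ultimately have "min (real P0 / real Q) (real Q / (4 * real J * (real h)\<^sup>2)) \<le> 12 * min (1 / A) (H / (real h)\<^sup>2)"
      by (auto simp: min_def)
    then have "min (real P0 / real Q) (real Q / (4 * real J * (real h)\<^sup>2)) * L h
      \<le> 12 * min (1 / A) (H / (real h)\<^sup>2) * L h"
      unfolding L_def using C1 L0 by (intro mult_right_mono mult_nonneg_nonneg) auto
    also have "\<dots> = 12 * C1 * K powr (3/4 + \<eta>) * (min (1 / A) (H / (real h)\<^sup>2) * (sqrt (real h / A) + sqrt (A / real h)))"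
      unfolding L_def by (simp add: mult_ac)
    also have "\<dots> \<le> 12 * C1 * K powr (3/4 + \<eta>) * (2 * (H / A) / real h)"
      using min_interpolation[OF A HA(1) h] C1 by (intro mult_left_mono) auto
    also have "\<dots> = 24 * C1 * (K powr (3/4 + \<eta>) * K powr \<eta>) * (1 / real h)" unfolding HA(2) by simp
    also have "K powr (3/4 + \<eta>) * K powr \<eta> = K powr (3/4 + 2 * \<eta>)" by (rule powr_mult_eq) simp
    finally show "min (real P0 / real Q) (real Q / (4 * real J * (real h)\<^sup>2)) * L h \<le> 24 * C1 * K powr (3/4 + 2 * \<eta>) * (1 / real h)" .
  qed
  also have "\<dots> = 24 * C1 * K powr (3/4 + 2 * \<eta>) * (\<Sum>h=1..<Q. 1 / real h)" by (simp only: sum_distrib_left)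
  also have "\<dots> \<le> 24 * C1 * K powr (3/4 + 2 * \<eta>) * (2 * (1 + 1 / \<eta>) * K powr \<eta>)"
  proof (rule mult_left_mono)
    show "(\<Sum>h=1..<Q. 1 / real h) \<le> 2 * (1 + 1 / \<eta>) * K powr \<eta>"
    proof -
      have "(\<Sum>h=1..<Q. 1 / real h) \<le> (\<Sum>h=1..Q. 1 / real h)" by (intro sum_mono2) auto
      also have "\<dots> = harm Q" by (simp add: harm_def inverse_eq_divide)
      also have "\<dots> \<le> 1 + ln (real Q)" using Q by (intro harm_le_ln) auto
      also have "ln (real Q) \<le> ln (2 * K\<^sup>2)" using Q2 Q K by (subst ln_le_cancel_iff) auto
      also have "ln (2 * K\<^sup>2) = ln 2 + 2 * ln K" using K by (simp add: ln_mult ln_realpow)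
      also have "ln (2::real) \<le> 1" using ln_2_less_1 by simp
      finally have "(\<Sum>h=1..<Q. 1 / real h) \<le> 2 * (1 + ln K)" by simp
      then show ?thesis using ln_le_powr[OF K \<eta>(1)]
        by (simp only: mult.assoc) (rule order_trans, assumption, rule mult_left_mono, auto)
    qed
  qed (use C1 in auto)
  also have "\<dots> = 48 * C1 * (1 + 1 / \<eta>) * (K powr (3/4 + 2 * \<eta>) * K powr \<eta>)" by simp
  also have "K powr (3/4 + 2 * \<eta>) * K powr \<eta> = K powr (3/4 + 3 * \<eta>)" by (rule powr_mult_eq) simp
  finally have "2 * (\<Sum>h=1..<Q. min (real P0 / real Q) (real Q / (4 * real J * (real h)\<^sup>2)) * L h)
    \<le> 2 * (48 * C1 * (1 + 1 / \<eta>) * K powr (3/4 + 3 * \<eta>))" by (rule mult_left_mono) simp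
  with first show ?thesis unfolding reassoc C1_def by (rule order_trans)
qed

text \<open>For \<open>\<gamma> = 1 / c\<close> this is the number of \<open>n\<close> with \<open>\<lfloor>n powr c\<rfloor> = k\<close>.\<close>

definition ps_gap :: "real \<Rightarrow> nat \<Rightarrow> int" where
  "ps_gap \<gamma> k = \<lceil>real (Suc k) powr \<gamma>\<rceil> - \<lceil>real k powr \<gamma>\<rceil>"

text \<open>The linear model advances by exactly \<open>p\<close> from \<open>r\<close> to
  \<open>Suc r\<close>, so the difference of the two averaged ceilings is \<open>smooth_ind\<close>
  with width \<open>p\<close>. Each endpoint contributes one wide indicator as error.\<close>

lemma ps_gap_smooth_approx:
  fixes b p :: int
  assumes Q: "Q > 0" and J: "J > 0" "2 * J < Q" and p: "p \<ge> 0"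
    and lin: "\<And>r. r \<le> n \<Longrightarrow> \<bar>real Q * real (u + r) powr \<gamma> - real_of_int (b + int r * p)\<bar> \<le> real J" and r: "r < n"
  shows "\<bar>real_of_int (ps_gap \<gamma> (u + r)) - smooth_ind Q J (nat p) (b + int r * p)\<bar>
    \<le> smooth_ind Q J (6 * J) (b - 3 * int J + int r * p) + smooth_ind Q J (6 * J) (b + p - 3 * int J + int r * p)"
proof -
  define V where "V = (\<lambda>q. (\<Sum>t<J. real_of_int \<lceil>real_of_int (q + int t) / real Q\<rceil>) / real J)"
  have 1: "\<bar>real_of_int \<lceil>real (u + r) powr \<gamma>\<rceil> - V (b + int r * p)\<bar> \<le> smooth_ind Q J (6 * J) (b + int r * p - 3 * int J)"
    unfolding V_def using lin[of r] r by (intro ceiling_approx[OF Q J]) auto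
  have "\<bar>real Q * real (u + Suc r) powr \<gamma> - real_of_int (b + int (Suc r) * p)\<bar> \<le> real J" using lin[of "Suc r"] r by auto
  from ceiling_approx[OF Q J this]
  have 2: "\<bar>real_of_int \<lceil>real (Suc (u + r)) powr \<gamma>\<rceil> - V (b + int (Suc r) * p)\<bar> \<le> smooth_ind Q J (6 * J) (b + int (Suc r) * p - 3 * int J)"
    unfolding V_def by simp
  have e: "b + int (Suc r) * p = b + int r * p + int (nat p)" using p by (simp add: algebra_simps)
  have 3: "smooth_ind Q J (nat p) (b + int r * p) = V (b + int (Suc r) * p) - V (b + int r * p)"
    unfolding smooth_ind_eq_ceiling[OF Q] V_def e ..
  have 4: "b + int r * p - 3 * int J = b - 3 * int J + int r * p" "b + int (Suc r) * p - 3 * int J = b + p - 3 * int J + int r * p"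
    by (auto simp: algebra_simps)
  show ?thesis using 1 2 unfolding 3 4 ps_gap_def by linarith
qed

text \<open>The three error terms are the curvature, the rounding of the intercept, and the rounding
  of the slope accumulated over the block.\<close>

lemma block_linear_approx:
  fixes u r n Q :: nat and \<gamma> M :: real
  assumes \<gamma>: "0 < \<gamma>" "\<gamma> < 1" and u: "u > 0" and r: "r \<le> n" and M: "real u powr (\<gamma> - 2) \<le> M"
  shows "\<bar>real Q * real (u + r) powr \<gamma> - real_of_int (\<lfloor>real Q * real u powr \<gamma>\<rfloor> + int r * \<lfloor>real Q * (\<gamma> * real u powr (\<gamma> - 1))\<rfloor>)\<bar>
    \<le> real Q * ((real n)\<^sup>2 * M) + 1 + real n"
proof -
  define b p where "b = real Q * real u powr \<gamma>" and "p = real Q * (\<gamma> * real u powr (\<gamma> - 1))"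
  have "\<bar>real Q * ((real u + real r) powr \<gamma> - (real u powr \<gamma> + real r * (\<gamma> * real u powr (\<gamma> - 1))))\<bar>
     \<le> real Q * ((real r)\<^sup>2 * real u powr (\<gamma> - 2))"
    unfolding abs_mult using powr_linear_approx[of "real u" "real r" \<gamma>] \<gamma> u by (simp add: mult_left_mono)
  also have "\<dots> \<le> real Q * ((real n)\<^sup>2 * M)" using r M by (intro mult_left_mono mult_mono power_mono) auto
  finally have 1: "\<bar>real Q * real (u + r) powr \<gamma> - (b + real r * p)\<bar> \<le> real Q * ((real n)\<^sup>2 * M)"
    unfolding b_def p_def by (simp add: algebra_simps)
  have 2: "\<bar>b - of_int \<lfloor>b\<rfloor>\<bar> \<le> 1" by linarith
  have "\<bar>p - of_int \<lfloor>p\<rfloor>\<bar> \<le> 1" by linarith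
  then have "real r * \<bar>p - of_int \<lfloor>p\<rfloor>\<bar> \<le> real n * 1" using r by (intro mult_mono) auto
  then have 3: "\<bar>real r * p - real r * of_int \<lfloor>p\<rfloor>\<bar> \<le> real n"
    by (simp add: right_diff_distrib[symmetric] abs_mult)
  have "real_of_int (\<lfloor>b\<rfloor> + int r * \<lfloor>p\<rfloor>) = of_int \<lfloor>b\<rfloor> + real r * of_int \<lfloor>p\<rfloor>" by simp
  then show ?thesis using 1 2 3 unfolding b_def[symmetric] p_def[symmetric] by linarith
qed

lemma card_separated_nat_le:
  fixes U :: "nat set" and K :: real
  assumes n: "n > 0" and fin: "finite U" and U: "\<And>u. u \<in> U \<Longrightarrow> real u \<le> K"
    and sep: "\<And>u v. u \<in> U \<Longrightarrow> v \<in> U \<Longrightarrow> u < v \<Longrightarrow> u + n \<le> v" and K: "K \<ge> 0"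
  shows "real n * real (card U) \<le> K + real n"
proof -
  have "real (card (real ` U)) \<le> K / real n + 1"
  proof (rule card_separated_le(2)[where a = 0])
    fix y z assume yz: "y \<in> real ` U" "z \<in> real ` U" "y < z"
    then obtain u v where "u \<in> U" "v \<in> U" "y = real u" "z = real v" by auto
    then show "y + real n \<le> z" using sep[of u v] yz(3) by auto
  qed (use n K U in auto)
  moreover have "card (real ` U) = card U" by (intro card_image) (auto simp: inj_on_def)
  ultimately have "real n * real (card U) \<le> real n * (K / real n + 1)" by (intro mult_left_mono) auto
  also have "\<dots> = K + real n" using n by (simp add: field_simps)
  finally show ?thesis .
qed

text \<open>On each block the gap is replaced by \<open>smooth_ind\<close> of width
  \<open>p u\<close>. Its nonzero frequencies are handled by the large sieve, while frequency zero
  produces the last term, in which \<open>a\<close> can still exhibit cancellation. The replacement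
  error consists of two nonnegative indicators, so their total is evaluated by the same Fourier
  estimate with all coefficients equal to 1.\<close>

proposition ps_gap_block_sums:
  fixes \<gamma> \<eta> :: real
  assumes \<gamma>: "3/4 < \<gamma>" "\<gamma> < 1" and \<eta>: "\<eta> = (\<gamma> - 3/4) / 4"
  obtains C K0 :: real where "C \<ge> 0" "K0 \<ge> 1"
    "\<And>K n U a. K \<ge> K0 \<Longrightarrow> K powr (1/2 - \<eta>) / 4 \<le> real n \<Longrightarrow> real n \<le> K powr (1/2 - \<eta>) \<Longrightarrow>
       finite U \<Longrightarrow> (\<And>u. u \<in> U \<Longrightarrow> K / 8 \<le> real u \<and> real u \<le> K) \<Longrightarrow>
       (\<And>u v. u \<in> U \<Longrightarrow> v \<in> U \<Longrightarrow> u < v \<Longrightarrow> u + n \<le> v) \<Longrightarrow>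
       (\<And>r. norm (a r :: complex) \<le> 1) \<Longrightarrow>
       (\<Sum>u\<in>U. norm (\<Sum>r<n. a r * of_int (ps_gap \<gamma> (u + r))))
         \<le> C * (K powr (\<gamma> - \<eta>) + K powr (\<gamma> - 1) * (\<Sum>u\<in>U. norm (\<Sum>r<n. a r)))"
proof -
  have \<gamma>0: "0 < \<gamma>" and \<eta>0: "0 < \<eta>" "\<eta> < 1/16" "\<eta> < 1/4" using \<gamma> \<eta> by auto
  define c where "c = \<gamma> * (1 - \<gamma>)"
  have c: "c > 0" using \<gamma> by (simp add: c_def)
  define C1 where "C1 = 96 * (1 + 1 / \<eta>) * sqrt (2048 / (\<gamma> * (1 - \<gamma>)) * (1 + 1 / \<eta>))"
  have C1: "C1 \<ge> 0" unfolding C1_def using \<gamma> \<eta>0 by simp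
  \<comment> \<open>\<open>u \<ge> K / 8\<close> makes the curvature bound at most
    \<open>8\<^sup>2 = 64\<close> times its value at \<open>K\<close>; twice 64 lets the curvature
    use only half of the tolerance. The same threshold gives \<open>2 * J < Q\<close>.\<close>
  obtain K1 where K1: "K1 \<ge> 1" "\<And>K. K \<ge> K1 \<Longrightarrow> K powr \<eta> \<ge> 128" using powr_eventually_ge[OF \<eta>0(1)] by metis
  \<comment> \<open>The value 4 makes the rounding errors fit into the other half of the tolerance,
    and \<open>8 / c\<close> makes the rounded slopes stay separated, with \<open>n\<close> at least
    a quarter of \<open>K powr (1/2 - \<eta>)\<close>.\<close>
  have pos: "1/2 - \<eta> + \<gamma> > 0" using \<gamma> \<eta>0 by linarith
  obtain K2 where K2: "K2 \<ge> 1" "\<And>K. K \<ge> K2 \<Longrightarrow> K powr (1/2 - \<eta> + \<gamma>) \<ge> max 4 (8 / c)"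
    using powr_eventually_ge[OF pos] by metis
  define K0 where "K0 = max K1 K2"
  \<comment> \<open>8 bounds the zero frequency, there are three Fourier errors of size
    \<open>C1\<close>, and each of the two error indicators has mean value at most 24.\<close>
  define C where "C = 8 + 3 * C1 + 48"
  have C0: "C \<ge> 0" using C1 by (simp add: C_def)
  have main: "(\<Sum>u\<in>U. norm (\<Sum>r<n. a r * of_int (ps_gap \<gamma> (u + r))))
         \<le> C * (K powr (\<gamma> - \<eta>) + K powr (\<gamma> - 1) * (\<Sum>u\<in>U. norm (\<Sum>r<n. a r)))"
    if KK: "K \<ge> K0" and nK: "K powr (1/2 - \<eta>) / 4 \<le> real n" "real n \<le> K powr (1/2 - \<eta>)"
      and fin: "finite U" and U: "\<And>u. u \<in> U \<Longrightarrow> K / 8 \<le> real u \<and> real u \<le> K"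
      and sep: "\<And>u v. u \<in> U \<Longrightarrow> v \<in> U \<Longrightarrow> u < v \<Longrightarrow> u + n \<le> v"
      and a: "\<And>r. norm (a r :: complex) \<le> 1" for K n U a
  proof -
    have K: "K \<ge> 1" and Keta: "K powr \<eta> \<ge> 128" and Kbig: "K powr (1/2 - \<eta> + \<gamma>) \<ge> 4" "K powr (1/2 - \<eta> + \<gamma>) \<ge> 8 / c"
      using K1 K2 KK unfolding K0_def by fastforce+
    have n: "n > 0"
    proof -
      have "0 < K powr (1/2 - \<eta>) / 4" using K by simp
      then show ?thesis using nK(1) by (metis gr0I of_nat_0 order_less_le_trans order_less_irrefl)
    qed
    \<comment> \<open>Fine enough that rounding slopes to multiples of \<open>1 / Q\<close> neither
      destroys their spacing nor accumulates beyond the tolerance \<open>J\<close> over a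
      block.\<close>
    define Q where "Q = nat \<lceil>K\<^sup>2\<rceil>"
    have K21: "K\<^sup>2 \<ge> 1" using K by simp
    have Q: "K\<^sup>2 \<le> real Q" "real Q \<le> 2 * K\<^sup>2" unfolding Q_def using K21 by linarith+
    have Q0: "Q > 0" using Q(1) K21 by (metis gr0I of_nat_0 order_trans not_one_le_zero)
    have Ksq: "K\<^sup>2 = K powr 2" using K by (simp add: powr_numeral)
    define X where "X = real Q * K powr (\<gamma> - 1 - \<eta>)"
    have Xge: "K powr (1 + \<gamma> - \<eta>) \<le> X"
    proof -
      have "K powr 2 * K powr (\<gamma> - 1 - \<eta>) \<le> X" unfolding X_def using Q Ksq by (intro mult_right_mono) auto
      moreover have "K powr 2 * K powr (\<gamma> - 1 - \<eta>) = K powr (1 + \<gamma> - \<eta>)"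
        by (rule powr_mult_eq) simp
      ultimately show ?thesis by simp
    qed
    have X4: "X \<ge> 4 * K powr (1/2)"
    proof -
      have "4 * K powr (1/2) \<le> K powr (1/2 - \<eta> + \<gamma>) * K powr (1/2)" using Kbig by (intro mult_right_mono) auto
      also have "\<dots> = K powr (1 + \<gamma> - \<eta>)" by (rule powr_mult_eq) simp
      finally show ?thesis using Xge by simp
    qed
    have Khalf: "K powr (1/2) \<ge> 1" using K by (simp add: ge_one_powr_ge_zero)
    have X1: "X \<ge> 1" using X4 Khalf by linarith
    \<comment> \<open>\<open>J / Q\<close> is about \<open>K powr (- \<eta>)\<close> times the
      interval length \<open>K powr (\<gamma> - 1)\<close>: small enough for the error indicators to
      save a power, large enough to exceed the curvature error, which is smaller by a further
      \<open>K powr (- \<eta>)\<close>.\<close>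
    define J where "J = nat \<lceil>X\<rceil>"
    have J: "X \<le> real J" "real J \<le> 2 * X" unfolding J_def using X1 by linarith+
    have J0: "J > 0" using J(1) X1 by (metis gr0I of_nat_0 order_trans not_one_le_zero)
    have Kneg: "K powr (\<gamma> - 1 - \<eta>) \<le> 1 / 128"
    proof -
      have "K powr (\<gamma> - 1 - \<eta>) \<le> K powr (- \<eta>)" using K \<gamma> by (intro powr_mono) auto
      also have "\<dots> = 1 / K powr \<eta>" by (simp add: powr_minus_divide)
      also have "\<dots> \<le> 1 / 128" using Keta by (intro divide_left_mono) auto
      finally show ?thesis .
    qed
    have J2: "2 * J < Q"
    proof -
      have "X \<le> real Q * (1 / 128)" unfolding X_def using Kneg by (intro mult_left_mono) auto
      then have "2 * real J < real Q" using J Q0 by linarith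
      then show ?thesis by linarith
    qed
    have nhalf: "real n \<le> K powr (1/2)"
      using nK(2) powr_mono[of "1/2 - \<eta>" "1/2" K] K \<eta>0 by linarith
    have n2: "(real n)\<^sup>2 \<le> K powr (1 - 2 * \<eta>)"
    proof -
      have "(real n)\<^sup>2 \<le> (K powr (1/2 - \<eta>))\<^sup>2" using nK by (intro power_mono) auto
      also have "\<dots> = K powr (1 - 2 * \<eta>)" by (simp add: power2_eq_square flip: powr_add)
      finally show ?thesis .
    qed
    define p where "p = (\<lambda>u. \<lfloor>real Q * (\<gamma> * real u powr (\<gamma> - 1))\<rfloor>)"
    define b where "b = (\<lambda>u. \<lfloor>real Q * real u powr \<gamma>\<rfloor>)"
    have pb: "0 \<le> real_of_int (p u)" "real_of_int (p u) \<le> real Q * (8 * K powr (\<gamma> - 1))" if "u \<in> U" for u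
      unfolding p_def using slope_bounds[OF \<gamma>0 \<gamma>(2) K] U[OF that] by auto
    have lin: "\<bar>real Q * real (u + r) powr \<gamma> - real_of_int (b u + int r * p u)\<bar> \<le> real J" if u: "u \<in> U" and r: "r \<le> n" for u r
    proof -
      have u0: "u > 0" using U[OF u] K by (cases u) auto
      have "real u powr (\<gamma> - 2) \<le> 8 powr (- (\<gamma> - 2)) * K powr (\<gamma> - 2)"
        using U[OF u] K \<gamma> by (intro powr_le_scaled) auto
      also have "\<dots> \<le> 8 powr 2 * K powr (\<gamma> - 2)" using \<gamma> by (intro mult_right_mono powr_mono) auto
      finally have M: "real u powr (\<gamma> - 2) \<le> 64 * K powr (\<gamma> - 2)" by (simp add: powr_numeral)
      have "\<bar>real Q * real (u + r) powr \<gamma> - real_of_int (b u + int r * p u)\<bar>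
        \<le> real Q * ((real n)\<^sup>2 * (64 * K powr (\<gamma> - 2))) + 1 + real n"
        unfolding b_def p_def by (rule block_linear_approx[OF \<gamma>0 \<gamma>(2) u0 r M])
      also have "real Q * ((real n)\<^sup>2 * (64 * K powr (\<gamma> - 2))) \<le> X / 2"
      proof -
        have "(real n)\<^sup>2 * (64 * K powr (\<gamma> - 2)) \<le> K powr (1 - 2 * \<eta>) * (64 * K powr (\<gamma> - 2))"
          using n2 by (intro mult_right_mono) auto
        also have "\<dots> = 64 * (K powr (1 - 2 * \<eta>) * K powr (\<gamma> - 2))" by simp
        also have "K powr (1 - 2 * \<eta>) * K powr (\<gamma> - 2) = K powr (\<gamma> - 1 - \<eta>) * (1 / K powr \<eta>)"
          unfolding powr_minus_divide[symmetric] powr_add[symmetric] by (rule arg_cong[where f = "(powr) K"]) simp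
        also have "64 * (K powr (\<gamma> - 1 - \<eta>) * (1 / K powr \<eta>)) \<le> 64 * (K powr (\<gamma> - 1 - \<eta>) * (1 / 128))"
          using Keta by (intro mult_left_mono divide_left_mono) auto
        finally have "(real n)\<^sup>2 * (64 * K powr (\<gamma> - 2)) \<le> K powr (\<gamma> - 1 - \<eta>) / 2" by simp
        then have "real Q * ((real n)\<^sup>2 * (64 * K powr (\<gamma> - 2))) \<le> real Q * (K powr (\<gamma> - 1 - \<eta>) / 2)" by (intro mult_left_mono) auto
        then show ?thesis by (simp add: X_def)
      qed
      finally show ?thesis using nhalf Khalf X4 J(1) by linarith
    qed
    have cardU: "real n * real (card U) \<le> 2 * K"
    proof -
      have "real n * real (card U) \<le> K + real n"
        by (rule card_separated_nat_le[OF n fin _ sep]) (use U K in auto)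
      also have "real n \<le> K" using nhalf powr_mono[of "1/2" 1 K] K by simp
      finally show ?thesis by simp
    qed
    have big: "real Q * (real n * (\<gamma> * (1 - \<gamma>) * K powr (\<gamma> - 2))) \<ge> 2"
    proof -
      have "2 \<le> c / 4 * K powr (1/2 - \<eta> + \<gamma>)" using Kbig(2) c by (simp add: field_simps)
      also have "K powr (1/2 - \<eta> + \<gamma>) = K powr 2 * (K powr (1/2 - \<eta>) * K powr (\<gamma> - 2))"
        unfolding powr_add[symmetric] by (rule arg_cong[where f = "(powr) K"]) simp
      also have "c / 4 * (K powr 2 * (K powr (1/2 - \<eta>) * K powr (\<gamma> - 2))) = K powr 2 * ((K powr (1/2 - \<eta>) / 4) * (c * K powr (\<gamma> - 2)))" by simp
      also have "\<dots> \<le> real Q * (real n * (c * K powr (\<gamma> - 2)))" using Q(1) Ksq nK(1) c by (intro mult_mono) auto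
      finally show ?thesis unfolding c_def .
    qed
    have Kg: "K powr (\<gamma> - 1 - \<eta>) \<le> K powr (\<gamma> - 1)" using K \<eta>0 by (intro powr_mono) auto
    define P0 where "P0 = nat \<lfloor>real Q * (8 * K powr (\<gamma> - 1))\<rfloor>"
    have P01: "nat (p u) \<le> P0" if "u \<in> U" for u
      unfolding P0_def using pb[OF that] by (intro nat_mono) (simp add: le_floor_iff)
    have P02: "real P0 \<le> 12 * (real Q * K powr (\<gamma> - 1))"
    proof -
      have "0 \<le> real Q * K powr (\<gamma> - 1)" "real Q * (8 * K powr (\<gamma> - 1)) = 8 * (real Q * K powr (\<gamma> - 1))" by simp_all
      then show ?thesis unfolding P0_def by linarith
    qed
    have P6: "real (6 * J) \<le> 12 * (real Q * K powr (\<gamma> - 1))"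
    proof -
      have "X \<le> real Q * K powr (\<gamma> - 1)" unfolding X_def using Kg by (intro mult_left_mono) auto
      then show ?thesis using J(2) by simp
    qed
    define E where "E = C1 * K powr (\<gamma> - \<eta>)"
    \<comment> \<open>This balance fixes \<open>\<eta>\<close>: after three losses of
      \<open>\<eta>\<close> the exponent 3/4 must still be \<open>\<eta>\<close> below
      \<open>\<gamma>\<close>.\<close>
    have E3: "3/4 + 3 * \<eta> = \<gamma> - \<eta>" using \<eta> by simp
    have fourier: "(\<Sum>u\<in>U. norm ((\<Sum>r<n. d r * of_real (smooth_ind Q J (P u) (bb u + int r * p u)))
             - of_real (real (P u) / real Q) * (\<Sum>r<n. d r))) \<le> E"
      if "\<And>r. norm (d r) \<le> 1" "\<And>u. u \<in> U \<Longrightarrow> P u \<le> M" "real M \<le> 12 * (real Q * K powr (\<gamma> - 1))"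
      for d :: "nat \<Rightarrow> complex" and P bb M
      unfolding E_def C1_def E3[symmetric]
      by (rule smooth_ind_slopes[OF \<gamma>0 \<gamma>(2) \<eta>0(1,3) K n Q0 nK fin U cardU sep that(1) _ big Q(2) J0 J(1)[unfolded X_def] that(2,3)])
         (auto simp: p_def)
    have F1: "(\<Sum>u\<in>U. norm ((\<Sum>r<n. a r * of_real (smooth_ind Q J (nat (p u)) (b u + int r * p u)))
             - of_real (real (nat (p u)) / real Q) * (\<Sum>r<n. a r))) \<le> E"
      by (rule fourier[OF a P01 P02])
    \<comment> \<open>Frequency zero contributes the density
      \<open>6 * J / Q \<le> 12 * K powr (\<gamma> - 1 - \<eta>)\<close> times the total length of
      the blocks, which is at most \<open>2 * K\<close>.\<close>
    have F2: "(\<Sum>u\<in>U. \<Sum>r<n. smooth_ind Q J (6 * J) (bb u + int r * p u)) \<le> E + 24 * K powr (\<gamma> - \<eta>)" for bb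
    proof -
      have "(\<Sum>u\<in>U. norm ((\<Sum>r<n. 1 * of_real (smooth_ind Q J (6 * J) (bb u + int r * p u)))
             - of_real (real (6 * J) / real Q) * (\<Sum>r<n. 1 :: complex))) \<le> E"
        by (rule fourier[OF _ _ P6]) auto
      moreover have "(\<Sum>r<n. smooth_ind Q J (6 * J) (bb u + int r * p u)) \<le>
          norm ((\<Sum>r<n. 1 * of_real (smooth_ind Q J (6 * J) (bb u + int r * p u)))
             - of_real (real (6 * J) / real Q) * (\<Sum>r<n. 1 :: complex)) + real (6 * J) / real Q * real n" for u
      proof -
        have "(\<Sum>r<n. 1 * of_real (smooth_ind Q J (6 * J) (bb u + int r * p u)))
             - of_real (real (6 * J) / real Q) * (\<Sum>r<n. 1 :: complex)
           = of_real ((\<Sum>r<n. smooth_ind Q J (6 * J) (bb u + int r * p u)) - real (6 * J) / real Q * real n)" by simp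
        then show ?thesis by (simp only: norm_of_real)
      qed
      then have "(\<Sum>u\<in>U. \<Sum>r<n. smooth_ind Q J (6 * J) (bb u + int r * p u)) \<le> (\<Sum>u\<in>U. 
          norm ((\<Sum>r<n. 1 * of_real (smooth_ind Q J (6 * J) (bb u + int r * p u)))
             - of_real (real (6 * J) / real Q) * (\<Sum>r<n. 1 :: complex)) + real (6 * J) / real Q * real n)"
        by (intro sum_mono)
      moreover have "real (card U) * (real (6 * J) / real Q * real n) \<le> 24 * K powr (\<gamma> - \<eta>)"
      proof -
        have "real (6 * J) / real Q \<le> 12 * K powr (\<gamma> - 1 - \<eta>)" using J(2) Q0 unfolding X_def by (simp add: field_simps)
        then have "real (6 * J) / real Q * (real n * real (card U)) \<le> 12 * K powr (\<gamma> - 1 - \<eta>) * (2 * K)"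
          by (rule mult_mono[OF _ cardU]) auto
        also have "\<dots> = 24 * (K powr (\<gamma> - 1 - \<eta>) * K powr 1)" using K by simp
        also have "K powr (\<gamma> - 1 - \<eta>) * K powr 1 = K powr (\<gamma> - \<eta>)" by (rule powr_mult_eq) simp
        finally show ?thesis by (simp add: mult_ac)
      qed
      ultimately show ?thesis by (simp add: sum.distrib)
    qed
    have each: "norm (\<Sum>r<n. a r * of_int (ps_gap \<gamma> (u + r)))
      \<le> norm ((\<Sum>r<n. a r * of_real (smooth_ind Q J (nat (p u)) (b u + int r * p u)))
             - of_real (real (nat (p u)) / real Q) * (\<Sum>r<n. a r))
        + 8 * K powr (\<gamma> - 1) * norm (\<Sum>r<n. a r)
        + ((\<Sum>r<n. smooth_ind Q J (6 * J) ((b u - 3 * int J) + int r * p u))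
          + (\<Sum>r<n. smooth_ind Q J (6 * J) ((b u + p u - 3 * int J) + int r * p u)))" if u: "u \<in> U" for u
    proof -
      define S where "S = (\<Sum>r<n. a r * of_real (smooth_ind Q J (nat (p u)) (b u + int r * p u)))"
      define T where "T = of_real (real (nat (p u)) / real Q) * (\<Sum>r<n. a r)"
      define D where "D = (\<Sum>r<n. a r * of_real (real_of_int (ps_gap \<gamma> (u + r)) - smooth_ind Q J (nat (p u)) (b u + int r * p u)))"
      have "(\<Sum>r<n. a r * of_int (ps_gap \<gamma> (u + r))) = (S - T) + T + D"
        unfolding S_def D_def by (simp add: algebra_simps sum.distrib[symmetric] sum_subtractf)
      then have "norm (\<Sum>r<n. a r * of_int (ps_gap \<gamma> (u + r))) \<le> norm (S - T) + norm T + norm D"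
        by (metis norm_triangle_le norm_triangle_ineq add_right_mono)
      moreover have "norm T \<le> 8 * K powr (\<gamma> - 1) * norm (\<Sum>r<n. a r)"
      proof -
        have "real (nat (p u)) / real Q \<le> 8 * K powr (\<gamma> - 1)" using pb[OF u] Q0 by (simp add: field_simps)
        then show ?thesis unfolding T_def norm_mult norm_of_real by (intro mult_right_mono) auto
      qed
      moreover have "norm D \<le> (\<Sum>r<n. smooth_ind Q J (6 * J) ((b u - 3 * int J) + int r * p u)
          + smooth_ind Q J (6 * J) ((b u + p u - 3 * int J) + int r * p u))"
        unfolding D_def
      proof (rule sum_norm_le)
        fix r assume "r \<in> {..<n}"
        then have r: "r < n" by simp
        have p0: "p u \<ge> 0" using pb[OF u] by simp
        have "norm (a r) * \<bar>real_of_int (ps_gap \<gamma> (u + r)) - smooth_ind Q J (nat (p u)) (b u + int r * p u)\<bar>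
          \<le> 1 * (smooth_ind Q J (6 * J) ((b u - 3 * int J) + int r * p u)
          + smooth_ind Q J (6 * J) ((b u + p u - 3 * int J) + int r * p u))"
          by (intro mult_mono a ps_gap_smooth_approx[OF Q0 J0 J2 p0 lin[OF u] r]) auto
        then show "norm (a r * of_real (real_of_int (ps_gap \<gamma> (u + r)) - smooth_ind Q J (nat (p u)) (b u + int r * p u)))
          \<le> smooth_ind Q J (6 * J) ((b u - 3 * int J) + int r * p u)
          + smooth_ind Q J (6 * J) ((b u + p u - 3 * int J) + int r * p u)"
          unfolding norm_mult norm_of_real by simp
      qed
      ultimately show ?thesis unfolding S_def[symmetric] T_def[symmetric] sum.distrib by linarith
    qed
    have "(\<Sum>u\<in>U. norm (\<Sum>r<n. a r * of_int (ps_gap \<gamma> (u + r))))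
      \<le> (\<Sum>u\<in>U. norm ((\<Sum>r<n. a r * of_real (smooth_ind Q J (nat (p u)) (b u + int r * p u)))
             - of_real (real (nat (p u)) / real Q) * (\<Sum>r<n. a r))
        + 8 * K powr (\<gamma> - 1) * norm (\<Sum>r<n. a r)
        + ((\<Sum>r<n. smooth_ind Q J (6 * J) ((b u - 3 * int J) + int r * p u))
          + (\<Sum>r<n. smooth_ind Q J (6 * J) ((b u + p u - 3 * int J) + int r * p u))))"
      by (intro sum_mono each)
    also have "\<dots> \<le> E + 8 * K powr (\<gamma> - 1) * (\<Sum>u\<in>U. norm (\<Sum>r<n. a r)) + ((E + 24 * K powr (\<gamma> - \<eta>)) + (E + 24 * K powr (\<gamma> - \<eta>)))"
      unfolding sum.distrib unfolding sum_distrib_left[symmetric] by (intro add_mono F1 F2 order_refl)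
    also have "\<dots> = (3 * C1 + 48) * K powr (\<gamma> - \<eta>) + 8 * (K powr (\<gamma> - 1) * (\<Sum>u\<in>U. norm (\<Sum>r<n. a r)))"
      unfolding E_def by (simp add: algebra_simps)
    also have "\<dots> \<le> C * K powr (\<gamma> - \<eta>) + C * (K powr (\<gamma> - 1) * (\<Sum>u\<in>U. norm (\<Sum>r<n. a r)))"
      using C1 unfolding C_def by (intro add_mono mult_right_mono mult_nonneg_nonneg sum_nonneg) auto
    finally show ?thesis by (simp add: algebra_simps)
  qed
  show ?thesis by (rule that[of C K0]) (use C0 main K1 in \<open>auto simp: K0_def\<close>)
qed

section \<open>The Piatetski-Shapiro sum\<close>

lemma powr_Suc_le:
  fixes \<gamma> :: real assumes "0 < \<gamma>" "\<gamma> < 1"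
  shows "real k powr \<gamma> \<le> real (Suc k) powr \<gamma>" "real (Suc k) powr \<gamma> \<le> real k powr \<gamma> + 1"
proof -
  show "real k powr \<gamma> \<le> real (Suc k) powr \<gamma>" using assms by (intro powr_mono2) auto
  have le: "x \<le> x powr \<gamma>" if "0 \<le> x" "x \<le> 1" for x :: real
    using powr_mono'[of \<gamma> 1 x] that assms by (cases "x = 0") auto
  define n where "n = real (Suc k)"
  have n: "n > 0" "real k \<le> n" "1 \<le> n" by (auto simp: n_def)
  \<comment> \<open>Subadditivity of the power: dividing by \<open>n = k + 1\<close> reduces it to
    \<open>x \<le> x powr \<gamma>\<close> on the unit interval.\<close>
  have "1 = real k / n + 1 / n" by (simp add: n_def field_simps)
  also have "\<dots> \<le> (real k / n) powr \<gamma> + (1 / n) powr \<gamma>"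
    using n by (intro add_mono le) auto
  also have "\<dots> = (real k powr \<gamma> + 1) / n powr \<gamma>" using n by (simp add: powr_divide add_divide_distrib)
  finally show "real (Suc k) powr \<gamma> \<le> real k powr \<gamma> + 1" unfolding n_def[symmetric] using n by (simp add: field_simps)
qed

lemma ps_gap_bounds:
  assumes "0 < \<gamma>" "\<gamma> < 1"
  shows "0 \<le> ps_gap \<gamma> k" "ps_gap \<gamma> k \<le> 1"
  using powr_Suc_le[OF assms, of k] unfolding ps_gap_def by linarith+

text \<open>A block inside the window loses its common factor \<open>\<omega> ^ sZ u\<close> of
  modulus 1. The blocks do not overlap, so each end of the window cuts at most one of them, and a
  cut block costs at most its length because the gaps are 0 or 1.\<close>

lemma zeck_block_window:
  fixes \<omega> :: complex and \<gamma> :: real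
  assumes \<omega>: "norm \<omega> = 1" and \<gamma>: "0 < \<gamma>" "\<gamma> < 1" and U: "zeck_block_starts q N U"
  shows "norm (\<Sum>u\<in>U. \<Sum>r<q. if A \<le> u + r \<and> u + r < B then \<omega> ^ sZ (u + r) * of_int (ps_gap \<gamma> (u + r)) else 0)
    \<le> (\<Sum>u\<in>{u \<in> U. A \<le> u \<and> u + q \<le> B}. norm (\<Sum>r<q. \<omega> ^ sZ r * of_int (ps_gap \<gamma> (u + r)))) + 2 * real q"
proof -
  define h where "h = (\<lambda>k. if A \<le> k \<and> k < B then \<omega> ^ sZ k * of_int (ps_gap \<gamma> k) else 0)"
  define U' where "U' = {u \<in> U. A \<le> u \<and> u + q \<le> B}"
  define W where "W = (\<lambda>E. {u \<in> U. u < E \<and> E < u + q})"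
  have fin: "finite U" and sep: "\<And>u v. u \<in> U \<Longrightarrow> v \<in> U \<Longrightarrow> u < v \<Longrightarrow> u + q \<le> v"
    and mult: "\<And>u r. u \<in> U \<Longrightarrow> r < q \<Longrightarrow> sZ (u + r) = sZ u + sZ r"
    using U unfolding zeck_block_starts_def by blast+
  have h1: "norm (h k) \<le> 1" for k
  proof -
    have "\<bar>real_of_int (ps_gap \<gamma> k)\<bar> \<le> 1" using ps_gap_bounds[OF \<gamma>, of k] by linarith
    then show ?thesis unfolding h_def using \<omega> by (simp add: norm_mult norm_power)
  qed
  have cardW: "real (card (W E)) \<le> 1" for E
  proof -
    have "card (W E) \<le> 1"
    proof (rule ccontr)
      assume "\<not> card (W E) \<le> 1"
      moreover have "finite (W E)" using fin unfolding W_def by simp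
      ultimately obtain u v where uv: "u \<in> W E" "v \<in> W E" "u \<noteq> v"
        using card_le_Suc0_iff_eq[of "W E"] by auto
      have "u < v \<or> v < u" using uv by auto
      then show False
      proof
        assume "u < v"
        then have "u + q \<le> v" using sep uv unfolding W_def by auto
        then show False using uv unfolding W_def by auto
      next
        assume "v < u"
        then have "v + q \<le> u" using sep uv unfolding W_def by auto
        then show False using uv unfolding W_def by auto
      qed
    qed
    then show ?thesis by simp
  qed
  define g where "g = (\<lambda>u. norm (\<Sum>r<q. \<omega> ^ sZ r * of_int (ps_gap \<gamma> (u + r))))"
  have each: "norm (\<Sum>r<q. h (u + r)) \<le> (if u \<in> U' then g u else 0) + (if u \<in> W A then real q else 0) + (if u \<in> W B then real q else 0)"
    if u: "u \<in> U" for u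
  proof -
    have triv: "norm (\<Sum>r<q. h (u + r)) \<le> real q"
      using sum_norm_le[of "{..<q}" "\<lambda>r. h (u + r)" "\<lambda>_. 1"] h1 by simp
    have g0: "g u \<ge> 0" by (simp add: g_def)
    consider "u \<in> U'" | "u \<in> W A" | "u \<in> W B" | "u + q \<le> A" | "B \<le> u"
      using u unfolding U'_def W_def mem_Collect_eq by linarith
    then show ?thesis
    proof cases
      case 1
      have "(\<Sum>r<q. h (u + r)) = \<omega> ^ sZ u * (\<Sum>r<q. \<omega> ^ sZ r * of_int (ps_gap \<gamma> (u + r)))"
        unfolding sum_distrib_left
      proof (rule sum.cong[OF refl])
        fix r assume "r \<in> {..<q}"
        then have r: "r < q" by simp
        then have "A \<le> u + r \<and> u + r < B" using 1 unfolding U'_def by auto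
        then show "h (u + r) = \<omega> ^ sZ u * (\<omega> ^ sZ r * of_int (ps_gap \<gamma> (u + r)))"
          unfolding h_def using mult[OF u r] by (simp add: power_add)
      qed
      then have "norm (\<Sum>r<q. h (u + r)) = g u" unfolding g_def using \<omega> by (simp add: norm_mult norm_power)
      then show ?thesis using 1 by simp
    next
      case 2 then show ?thesis using triv g0 by simp
    next
      case 3 then show ?thesis using triv g0 by simp
    next
      case 4
      then have "(\<Sum>r<q. h (u + r)) = 0" unfolding h_def by (intro sum.neutral) auto
      then show ?thesis using g0 by simp
    next
      case 5
      then have "(\<Sum>r<q. h (u + r)) = 0" unfolding h_def by (intro sum.neutral) auto
      then show ?thesis using g0 by simp
    qed
  qed
  have ind: "(\<Sum>u\<in>U. if u \<in> Y then f u else 0) = (\<Sum>u\<in>Y. f u)" if "Y \<subseteq> U" for Y and f :: "nat \<Rightarrow> real"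
    using that fin by (simp add: sum.inter_restrict[symmetric] Int_absorb1)
  have "norm (\<Sum>u\<in>U. \<Sum>r<q. h (u + r)) \<le> (\<Sum>u\<in>U. (if u \<in> U' then g u else 0) + (if u \<in> W A then real q else 0) + (if u \<in> W B then real q else 0))"
    by (intro sum_norm_le each)
  also have "\<dots> = (\<Sum>u\<in>U'. g u) + real (card (W A)) * real q + real (card (W B)) * real q"
    unfolding sum.distrib using ind[of U' g] ind[of "W A" "\<lambda>_. real q"] ind[of "W B" "\<lambda>_. real q"]
    by (auto simp: U'_def W_def)
  also have "\<dots> \<le> (\<Sum>u\<in>U'. g u) + 1 * real q + 1 * real q"
    by (intro add_mono mult_right_mono cardW) auto
  finally show ?thesis unfolding h_def U'_def g_def by simp
qed

text \<open>Restricting to a dyadic range keeps every relevant start between \<open>K / 8\<close>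
  and \<open>K\<close>, so that one scale \<open>K = B\<close> serves all slopes. Both families of
  blocks are estimated in the same way.\<close>

lemma zeckendorf_dyadic_sum:
  fixes \<omega> :: complex and \<gamma> :: real
  assumes \<omega>: "norm \<omega> = 1" "\<omega> \<noteq> 1" and \<gamma>: "3/4 < \<gamma>" "\<gamma> < 1"
  obtains \<epsilon> C :: real and B0 :: nat where "0 < \<epsilon>" "\<epsilon> < \<gamma> - 1/2" "C \<ge> 0"
    "\<And>B. B \<ge> B0 \<Longrightarrow> norm (\<Sum>k=B div 2..<B. \<omega> ^ sZ k * of_int (ps_gap \<gamma> k)) \<le> C * real B powr (\<gamma> - \<epsilon>)"
proof -
  have \<gamma>0: "0 < \<gamma>" using \<gamma> by simp
  define \<eta> where "\<eta> = (\<gamma> - 3/4) / 4"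
  have \<eta>: "0 < \<eta>" "\<eta> < 1/16" using \<gamma> by (auto simp: \<eta>_def)
  obtain \<delta> where \<delta>: "0 < \<delta>" "\<delta> \<le> 1"
    and save: "\<And>j. j \<ge> 1 \<Longrightarrow> norm (\<Sum>r<fibZ j. \<omega> ^ sZ r) \<le> 6 * real (fibZ j) powr (1 - \<delta>)"
    using sum_fibZ_power_saving[OF \<omega>] by blast
  obtain C K0 :: real where C: "C \<ge> 0" and K0: "K0 \<ge> 1" and key: "\<And>K n U a. K \<ge> K0 \<Longrightarrow> K powr (1/2 - \<eta>) / 4 \<le> real n \<Longrightarrow> real n \<le> K powr (1/2 - \<eta>) \<Longrightarrow>
       finite U \<Longrightarrow> (\<And>u. u \<in> U \<Longrightarrow> K / 8 \<le> real u \<and> real u \<le> K) \<Longrightarrow>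
       (\<And>u v. u \<in> U \<Longrightarrow> v \<in> U \<Longrightarrow> u < v \<Longrightarrow> u + n \<le> v) \<Longrightarrow>
       (\<And>r. norm (a r :: complex) \<le> 1) \<Longrightarrow>
       (\<Sum>u\<in>U. norm (\<Sum>r<n. a r * of_int (ps_gap \<gamma> (u + r))))
         \<le> C * (K powr (\<gamma> - \<eta>) + K powr (\<gamma> - 1) * (\<Sum>u\<in>U. norm (\<Sum>r<n. a r)))"
    using ps_gap_block_sums[OF \<gamma> \<eta>_def] by blast
  \<comment> \<open>The saving \<open>q powr (- \<delta>)\<close> is measured at a length
    \<open>q\<close> near \<open>K powr (1/2 - \<eta>)\<close>, and \<open>1/2 - \<eta>\<close> is
    at least 1/4.\<close>
  define \<epsilon> where "\<epsilon> = min \<eta> (\<delta> / 4)"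
  have \<epsilon>: "0 < \<epsilon>" "\<epsilon> \<le> \<eta>" "\<epsilon> \<le> \<delta> / 4" using \<eta> \<delta> by (auto simp: \<epsilon>_def)
  define C' where "C' = 2 * (C * 49 + 2)"
  have main: "norm (\<Sum>k=B div 2..<B. \<omega> ^ sZ k * of_int (ps_gap \<gamma> k)) \<le> C' * real B powr (\<gamma> - \<epsilon>)"
    if B: "B \<ge> nat \<lceil>K0\<rceil> + 2" for B
  proof -
    define K where "K = real B"
    have "real (nat \<lceil>K0\<rceil>) \<ge> K0" using K0 by linarith
    moreover have "K \<ge> real (nat \<lceil>K0\<rceil>) + 2" using B unfolding K_def by linarith
    ultimately have K: "K \<ge> K0" "K \<ge> 2" "K \<ge> 1" using K0 by linarith+
    define M where "M = nat \<lfloor>K powr (1/2 - \<eta>)\<rfloor>"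
    have "K powr (1/2 - \<eta>) \<ge> 1" using K \<eta> by (intro ge_one_powr_ge_zero) auto
    then have M: "M \<ge> 1" "real M \<le> K powr (1/2 - \<eta>)" "K powr (1/2 - \<eta>) < real M + 1" unfolding M_def by linarith+
    obtain j where j: "j \<ge> 2" "fibZ j \<le> M" "M < fibZ (Suc j)" using fibZ_cover[OF M(1)] by blast
    \<comment> \<open>Consecutive Fibonacci numbers differ by a factor of at most 2. Two such steps
      bring \<open>fibZ (Suc j)\<close>, which exceeds \<open>M\<close>, down to
      \<open>fibZ (j - 1)\<close>; hence the factor 1/4 in the lower bound for the block
      lengths.\<close>
    have f1: "fibZ (Suc j) \<le> 2 * fibZ j" using fibZ_Suc[of j] fibZ_mono[of "j - 1" j] j by simp
    have f2: "fibZ j \<le> 2 * fibZ (j - 1)" using fibZ_Suc[of "j - 1"] fibZ_mono[of "j - 1 - 1" "j - 1"] j by simp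
    have f3: "fibZ (j - 1) \<le> fibZ j" by (rule fibZ_mono) simp
    have q_lo: "K powr (1/2 - \<eta>) / 4 \<le> real (fibZ j)" "K powr (1/2 - \<eta>) / 4 \<le> real (fibZ (j - 1))"
      using f1 f2 f3 j M by linarith+
    have q_hi: "real (fibZ j) \<le> K powr (1/2 - \<eta>)" "real (fibZ (j - 1)) \<le> K powr (1/2 - \<eta>)"
      using f3 j M by linarith+
    \<comment> \<open>Any Fibonacci number beyond \<open>B\<close> will do: the window in
      \<open>zeck_block_window\<close> removes the surplus.\<close>
    define I where "I = Suc (B + j)"
    have I: "I \<ge> j - 1" "B \<le> fibZ I" using le_fibZ_Suc[of "B + j"] unfolding I_def by auto
    obtain U V where U: "zeck_block_starts (fibZ j) (fibZ I) U"
      and V: "zeck_block_starts (fibZ (j - 1)) (fibZ I) V"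
      and UV: "\<And>h::nat\<Rightarrow>complex. (\<Sum>k<fibZ I. h k) =
         (\<Sum>u\<in>U. \<Sum>r<fibZ j. h (u + r)) + (\<Sum>u\<in>V. \<Sum>r<fibZ (j - 1). h (u + r))"
      using zeck_blocks[OF j(1) I(1)] by blast
    have part: "norm (\<Sum>u\<in>W. \<Sum>r<fibZ i. if B div 2 \<le> u + r \<and> u + r < B then \<omega> ^ sZ (u + r) * of_int (ps_gap \<gamma> (u + r)) else 0)
        \<le> (C * 49 + 2) * K powr (\<gamma> - \<epsilon>)"
      if W: "zeck_block_starts (fibZ i) (fibZ I) W" and lo: "K powr (1/2 - \<eta>) / 4 \<le> real (fibZ i)"
        and hi: "real (fibZ i) \<le> K powr (1/2 - \<eta>)" and i: "i \<ge> 1" for i W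
    proof -
      define q where "q = fibZ i"
      have q: "q \<ge> 1" using fibZ_pos[OF i] unfolding q_def .
      define W' where "W' = {u \<in> W. B div 2 \<le> u \<and> u + q \<le> B}"
      have fin: "finite W'" and sep: "\<And>u v. u \<in> W' \<Longrightarrow> v \<in> W' \<Longrightarrow> u < v \<Longrightarrow> u + q \<le> v"
        using W unfolding zeck_block_starts_def W'_def q_def by auto
      have rng: "K / 8 \<le> real u \<and> real u \<le> K" if "u \<in> W'" for u
      proof -
        have "B \<le> 2 * u + 1" "u \<le> B" "2 \<le> B" using that K(2) unfolding W'_def K_def by auto
        then show ?thesis unfolding K_def by linarith
      qed
      have Khalf: "K powr (1/2 - \<eta>) \<le> K powr (\<gamma> - \<epsilon>)" using K \<epsilon> \<eta> \<gamma> by (intro powr_mono) auto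
      have qK: "real q \<le> K"
        using hi powr_mono[of "1/2 - \<eta>" 1 K] K \<eta> unfolding q_def by simp
      have cardW: "real q * real (card W') \<le> 2 * K"
      proof -
        have "real q * real (card W') \<le> K + real q"
          by (rule card_separated_nat_le[OF _ fin _ sep]) (use q rng K in auto)
        then show ?thesis using qK by linarith
      qed
      have saving: "K powr (\<gamma> - 1) * (\<Sum>u\<in>W'. norm (\<Sum>r<q. \<omega> ^ sZ r)) \<le> 48 * K powr (\<gamma> - \<epsilon>)"
      proof -
        have qd: "real q powr (1 - \<delta>) \<le> real q * (4 * K powr (- \<epsilon>))"
        proof -
          have "real q powr (1 - \<delta>) = real q powr 1 * real q powr (- \<delta>)" by (rule powr_mult_eq[symmetric]) simp
          also have "real q powr (- \<delta>) \<le> (K powr (1/2 - \<eta>) / 4) powr (- \<delta>)"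
            using lo \<delta> K unfolding q_def by (intro powr_mono2') auto
          also have "\<dots> = 4 powr \<delta> * K powr (- ((1/2 - \<eta>) * \<delta>))"
            using K by (simp add: powr_divide powr_powr powr_minus field_simps)
          also have "\<dots> \<le> 4 powr 1 * K powr (- \<epsilon>)"
          proof (intro mult_mono powr_mono)
            have "1/4 * \<delta> \<le> (1/2 - \<eta>) * \<delta>" using \<eta> \<delta> by (intro mult_right_mono) auto
            then show "- ((1/2 - \<eta>) * \<delta>) \<le> - \<epsilon>" using \<epsilon> by linarith
          qed (use \<delta> K in auto)
          finally show ?thesis by (simp add: mult_left_mono)
        qed
        have "(\<Sum>u\<in>W'. norm (\<Sum>r<q. \<omega> ^ sZ r)) \<le> real (card W') * (6 * (real q * (4 * K powr (- \<epsilon>))))"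
        proof -
          have "norm (\<Sum>r<q. \<omega> ^ sZ r) \<le> 6 * (real q * (4 * K powr (- \<epsilon>)))"
            using save[OF i] qd unfolding q_def by linarith
          then show ?thesis by (simp add: mult_left_mono)
        qed
        also have "\<dots> = 24 * K powr (- \<epsilon>) * (real q * real (card W'))" by simp
        also have "\<dots> \<le> 24 * K powr (- \<epsilon>) * (2 * K)" by (intro mult_left_mono cardW) auto
        finally have "K powr (\<gamma> - 1) * (\<Sum>u\<in>W'. norm (\<Sum>r<q. \<omega> ^ sZ r)) \<le> K powr (\<gamma> - 1) * (24 * K powr (- \<epsilon>) * (2 * K))"
          by (intro mult_left_mono) auto
        also have "\<dots> = 48 * (K powr (\<gamma> - 1) * K powr 1 * K powr (- \<epsilon>))" using K by simp
        also have "K powr (\<gamma> - 1) * K powr 1 * K powr (- \<epsilon>) = K powr (\<gamma> - \<epsilon>)"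
          unfolding powr_add[symmetric] by (rule arg_cong[where f = "(powr) K"]) simp
        finally show ?thesis .
      qed
      have "(\<Sum>u\<in>W'. norm (\<Sum>r<q. \<omega> ^ sZ r * of_int (ps_gap \<gamma> (u + r))))
         \<le> C * (K powr (\<gamma> - \<eta>) + K powr (\<gamma> - 1) * (\<Sum>u\<in>W'. norm (\<Sum>r<q. \<omega> ^ sZ r)))"
        by (rule key[OF K(1)]) (use lo hi fin rng sep \<omega> in \<open>auto simp: q_def norm_power\<close>)
      also have "\<dots> \<le> C * (K powr (\<gamma> - \<epsilon>) + 48 * K powr (\<gamma> - \<epsilon>))"
        using saving C K \<epsilon> by (intro mult_left_mono add_mono powr_mono) auto
      finally have "(\<Sum>u\<in>W'. norm (\<Sum>r<q. \<omega> ^ sZ r * of_int (ps_gap \<gamma> (u + r)))) \<le> C * 49 * K powr (\<gamma> - \<epsilon>)" by simp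
      moreover have "norm (\<Sum>u\<in>W. \<Sum>r<q. if B div 2 \<le> u + r \<and> u + r < B then \<omega> ^ sZ (u + r) * of_int (ps_gap \<gamma> (u + r)) else 0)
        \<le> (\<Sum>u\<in>W'. norm (\<Sum>r<q. \<omega> ^ sZ r * of_int (ps_gap \<gamma> (u + r)))) + 2 * real q"
        unfolding W'_def q_def by (rule zeck_block_window[OF \<omega>(1) \<gamma>0 \<gamma>(2) W])
      moreover have "real q \<le> K powr (\<gamma> - \<epsilon>)" using hi Khalf unfolding q_def by linarith
      ultimately show ?thesis unfolding q_def distrib_right by linarith
    qed
    have "(\<Sum>k=B div 2..<B. \<omega> ^ sZ k * of_int (ps_gap \<gamma> k))
       = (\<Sum>k<fibZ I. if B div 2 \<le> k \<and> k < B then \<omega> ^ sZ k * of_int (ps_gap \<gamma> k) else 0)"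
    proof -
      have "{k \<in> {..<fibZ I}. B div 2 \<le> k \<and> k < B} = {B div 2..<B}" using I by auto
      then show ?thesis by (simp add: sum.inter_filter[symmetric])
    qed
    also have "\<dots> = (\<Sum>u\<in>U. \<Sum>r<fibZ j. if B div 2 \<le> u + r \<and> u + r < B then \<omega> ^ sZ (u + r) * of_int (ps_gap \<gamma> (u + r)) else 0)
      + (\<Sum>u\<in>V. \<Sum>r<fibZ (j - 1). if B div 2 \<le> u + r \<and> u + r < B then \<omega> ^ sZ (u + r) * of_int (ps_gap \<gamma> (u + r)) else 0)"
      by (rule UV)
    finally have "norm (\<Sum>k=B div 2..<B. \<omega> ^ sZ k * of_int (ps_gap \<gamma> k)) \<le> (C * 49 + 2) * K powr (\<gamma> - \<epsilon>) + (C * 49 + 2) * K powr (\<gamma> - \<epsilon>)"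
      using norm_triangle_le[OF add_mono[OF part[OF U q_lo(1) q_hi(1)] part[OF V q_lo(2) q_hi(2)]]] j by auto
    then show ?thesis unfolding C'_def K_def mult.assoc by linarith
  qed
  show ?thesis by (rule that[of \<epsilon> C' "nat \<lceil>K0\<rceil> + 2"]) (use main \<epsilon> C \<eta> \<gamma> in \<open>auto simp: C'_def\<close>)
qed

lemma zeckendorf_gap_sum:
  fixes \<omega> :: complex and \<gamma> :: real
  assumes \<omega>: "norm \<omega> = 1" "\<omega> \<noteq> 1" and \<gamma>: "3/4 < \<gamma>" "\<gamma> < 1"
  obtains \<epsilon> D :: real where "0 < \<epsilon>" "\<epsilon> < \<gamma>" "D \<ge> 0"
    "\<And>B. B \<ge> 1 \<Longrightarrow> norm (\<Sum>k<B. \<omega> ^ sZ k * of_int (ps_gap \<gamma> k)) \<le> D * real B powr (\<gamma> - \<epsilon>)"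
proof -
  obtain \<epsilon> C B0 where \<epsilon>: "0 < \<epsilon>" "\<epsilon> < \<gamma> - 1/2" and C: "C \<ge> 0"
    and dy: "\<And>B. B \<ge> B0 \<Longrightarrow> norm (\<Sum>k=B div 2..<B. \<omega> ^ sZ k * of_int (ps_gap \<gamma> k)) \<le> C * real B powr (\<gamma> - \<epsilon>)"
    using zeckendorf_dyadic_sum[OF \<omega> \<gamma>] by blast
  define e where "e = \<gamma> - \<epsilon>"
  have e: "e > 1/2" using \<epsilon> by (simp add: e_def)
  \<comment> \<open>As \<open>e > 1/2\<close>, halving the range multiplies the bound by at most
    3/4, and \<open>4 * C\<close> lets the remaining quarter absorb the dyadic piece. The summand
    \<open>real B0 + 2\<close> covers small \<open>B\<close> trivially.\<close>
  define D where "D = 4 * C + real B0 + 2"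
  have half: "(1/2::real) powr e \<le> 3/4"
  proof -
    have "(1/2::real) powr e \<le> (1/2) powr (1/2)" using e by (intro powr_mono') auto
    also have "\<dots> = sqrt (1/2)" by (simp add: powr_half_sqrt)
    also have "\<dots> \<le> 3/4" by (rule real_le_lsqrt) (auto simp: power2_eq_square)
    finally show ?thesis .
  qed
  have "norm (\<Sum>k<B. \<omega> ^ sZ k * of_int (ps_gap \<gamma> k)) \<le> D * real B powr e" if "B \<ge> 1" for B
    using that
  proof (induction B rule: less_induct)
    case (less B)
    show ?case
    proof (cases "B < B0 + 2")
      case True
      have "norm (\<Sum>k<B. \<omega> ^ sZ k * of_int (ps_gap \<gamma> k)) \<le> (\<Sum>k<B. 1)"
      proof (rule sum_norm_le)
        fix k
        have "\<bar>real_of_int (ps_gap \<gamma> k)\<bar> \<le> 1" using ps_gap_bounds[of \<gamma> k] \<gamma> by linarith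
        then show "norm (\<omega> ^ sZ k * of_int (ps_gap \<gamma> k)) \<le> 1" using \<omega> by (simp add: norm_mult norm_power)
      qed
      also have "\<dots> \<le> D * 1" using True C unfolding D_def by simp
      also have "\<dots> \<le> D * real B powr e" using less.prems e C unfolding D_def by (intro mult_left_mono ge_one_powr_ge_zero) auto
      finally show ?thesis .
    next
      case False
      then have B: "B \<ge> B0" "B div 2 < B" "B div 2 \<ge> 1" by auto
      have "(\<Sum>k<B. \<omega> ^ sZ k * of_int (ps_gap \<gamma> k)) = (\<Sum>k<B div 2. \<omega> ^ sZ k * of_int (ps_gap \<gamma> k)) + (\<Sum>k=B div 2..<B. \<omega> ^ sZ k * of_int (ps_gap \<gamma> k))"
        using B by (simp add: lessThan_atLeast0 sum.atLeastLessThan_concat)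
      then have "norm (\<Sum>k<B. \<omega> ^ sZ k * of_int (ps_gap \<gamma> k)) \<le> D * real (B div 2) powr e + C * real B powr e"
        using norm_triangle_le[OF add_mono[OF less.IH[OF B(2,3)] dy[OF B(1)]]] unfolding e_def by simp
      also have "real (B div 2) powr e \<le> (real B * (1/2)) powr e" using e by (intro powr_mono2) auto
      also have "(real B * (1/2)) powr e = real B powr e * (1/2) powr e" by (simp only: powr_mult)
      also have "\<dots> \<le> real B powr e * (3/4)" using half by (intro mult_left_mono) auto
      finally have "norm (\<Sum>k<B. \<omega> ^ sZ k * of_int (ps_gap \<gamma> k)) \<le> D * (real B powr e * (3/4)) + C * real B powr e"
        using C unfolding D_def by (simp add: mult_left_mono)
      also have "\<dots> = (D * (3/4) + C) * real B powr e" by (simp add: algebra_simps)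
      also have "\<dots> \<le> D * real B powr e" unfolding D_def by (intro mult_right_mono) auto
      finally show ?thesis .
    qed
  qed
  then show ?thesis using that[of \<epsilon> D] \<epsilon> \<gamma> C unfolding e_def D_def by auto
qed

lemma ps_fiber:
  fixes c :: real
  assumes c: "1 < c" and n: "n \<in> {nat \<lceil>real B powr (1 / c)\<rceil>..<nat \<lceil>real (Suc B) powr (1 / c)\<rceil>}"
  shows "nat \<lfloor>real n powr c\<rfloor> = B"
proof -
  have lo: "real B powr (1 / c) \<le> real n" using n by (auto simp: nat_le_iff ceiling_le_iff)
  have hi: "real n < real (Suc B) powr (1 / c)" using n by (auto simp: zless_nat_eq_int_zless less_ceiling_iff)
  have inv: "(x powr (1 / c)) powr c = x" if "x \<ge> 0" for x using c that by (simp add: powr_powr)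
  have "(real B powr (1 / c)) powr c \<le> real n powr c" using lo c by (intro powr_mono2) auto
  moreover have "real n powr c < (real (Suc B) powr (1 / c)) powr c" using hi c by (intro powr_less_mono2) auto
  ultimately have "real B \<le> real n powr c" "real n powr c < real B + 1" by (auto simp: inv)
  then have "\<lfloor>real n powr c\<rfloor> = int B" by (simp add: floor_eq_iff)
  then show ?thesis by simp
qed

text \<open>\<open>\<lfloor>n powr c\<rfloor> = k\<close> means that \<open>n\<close> lies in the
  half-open interval from \<open>k powr (1 / c)\<close> to \<open>(k + 1) powr (1 / c)\<close>;
  rounding its endpoints up describes its integers, which is why ceilings occur in
  \<open>ps_gap\<close>. The fibre of 0 includes \<open>n = 0\<close>.\<close>

lemma sum_ps_gap:
  fixes \<phi> :: "nat \<Rightarrow> complex" and c :: real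
  assumes c: "1 < c"
  shows "(\<Sum>k<B. \<phi> k * of_int (ps_gap (1 / c) k)) = (\<Sum>n<nat \<lceil>real B powr (1 / c)\<rceil>. \<phi> (nat \<lfloor>real n powr c\<rfloor>))"
proof (induction B)
  case (Suc B)
  define M where "M = (\<lambda>B. nat \<lceil>real B powr (1 / c)\<rceil>)"
  have g: "0 < 1 / c" "1 / c < 1" using c by auto
  have "\<lceil>real B powr (1 / c)\<rceil> \<le> \<lceil>real (Suc B) powr (1 / c)\<rceil>" using powr_Suc_le(1)[OF g, of B] by (rule ceiling_mono)
  then have le: "M B \<le> M (Suc B)" unfolding M_def by (rule nat_mono)
  have nonneg: "0 \<le> \<lceil>real B powr (1 / c)\<rceil>" for B
    using powr_ge_zero[of "real B" "1 / c"] by linarith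
  have gap: "ps_gap (1 / c) B = int (M (Suc B) - M B)"
    using le nonneg[of B] nonneg[of "Suc B"] unfolding ps_gap_def M_def by linarith
  have "(\<Sum>n<M (Suc B). \<phi> (nat \<lfloor>real n powr c\<rfloor>)) = (\<Sum>n<M B. \<phi> (nat \<lfloor>real n powr c\<rfloor>)) + (\<Sum>n=M B..<M (Suc B). \<phi> (nat \<lfloor>real n powr c\<rfloor>))"
    using le by (simp add: lessThan_atLeast0 sum.atLeastLessThan_concat)
  also have "(\<Sum>n=M B..<M (Suc B). \<phi> (nat \<lfloor>real n powr c\<rfloor>)) = (\<Sum>n=M B..<M (Suc B). \<phi> B)"
    using ps_fiber[OF c] unfolding M_def by (intro sum.cong) auto
  also have "\<dots> = \<phi> B * of_int (ps_gap (1 / c) B)" unfolding gap by simp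
  finally show ?case using Suc unfolding M_def by simp
qed simp

lemma zeckendorf_ps_sum:
  fixes \<omega> :: complex and c :: real
  assumes \<omega>: "norm \<omega> = 1" "\<omega> \<noteq> 1" and c: "1 < c" "c < 4/3"
  obtains \<epsilon> C :: real where "0 < \<epsilon>" "C \<ge> 0"
    "\<And>x. x \<ge> 1 \<Longrightarrow> norm (\<Sum>n=1..nat \<lfloor>x\<rfloor>. \<omega> ^ sZ (nat \<lfloor>real n powr c\<rfloor>)) \<le> C * x powr (1 - \<epsilon>)"
proof -
  define \<gamma> where "\<gamma> = 1 / c"
  have \<gamma>: "3/4 < \<gamma>" "\<gamma> < 1" "0 < \<gamma>" using c by (auto simp: \<gamma>_def field_simps)
  obtain e D where e: "0 < e" "e < \<gamma>" and D: "D \<ge> 0"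
    and bound: "\<And>B. B \<ge> 1 \<Longrightarrow> norm (\<Sum>k<B. \<omega> ^ sZ k * of_int (ps_gap \<gamma> k)) \<le> D * real B powr (\<gamma> - e)"
    using zeckendorf_gap_sum[OF \<omega> \<gamma>(1,2)] by blast
  define \<phi> where "\<phi> = (\<lambda>n. \<omega> ^ sZ (nat \<lfloor>real n powr c\<rfloor>))"
  have phi1: "norm (\<phi> n) = 1" for n using \<omega> by (simp add: \<phi>_def norm_power)
  have main: "norm (\<Sum>n=1..nat \<lfloor>x\<rfloor>. \<phi> n) \<le> (D + 2) * x powr (1 - c * e)" if x: "x \<ge> 1" for x
  proof -
    define B where "B = nat \<lfloor>x powr c\<rfloor>"
    have xc: "x powr c \<ge> 1" using x c by (simp add: ge_one_powr_ge_zero)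
    have B: "B \<ge> 1" "real B \<le> x powr c" "x powr c < real B + 1" unfolding B_def using xc by linarith+
    define M where "M = nat \<lceil>real B powr \<gamma>\<rceil>"
    define N where "N = nat \<lfloor>x\<rfloor>"
    have xinv: "(x powr c) powr \<gamma> = x" using x c by (simp add: powr_powr \<gamma>_def)
    have "real B powr \<gamma> \<le> (x powr c) powr \<gamma>" using B \<gamma> by (intro powr_mono2) auto
    then have hi: "real B powr \<gamma> \<le> x" using xinv by simp
    have "(x powr c) powr \<gamma> < real (Suc B) powr \<gamma>" using B x \<gamma> by (intro powr_less_mono2) auto
    then have lo: "x - 1 < real B powr \<gamma>" using xinv powr_Suc_le(2)[OF \<gamma>(3,2), of B] by simp
    \<comment> \<open>The sum over gaps covers exactly the \<open>n < M\<close>. Compared with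
      \<open>1..N\<close> it may miss \<open>n = N\<close>, and it contains \<open>n = 0\<close>;
      these two terms account for the constant 2.\<close>
    have MN: "N \<le> M" "M \<le> N + 1" unfolding M_def N_def using hi lo x by linarith+
    have N: "{..<N + 1} = insert 0 {1..N}" by auto
    have S: "(\<Sum>n<N + 1. \<phi> n) = \<phi> 0 + (\<Sum>n=1..N. \<phi> n)" unfolding N by simp
    have "(\<Sum>n<N + 1. \<phi> n) = (\<Sum>n<M. \<phi> n) + (\<Sum>n=M..<N + 1. \<phi> n)"
      using MN by (simp add: lessThan_atLeast0 sum.atLeastLessThan_concat del: sum.op_ivl_Suc)
    then have "(\<Sum>n=1..N. \<phi> n) = (\<Sum>n<M. \<phi> n) + ((\<Sum>n=M..<N + 1. \<phi> n) - \<phi> 0)" using S by (simp add: algebra_simps)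
    then have "norm (\<Sum>n=1..N. \<phi> n) \<le> norm (\<Sum>n<M. \<phi> n) + norm ((\<Sum>n=M..<N + 1. \<phi> n) - \<phi> 0)"
      by (metis norm_triangle_ineq)
    also have "norm ((\<Sum>n=M..<N + 1. \<phi> n) - \<phi> 0) \<le> norm (\<Sum>n=M..<N + 1. \<phi> n) + norm (\<phi> 0)" by (rule norm_triangle_ineq4)
    also have "norm (\<Sum>n=M..<N + 1. \<phi> n) \<le> (\<Sum>n=M..<N + 1. 1)" by (rule sum_norm_le) (simp add: phi1)
    also have "\<dots> \<le> 1" using MN by simp
    also have "norm (\<phi> 0) = 1" by (rule phi1)
    also have "(\<Sum>n<M. \<phi> n) = (\<Sum>k<B. \<omega> ^ sZ k * of_int (ps_gap \<gamma> k))"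
      unfolding M_def \<phi>_def \<gamma>_def by (rule sum_ps_gap[OF c(1), symmetric])
    finally have "norm (\<Sum>n=1..N. \<phi> n) \<le> norm (\<Sum>k<B. \<omega> ^ sZ k * of_int (ps_gap \<gamma> k)) + (1 + 1)" by simp
    also have "\<dots> \<le> D * real B powr (\<gamma> - e) + 2" using bound[OF B(1)] by simp
    also have "real B powr (\<gamma> - e) \<le> (x powr c) powr (\<gamma> - e)" using B e by (intro powr_mono2) auto
    also have "(x powr c) powr (\<gamma> - e) = x powr (1 - c * e)" using c by (simp add: powr_powr \<gamma>_def algebra_simps)
    finally have "norm (\<Sum>n=1..N. \<phi> n) \<le> D * x powr (1 - c * e) + 2" using D by (simp add: mult_left_mono)
    moreover have "1 \<le> x powr (1 - c * e)"
    proof (rule ge_one_powr_ge_zero[OF x])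
      have "c * e \<le> c * \<gamma>" using c e by (intro mult_left_mono) auto
      then show "0 \<le> 1 - c * e" using c by (simp add: \<gamma>_def)
    qed
    ultimately show ?thesis unfolding N_def by (simp add: distrib_right)
  qed
  show ?thesis by (rule that[of "c * e" "D + 2"]) (use main e c D in \<open>auto simp: \<phi>_def\<close>)
qed

theorem theorem4:
  fixes m :: nat and a :: int and c :: real
  assumes "m \<ge> 1" and "1 < c" and "c < 4/3"
  shows "\<exists>\<epsilon>>0. \<exists>C. \<forall>x::real. x \<ge> 1 \<longrightarrow>
           \<bar>real (card {n::nat. 1 \<le> n \<and> real n \<le> x \<and>
                 int (sZ (nat \<lfloor>(real n) powr c\<rfloor>)) mod int m = a mod int m}) - x / real m\<bar>
           \<le> C * x powr (1 - \<epsilon>)"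
proof -
  define s where "s = (\<lambda>n. sZ (nat \<lfloor>real n powr c\<rfloor>))"
  define \<omega> where "\<omega> = (\<lambda>h::nat. ee (real h / real m))"
  have "\<exists>e C. e > 0 \<and> C \<ge> 0 \<and> (\<forall>x\<ge>1. norm (\<Sum>n=1..nat \<lfloor>x\<rfloor>. \<omega> h ^ s n) \<le> C * x powr (1 - e))"
    if h: "h \<in> {1..<m}" for h
  proof -
    have "\<omega> h \<noteq> 1"
    proof
      assume "\<omega> h = 1"
      then have "real h / real m \<in> \<int>" unfolding \<omega>_def ee_eq_1_iff .
      then obtain z :: int where z: "real h / real m = of_int z" by (auto elim: Ints_cases)
      have "0 < real h / real m" "real h / real m < 1" using h by auto
      then show False unfolding z by simp
    qed
    then obtain e C where "0 < e" "C \<ge> 0"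
      "\<And>x. x \<ge> 1 \<Longrightarrow> norm (\<Sum>n=1..nat \<lfloor>x\<rfloor>. \<omega> h ^ sZ (nat \<lfloor>real n powr c\<rfloor>)) \<le> C * x powr (1 - e)"
      using zeckendorf_ps_sum[of "\<omega> h" c] assms by (auto simp: \<omega>_def)
    then show ?thesis unfolding s_def by blast
  qed
  then obtain e C where eC: "\<And>h. h \<in> {1..<m} \<Longrightarrow> e h > (0::real) \<and> C h \<ge> (0::real) \<and>
      (\<forall>x\<ge>1. norm (\<Sum>n=1..nat \<lfloor>x\<rfloor>. \<omega> h ^ s n) \<le> C h * x powr (1 - e h))" by metis
  \<comment> \<open>Inserting 1 keeps the set nonempty when \<open>m = 1\<close>, and
    \<open>\<epsilon> \<le> 1\<close> ensures \<open>x powr (1 - \<epsilon>) \<ge> 1\<close>, which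
    absorbs the error from replacing \<open>x\<close> by its integer part.\<close>
  define \<epsilon> where "\<epsilon> = Min (insert 1 (e ` {1..<m}))"
  have \<epsilon>0: "\<epsilon> > 0" unfolding \<epsilon>_def using eC by (subst Min_gr_iff) auto
  have \<epsilon>e: "\<epsilon> \<le> e h" if "h \<in> {1..<m}" for h unfolding \<epsilon>_def using that by (intro Min_le) auto
  have \<epsilon>1: "\<epsilon> \<le> 1" unfolding \<epsilon>_def by (intro Min_le) auto
  define D where "D = (\<Sum>h=1..<m. C h) + 1"
  have main: "\<bar>real (card {n::nat. 1 \<le> n \<and> real n \<le> x \<and> int (s n) mod int m = a mod int m}) - x / real m\<bar> \<le> D * x powr (1 - \<epsilon>)"
    if x: "x \<ge> 1" for x :: real
  proof -
    have m0: "m > 0" using assms by simp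
    define N where "N = nat \<lfloor>x\<rfloor>"
    have xN: "real N \<le> x" "x < real N + 1" unfolding N_def using x by linarith+
    have iff: "int m dvd int (s n) - a \<longleftrightarrow> int (s n) mod int m = a mod int m" for n by (simp add: mod_eq_dvd_iff)
    have set: "{n::nat. 1 \<le> n \<and> real n \<le> x \<and> int (s n) mod int m = a mod int m} = {n \<in> {1..N}. int m dvd int (s n) - a}"
      unfolding iff using xN unfolding N_def by (auto simp: le_nat_iff le_floor_iff)
    have "complex_of_real (real (card {n \<in> {1..N}. int m dvd int (s n) - a})) = (\<Sum>n=1..N. if int m dvd int (s n) - a then 1 else 0)"
      by (simp add: sum.If_cases Int_def)
    also have "\<dots> = (\<Sum>n=1..N. (\<Sum>h<m. ee (real h * of_int (int (s n) - a) / real m)) / of_nat m)"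
      unfolding sum_ee_indicator[OF m0] using m0 by (intro sum.cong) auto
    also have "\<dots> = (\<Sum>n=1..N. \<Sum>h<m. ee (- (real h * of_int a / real m)) * \<omega> h ^ s n) / of_nat m"
    proof -
      have "ee (real h * of_int (int (s n) - a) / real m) = ee (- (real h * of_int a / real m)) * \<omega> h ^ s n" for h n
        unfolding \<omega>_def ee_of_nat_mult[symmetric] ee_add[symmetric] by (simp add: algebra_simps diff_divide_distrib)
      then show ?thesis by (simp add: sum_divide_distrib)
    qed
    also have "(\<Sum>n=1..N. \<Sum>h<m. ee (- (real h * of_int a / real m)) * \<omega> h ^ s n) = (\<Sum>h<m. ee (- (real h * of_int a / real m)) * (\<Sum>n=1..N. \<omega> h ^ s n))"
      unfolding sum_distrib_left by (rule sum.swap)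
    also have "{..<m} = insert 0 {1..<m}" using m0 by auto
    also have "(\<Sum>h\<in>insert 0 {1..<m}. ee (- (real h * of_int a / real m)) * (\<Sum>n=1..N. \<omega> h ^ s n)) = of_nat N + (\<Sum>h=1..<m. ee (- (real h * of_int a / real m)) * (\<Sum>n=1..N. \<omega> h ^ s n))"
      by (simp add: \<omega>_def)
    finally have "complex_of_real (real (card {n \<in> {1..N}. int m dvd int (s n) - a}) - real N / real m)
       = (\<Sum>h=1..<m. ee (- (real h * of_int a / real m)) * (\<Sum>n=1..N. \<omega> h ^ s n)) / of_nat m"
      by (simp add: add_divide_distrib)
    from arg_cong[OF this, of norm]
    have "\<bar>real (card {n \<in> {1..N}. int m dvd int (s n) - a}) - real N / real m\<bar>
       = norm (\<Sum>h=1..<m. ee (- (real h * of_int a / real m)) * (\<Sum>n=1..N. \<omega> h ^ s n)) / real m"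
      by (simp only: norm_divide norm_of_nat norm_of_real)
    also have "\<dots> \<le> norm (\<Sum>h=1..<m. ee (- (real h * of_int a / real m)) * (\<Sum>n=1..N. \<omega> h ^ s n)) / 1"
      using assms(1) by (intro divide_left_mono) auto
    also have "\<dots> \<le> (\<Sum>h=1..<m. C h * x powr (1 - \<epsilon>))"
      unfolding div_by_1
    proof (rule sum_norm_le)
      fix h assume h: "h \<in> {1..<m}"
      have "norm (ee (- (real h * of_int a / real m)) * (\<Sum>n=1..N. \<omega> h ^ s n)) \<le> C h * x powr (1 - e h)"
        using eC[OF h] x unfolding norm_mult N_def by simp
      also have "\<dots> \<le> C h * x powr (1 - \<epsilon>)" using eC[OF h] \<epsilon>e[OF h] x by (intro mult_left_mono powr_mono) auto
      finally show "norm (ee (- (real h * of_int a / real m)) * (\<Sum>n=1..N. \<omega> h ^ s n)) \<le> C h * x powr (1 - \<epsilon>)" .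
    qed
    also have "\<dots> = (\<Sum>h=1..<m. C h) * x powr (1 - \<epsilon>)" by (simp add: sum_distrib_right)
    finally have 1: "\<bar>real (card {n \<in> {1..N}. int m dvd int (s n) - a}) - real N / real m\<bar> \<le> (\<Sum>h=1..<m. C h) * x powr (1 - \<epsilon>)" .
    have "\<bar>real N / real m - x / real m\<bar> = \<bar>real N - x\<bar> / real m" by (simp add: diff_divide_distrib[symmetric] abs_divide)
    also have "\<dots> \<le> 1 / 1" using xN assms(1) by (intro frac_le) auto
    finally have 2: "\<bar>real N / real m - x / real m\<bar> \<le> 1" by simp
    have "1 \<le> x powr (1 - \<epsilon>)" using x \<epsilon>1 by (intro ge_one_powr_ge_zero) auto
    then show ?thesis using 1 2 unfolding set D_def distrib_right by linarith
  qed
  show ?thesis using \<epsilon>0 main unfolding s_def by blast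
qed

end
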